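(* Let $0<T<\infty$, let $r\ge 16$ be an integer, let $u_0\in H^r$ be real-valued and $2\pi$-periodic, and let $C_0>0$. Let $u$ be the solution of the periodic Kawahara equation $u_t+uu_x+u_{xxx}-u_{xxxxx}=0$ with $u(\cdot,0)=u_0$, and for each positive integer $N$ let $U=U_N:[0,\infty)\to S_N$ be the real-valued solution of $$(U_t+UU_x+U_{xxx}-U_{xxxxx},\phi)=0\quad\text{for all }\phi\in S_N,\ t\ge0,\qquad U(0)=P_Nu_0.$$ Then there exist constants $C_1>0$ and $C>0$, independent of $N$ and $\Delta t$, such that the following holds. Let $N,M$ be positive integers, $\Delta t=T/M$, $t_m=m\Delta t$, and suppose $N^5\Delta t\le C_1$. Let $U^0,\dots,U^M\in S_N$ be real-valued and satisfy $$(U^{m+1}-U^{m-1},\phi)+2\Delta t\,(U^mU^m_x+U^m_{xxx}-U^m_{xxxxx},\phi)=0\quad\text{for all }\phi\in S_N,\ 1\le m\le M-1,$$ with $U^0=U(0)$ and $\|U^1-U(\Delta t)\|\le C_0\,\Delta t^2$. Then $$\max_{0\le m\le M}\|u(\cdot,t_m)-U^m\|\le C\left(\frac1{N^r}+\Delta t^2\right).$$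
   Context: All functions are $2\pi$-periodic in $x$; function spaces are on $[-\pi,\pi]$. $(f,g)=\int_{-\pi}^{\pi} f\,\overline{g}\,dx$ is the $L^2$ inner product and $\|\cdot\|$ its norm. With $\hat f(k)=\frac1{2\pi}\int_{-\pi}^{\pi}e^{-ikx}f(x)\,dx$, the periodic Sobolev space $H^r$ has norm $\|f\|_r=\left(\sum_{k\in\mathbb Z}(1+k^2)^r|\hat f(k)|^2\right)^{1/2}$. $S_N=\mathrm{span}\{e^{ikx}: k\in\mathbb Z,\ -N\le k\le N\}$ and $P_N$ is the $L^2$-orthogonal projection onto $S_N$. The semi-discrete problem has a unique real-valued solution for all $t\ge0$. The solution $u$ of the Kawahara equation with data $u_0\in H^r$, $r\ge 5$, is the (known to exist) unique real-valued, $2\pi$-periodic solution in $C([0,\infty);H^r)\cap C^1([0,\infty);H^{r-5})$. Constants may depend on $T$, $r$, $u_0$ and $C_0$. *)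

theory Defs
  imports "HOL-Analysis.Analysis"
begin

text \<open>
  All functions of the space variable have type \<open>real \<Rightarrow> complex\<close>; reality and
  \<open>2\<pi>\<close>-periodicity are stated as predicates. Elements of \<open>L\<^sup>2\<close> and \<open>H\<^sup>r\<close> are represented by
  arbitrary measurable functions, so that equality in these spaces is equality almost everywhere.
\<close>

definition periodic :: "(real \<Rightarrow> complex) \<Rightarrow> bool" where
  "periodic f \<longleftrightarrow> (\<forall>x. f (x + 2 * pi) = f x)"

definition real_valued :: "(real \<Rightarrow> complex) \<Rightarrow> bool" where
  "real_valued f \<longleftrightarrow> (\<forall>x. f x \<in> \<real>)"

definition L2 :: "(real \<Rightarrow> complex) set" where
  "L2 = {f. periodic f \<and> f \<in> borel_measurable (lebesgue_on {-pi..pi}) \<and>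
            integrable (lebesgue_on {-pi..pi}) (\<lambda>x. (cmod (f x))\<^sup>2)}"

definition l2_inner :: "(real \<Rightarrow> complex) \<Rightarrow> (real \<Rightarrow> complex) \<Rightarrow> complex" where
  "l2_inner f g = (LINT x|lebesgue_on {-pi..pi}. f x * cnj (g x))"

definition l2_norm :: "(real \<Rightarrow> complex) \<Rightarrow> real" where
  "l2_norm f = sqrt (Re (l2_inner f f))"

definition fourier_coeff :: "(real \<Rightarrow> complex) \<Rightarrow> int \<Rightarrow> complex" where
  "fourier_coeff f k =
     1 / (2 * of_real pi) * (LINT x|lebesgue_on {-pi..pi}. exp (- \<i> * of_int k * of_real x) * f x)"

definition sobolev :: "nat \<Rightarrow> (real \<Rightarrow> complex) set" where
  "sobolev r = {f \<in> L2. (\<lambda>k::int. (1 + (real_of_int k)\<^sup>2) ^ r * (cmod (fourier_coeff f k))\<^sup>2)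
                          summable_on UNIV}"

definition sobolev_norm :: "nat \<Rightarrow> (real \<Rightarrow> complex) \<Rightarrow> real" where
  "sobolev_norm r f =
     sqrt (\<Sum>\<^sub>\<infinity>k::int. (1 + (real_of_int k)\<^sup>2) ^ r * (cmod (fourier_coeff f k))\<^sup>2)"

definition trig_space :: "nat \<Rightarrow> (real \<Rightarrow> complex) set" where
  "trig_space N =
     {f. \<exists>c::int \<Rightarrow> complex. f = (\<lambda>x. \<Sum>k = - int N..int N. c k * exp (\<i> * of_int k * of_real x))}"

definition trig_proj :: "nat \<Rightarrow> (real \<Rightarrow> complex) \<Rightarrow> (real \<Rightarrow> complex)" where
  "trig_proj N f =
     (THE p. p \<in> trig_space N \<and> (\<forall>\<phi>\<in>trig_space N. l2_inner (\<lambda>x. f x - p x) \<phi> = 0))"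

definition dx :: "(real \<Rightarrow> complex) \<Rightarrow> (real \<Rightarrow> complex)" where
  "dx f = (\<lambda>x. vector_derivative f (at x))"

definition smooth :: "(real \<Rightarrow> complex) \<Rightarrow> bool" where
  "smooth f \<longleftrightarrow> (\<forall>n x. (dx ^^ n) f differentiable (at x))"

text \<open>
  Spatial derivatives of Sobolev functions are weak derivatives on the circle: periodic test
  functions leave no boundary terms.
\<close>

definition weak_deriv :: "nat \<Rightarrow> (real \<Rightarrow> complex) \<Rightarrow> (real \<Rightarrow> complex) \<Rightarrow> bool" where
  "weak_deriv n f g \<longleftrightarrow> f \<in> L2 \<and> g \<in> L2 \<and>
     (\<forall>\<psi>. smooth \<psi> \<and> periodic \<psi> \<longrightarrow>
        (LINT x|lebesgue_on {-pi..pi}. f x * (dx ^^ n) \<psi> x) =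
        (-1) ^ n * (LINT x|lebesgue_on {-pi..pi}. g x * \<psi> x))"

text \<open>
  Curves \<open>[0,\<infinity>) \<rightarrow> X\<close>, written \<open>u t x\<close>: continuity on \<open>[0,\<infinity>)\<close> and the derivative at \<open>t\<close> (one-sided
  at \<open>0\<close>) with respect to the norm \<open>nrm\<close> of \<open>X\<close>. Membership in \<open>X\<close> is required separately.
\<close>

definition curve_continuous ::
  "((real \<Rightarrow> complex) \<Rightarrow> real) \<Rightarrow> (real \<Rightarrow> real \<Rightarrow> complex) \<Rightarrow> bool" where
  "curve_continuous nrm u \<longleftrightarrow>
     (\<forall>t\<ge>0. ((\<lambda>s. nrm (\<lambda>x. u s x - u t x)) \<longlongrightarrow> 0) (at t within {0..}))"

definition has_curve_deriv ::
  "((real \<Rightarrow> complex) \<Rightarrow> real) \<Rightarrow> (real \<Rightarrow> real \<Rightarrow> complex) \<Rightarrow> (real \<Rightarrow> complex) \<Rightarrow> real \<Rightarrow> bool" where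
  "has_curve_deriv nrm u v t \<longleftrightarrow>
     ((\<lambda>s. nrm (\<lambda>x. (u s x - u t x) / of_real (s - t) - v x)) \<longlongrightarrow> 0) (at t within {0..})"

text \<open>
  Used only for \<open>r \<ge> 5\<close>, where the natural-number subtraction \<open>r - 5\<close> is the true one.
\<close>

definition kawahara_solution ::
  "nat \<Rightarrow> (real \<Rightarrow> complex) \<Rightarrow> (real \<Rightarrow> real \<Rightarrow> complex) \<Rightarrow> bool" where
  "kawahara_solution r u0 u \<longleftrightarrow>
     (\<forall>t\<ge>0. u t \<in> sobolev r \<and> real_valued (u t)) \<and>
     curve_continuous (sobolev_norm r) u \<and>
     (AE x in lebesgue_on {-pi..pi}. u 0 x = u0 x) \<and>
     (\<exists>ut. (\<forall>t\<ge>0. ut t \<in> sobolev (r - 5) \<and> has_curve_deriv (sobolev_norm (r - 5)) u (ut t) t) \<and>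
           curve_continuous (sobolev_norm (r - 5)) ut \<and>
           (\<forall>t\<ge>0. \<exists>ux uxxx uxxxxx.
              weak_deriv 1 (u t) ux \<and> weak_deriv 3 (u t) uxxx \<and> weak_deriv 5 (u t) uxxxxx \<and>
              (AE x in lebesgue_on {-pi..pi}. ut t x + u t x * ux x + uxxx x - uxxxxx x = 0)))"

definition semidiscrete_solution ::
  "nat \<Rightarrow> (real \<Rightarrow> complex) \<Rightarrow> (real \<Rightarrow> real \<Rightarrow> complex) \<Rightarrow> bool" where
  "semidiscrete_solution N u0 U \<longleftrightarrow>
     (\<forall>t\<ge>0. U t \<in> trig_space N \<and> real_valued (U t)) \<and>
     U 0 = trig_proj N u0 \<and>
     (\<exists>Ut. \<forall>t\<ge>0. Ut t \<in> trig_space N \<and> has_curve_deriv l2_norm U (Ut t) t \<and>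
        (\<forall>\<phi>\<in>trig_space N.
           l2_inner (\<lambda>x. Ut t x + U t x * dx (U t) x + (dx ^^ 3) (U t) x - (dx ^^ 5) (U t) x) \<phi> = 0))"

definition leapfrog_solution :: "nat \<Rightarrow> nat \<Rightarrow> real \<Rightarrow> (nat \<Rightarrow> real \<Rightarrow> complex) \<Rightarrow> bool" where
  "leapfrog_solution N M dt V \<longleftrightarrow>
     (\<forall>m\<le>M. V m \<in> trig_space N \<and> real_valued (V m)) \<and>
     (\<forall>m\<in>{1..M - 1}. \<forall>\<phi>\<in>trig_space N.
        l2_inner (\<lambda>x. V (m + 1) x - V (m - 1) x) \<phi>
        + 2 * of_real dt *
          l2_inner (\<lambda>x. V m x * dx (V m) x + (dx ^^ 3) (V m) x - (dx ^^ 5) (V m) x) \<phi> = 0)"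

end

theory Submission
  imports Defs
begin

text \<open>
  Everything takes place on Fourier coefficients, where the linear part of the equation is
  multiplication by \<open>\<i>(k\<^sup>3 + k\<^sup>5)\<close>.

  Space. Comparing the Galerkin solution with \<open>P\<^sub>N u\<close> alone loses a factor \<open>N\<close>, because the low modes
  of \<open>\<partial>\<^sub>x (u \<rho>)\<close>, \<open>\<rho> = u - P\<^sub>N u\<close>, are only \<open>O(N\<^bsup>1-r\<^esup>)\<close>. The phase of an interaction \<open>(k - j, j) \<mapsto> k\<close>,
  however, rotates with the frequency \<open>k (k - j) j (3 + 5/2 (k\<^sup>2 + (k - j)\<^sup>2 + j\<^sup>2))\<close>, which is at
  least \<open>\<bar>k\<bar> N\<^sup>3\<close> for \<open>\<bar>j\<bar> > N\<close>. Adding to \<open>P\<^sub>N u\<close> the bilinear correction that integrates this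
  oscillation in time gives a comparison function with residual \<open>O(N\<^bsup>-r\<^esup>)\<close>, and an energy estimate
  concludes. Interactions with \<open>\<bar>j\<bar> > 2N\<close> need no correction: they involve two high modes.

  Time. As \<open>r \<ge> 16\<close>, the spatial estimate and an inverse inequality bound 15 derivatives of the
  Galerkin solutions uniformly in \<open>N\<close>, hence three time derivatives, and the leapfrog truncation error
  is \<open>O(\<Delta>t\<^sup>3)\<close>. Stability uses the leapfrog energy to which the first-order transport term has been
  added, so that this term telescopes up to its symmetric part, which involves no derivative of the
  error. The quadratic term in the error is handled by a bootstrap using \<open>N\<^sup>5 \<Delta>t \<le> C\<^sub>1\<close>.
\<close>

section \<open>Sequences of Fourier coefficients\<close>

text \<open>Two kinds of norms share the work. Errors are measured in l2; known profiles enter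
  through weighted l1 norms of their coefficients, which control derivatives in the sup norm and are
  algebra norms. Passing from l2 to l1 costs one power of N, or one derivative, so the 15
  derivatives behind three time derivatives require r >= 16.

  In space no smallness of the error is needed: its cubic energy contribution vanishes identically,
  so the energy inequality is linear. For leapfrog the quadratic term at level m is tested with the
  levels m + 1 and m - 1, this cancellation is lost, and N^2 times the error must stay bounded. The
  bootstrap closes because the scheme is explicit: the energy of the step before already controls
  the error at level m, the only one that enters quadratically.

  Solutions are given up to null sets and derivatives are weak. The way back from coefficients to
  the L2 norm therefore needs uniqueness of Fourier coefficients for integrable functions, proved
  from Stone-Weierstrass on the circle; only absolutely convergent series occur afterwards.\<close>

definition disp :: "int \<Rightarrow> real" where
  "disp k = real_of_int k ^ 3 + real_of_int k ^ 5"

text \<open>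
  The truncation \<open>K\<close> keeps the sum finite; this is the full convolution as soon as \<open>f\<close> is supported
  in \<open>[-K, K]\<close>.
\<close>

definition conv :: "int \<Rightarrow> (int \<Rightarrow> 'a) \<Rightarrow> (int \<Rightarrow> 'a) \<Rightarrow> int \<Rightarrow> 'a::comm_semiring_0" where
  "conv K f g k = (\<Sum>j=-K..K. f j * g (k - j))"

definition supp :: "int \<Rightarrow> (int \<Rightarrow> 'a::zero) \<Rightarrow> bool" where
  "supp K f \<longleftrightarrow> (\<forall>k. \<bar>k\<bar> > K \<longrightarrow> f k = 0)"

text \<open>The norm of the Wiener algebra, truncated at \<open>K\<close>; it dominates the sup norm
  of the trigonometric sum with these coefficients.\<close>

definition l1 :: "int \<Rightarrow> (int \<Rightarrow> complex) \<Rightarrow> real" where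
  "l1 K f = (\<Sum>k=-K..K. cmod (f k))"

definition l2 :: "int \<Rightarrow> (int \<Rightarrow> complex) \<Rightarrow> real" where
  "l2 K f = L2_set (\<lambda>k. cmod (f k)) {-K..K}"

definition ip :: "int \<Rightarrow> (int \<Rightarrow> complex) \<Rightarrow> (int \<Rightarrow> complex) \<Rightarrow> real" where
  "ip N f g = (\<Sum>k=-N..N. Re (f k * cnj (g k)))"

text \<open>In terms of functions this is \<open>Re (\<partial>\<^sub>x (W f), g) / (2\<pi>)\<close>.\<close>

definition transport :: "int \<Rightarrow> (int \<Rightarrow> complex) \<Rightarrow> (int \<Rightarrow> complex) \<Rightarrow> (int \<Rightarrow> complex) \<Rightarrow> real" where
  "transport N W f g = ip N (\<lambda>k. \<i> * of_int k * conv N f W k) g"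

text \<open>The coefficients of real-valued functions have this symmetry.\<close>

definition herm :: "(int \<Rightarrow> complex) \<Rightarrow> bool" where
  "herm f \<longleftrightarrow> (\<forall>k. f (- k) = cnj (f k))"

text \<open>Preferred to the square root of 1 + k^2 because it is submultiplicative with constant 1
  (\<open>wt_mult\<close>), so that the weighted l1 norms are algebra norms.\<close>

definition wt :: "int \<Rightarrow> real" where
  "wt k = 1 + real_of_int \<bar>k\<bar>"

section \<open>Weights and norms of coefficient sequences\<close>

lemma wt_ge_1: "1 \<le> wt k"
  and wt_pos: "0 < wt k"
  and abs_le_wt: "\<bar>real_of_int k\<bar> \<le> wt k"
  by (auto simp: wt_def)

lemma cmod_wt_mult: "cmod (of_real (wt k) * z) = wt k * cmod z"
  using wt_pos[of k] by (simp add: norm_mult)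

lemma wt_mult: "wt k \<le> wt j * wt (k - j)"
proof -
  have 1: "real_of_int \<bar>k\<bar> \<le> real_of_int \<bar>j\<bar> + real_of_int \<bar>k - j\<bar>"
    by linarith
  have 2: "0 \<le> real_of_int \<bar>j\<bar> * real_of_int \<bar>k - j\<bar>" by simp
  have "wt j * wt (k - j) = 1 + real_of_int \<bar>j\<bar> + real_of_int \<bar>k - j\<bar> + real_of_int \<bar>j\<bar> * real_of_int \<bar>k - j\<bar>"
    unfolding wt_def by algebra
  then show ?thesis using 1 2 unfolding wt_def by linarith
qed

lemma l1_nonneg: "0 \<le> l1 K f"
  and l2_nonneg: "0 \<le> l2 K f"
  by (auto simp: l1_def l2_def sum_nonneg)

lemma l2_power2: "(l2 K f)\<^sup>2 = (\<Sum>k=-K..K. (cmod (f k))\<^sup>2)"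
  by (simp add: l2_def L2_set_def sum_nonneg)

lemma l2_triangle: "l2 K (\<lambda>k. f k + g k) \<le> l2 K f + l2 K g"
proof -
  have "l2 K (\<lambda>k. f k + g k) \<le> L2_set (\<lambda>k. cmod (f k) + cmod (g k)) {-K..K}"
    unfolding l2_def by (rule L2_set_mono) (auto intro: norm_triangle_ineq)
  then show ?thesis using L2_set_triangle_ineq unfolding l2_def by (rule order_trans)
qed

lemma l2_mono:
  assumes "\<And>k. \<bar>k\<bar> \<le> K \<Longrightarrow> cmod (f k) \<le> D * cmod (g k)" "0 \<le> D"
  shows "l2 K f \<le> D * l2 K g"
proof -
  have "l2 K f \<le> L2_set (\<lambda>k. D * cmod (g k)) {-K..K}"
    unfolding l2_def by (rule L2_set_mono) (use assms in auto)
  also have "\<dots> = D * l2 K g" 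
    unfolding l2_def using assms(2) by (simp add: L2_set_right_distrib)
  finally show ?thesis .
qed

lemma l2_cong: "(\<And>k. \<bar>k\<bar> \<le> K \<Longrightarrow> f k = g k) \<Longrightarrow> l2 K f = l2 K g"
  unfolding l2_def by (rule L2_set_cong) auto

lemma l1_mono:
  assumes "\<And>k. \<bar>k\<bar> \<le> K \<Longrightarrow> cmod (f k) \<le> D * cmod (g k)"
  shows "l1 K f \<le> D * l1 K g"
  unfolding l1_def sum_distrib_left by (rule sum_mono) (use assms in auto)

lemma l1_triangle: "l1 K (\<lambda>k. f k + g k) \<le> l1 K f + l1 K g"
  unfolding l1_def sum.distrib[symmetric] by (rule sum_mono) (rule norm_triangle_ineq)

lemma l2_minus: "l2 K (\<lambda>k. f k - g k) \<le> l2 K f + l2 K g"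
  using l2_triangle[of K f "\<lambda>k. - g k"] by (simp add: l2_def)

lemma l1_index_mono: "K \<le> K' \<Longrightarrow> l1 K f \<le> l1 K' f"
  unfolding l1_def by (intro sum_mono2) auto

section \<open>Shifts, convolutions and Young's inequality\<close>

lemma sum_shift_supp_le:
  fixes g :: "int \<Rightarrow> real"
  assumes "supp N g" "\<And>k. 0 \<le> g k"
  shows "(\<Sum>k=-K..K. g (k - j)) \<le> (\<Sum>k=-N..N. g k)"
proof -
  have "(\<Sum>k=-K..K. g (k - j)) = (\<Sum>k\<in>(\<lambda>k. k - j) ` {-K..K}. g k)"
    by (subst sum.reindex) (auto simp: inj_on_def)
  also have "\<dots> = (\<Sum>k\<in>(\<lambda>k. k - j) ` {-K..K} \<inter> {-N..N}. g k)"
    by (rule sum.mono_neutral_right) (use assms(1) in \<open>auto simp: supp_def\<close>)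
  also have "\<dots> \<le> (\<Sum>k=-N..N. g k)"
    by (rule sum_mono2) (use assms in auto)
  finally show ?thesis .
qed

lemma l2_shift:
  assumes "supp N g"
  shows "L2_set (\<lambda>k. cmod (g (k - j))) {-K..K} \<le> l2 N g"
  unfolding l2_def L2_set_def
  by (intro real_sqrt_le_mono sum_shift_supp_le[of N "\<lambda>k. (cmod (g k))\<^sup>2"])
     (use assms in \<open>auto simp: supp_def\<close>)

lemma l1_shift:
  assumes "supp N g"
  shows "(\<Sum>k=-K..K. cmod (g (k - j))) \<le> l1 N g"
  unfolding l1_def
  by (intro sum_shift_supp_le[of N "\<lambda>k. cmod (g k)"])
     (use assms in \<open>auto simp: supp_def\<close>)

lemma l2_supp_le: "supp N f \<Longrightarrow> l2 K f \<le> l2 N f"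
  using l2_shift[of N f 0 K] by (simp add: l2_def)

lemma l1_supp_le: "supp N f \<Longrightarrow> l1 K f \<le> l1 N f"
  using l1_shift[of N f 0 K] by (simp add: l1_def)

text \<open>\<open>conv\<close> restricts only the index of its first factor. When both supports lie
  in [-K, K], restricting j and k - j at the same time loses nothing, and the reflection of j into k
  - j exchanges the factors.\<close>

lemma conv_commute:
  assumes "supp K f" "supp K g"
  shows "conv K f g k = conv K g f k"
proof -
  have 1: "conv K p q k = (\<Sum>j\<in>{-K..K} \<inter> (\<lambda>j. k - j) ` {-K..K}. p j * q (k - j))" if "supp K q" for p q :: "int \<Rightarrow> 'a"
    unfolding conv_def
  proof (rule sum.mono_neutral_right)
    show "\<forall>i\<in>{- K..K} - {- K..K} \<inter> (-) k ` {- K..K}. p i * q (k - i) = 0"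
    proof
      fix i assume "i \<in> {- K..K} - {- K..K} \<inter> (-) k ` {- K..K}"
      then have "k - i \<notin> {-K..K}" by (metis Diff_iff IntI diff_diff_eq2 add_diff_cancel_left' image_eqI)
      then show "p i * q (k - i) = 0" using that by (auto simp: supp_def)
    qed
  qed auto
  have "(\<Sum>j\<in>{-K..K} \<inter> (\<lambda>j. k - j) ` {-K..K}. f j * g (k - j))
      = (\<Sum>j\<in>{-K..K} \<inter> (\<lambda>j. k - j) ` {-K..K}. g j * f (k - j))"
    by (rule sum.reindex_bij_witness[of _ "\<lambda>j. k - j" "\<lambda>j. k - j"]) (auto simp: mult.commute)
  then show ?thesis using 1[OF assms(2), of f] 1[OF assms(1), of g] by simp
qed

text \<open>Every shift of \<open>g\<close> has at most the l2 norm of \<open>g\<close>, so the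
  triangle inequality over j suffices. Only a majorant of \<open>h\<close> is required, which also
  covers bilinear multipliers such as \<open>nform\<close>, whose coefficients depend on both
  modes.\<close>

lemma young_l2:
  assumes "supp K g" "0 \<le> D"
    and "\<And>k. \<bar>k\<bar> \<le> N \<Longrightarrow> cmod (h k) \<le> D * conv K (\<lambda>j. cmod (f j)) (\<lambda>j. cmod (g j)) k"
  shows "l2 N h \<le> D * l1 K f * l2 K g"
proof -
  have S: "L2_set (\<lambda>k. \<Sum>j\<in>J. cmod (f j) * cmod (g (k - j))) {-N..N} \<le> (\<Sum>j\<in>J. cmod (f j)) * l2 K g"
    if "finite J" for J
    using that
  proof induction
    case (insert j J)
    have "L2_set (\<lambda>k. \<Sum>j\<in>insert j J. cmod (f j) * cmod (g (k - j))) {-N..N}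
       = L2_set (\<lambda>k. cmod (f j) * cmod (g (k - j)) + (\<Sum>j\<in>J. cmod (f j) * cmod (g (k - j)))) {-N..N}"
      using insert by simp
    also have "\<dots> \<le> L2_set (\<lambda>k. cmod (f j) * cmod (g (k - j))) {-N..N} + (\<Sum>j\<in>J. cmod (f j)) * l2 K g"
      using L2_set_triangle_ineq insert.IH by (rule order_trans[OF _ add_left_mono])
    also have "L2_set (\<lambda>k. cmod (f j) * cmod (g (k - j))) {-N..N} \<le> cmod (f j) * l2 K g"
      using l2_shift[OF assms(1)] by (simp add: L2_set_right_distrib[symmetric] mult_left_mono)
    finally show ?case using insert by (simp add: algebra_simps)
  qed (simp add: L2_set_def)
  have "l2 N h \<le> L2_set (\<lambda>k. D * (\<Sum>j\<in>{-K..K}. cmod (f j) * cmod (g (k - j)))) {-N..N}"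
    unfolding l2_def by (rule L2_set_mono) (use assms(3) in \<open>auto simp: conv_def\<close>)
  also have "\<dots> = D * L2_set (\<lambda>k. (\<Sum>j\<in>{-K..K}. cmod (f j) * cmod (g (k - j)))) {-N..N}"
    using assms(2) by (simp add: L2_set_right_distrib)
  also have "\<dots> \<le> D * ((\<Sum>j\<in>{-K..K}. cmod (f j)) * l2 K g)"
    by (rule mult_left_mono[OF S assms(2)]) simp
  finally show ?thesis by (simp add: l1_def mult.assoc)
qed

lemma supp_cmod: "supp K f \<Longrightarrow> supp K (\<lambda>k. cmod (f k))"
  by (simp add: supp_def)

lemma young_l2':
  assumes "supp K f" "supp K g" "0 \<le> D"
    and "\<And>k. \<bar>k\<bar> \<le> N \<Longrightarrow> cmod (h k) \<le> D * conv K (\<lambda>j. cmod (f j)) (\<lambda>j. cmod (g j)) k"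
  shows "l2 N h \<le> D * l2 K f * l1 K g"
proof -
  have "l2 N h \<le> D * l1 K g * l2 K f"
    by (rule young_l2[OF assms(1,3)])
       (use assms(4) in \<open>simp add: conv_commute[OF supp_cmod[OF assms(1)] supp_cmod[OF assms(2)]]\<close>)
  then show ?thesis by (simp add: mult_ac)
qed

lemma young_l1:
  assumes "supp K g" "0 \<le> D"
    and "\<And>k. \<bar>k\<bar> \<le> N \<Longrightarrow> cmod (h k) \<le> D * conv K (\<lambda>j. cmod (f j)) (\<lambda>j. cmod (g j)) k"
  shows "l1 N h \<le> D * l1 K f * l1 K g"
proof -
  have "l1 N h \<le> (\<Sum>k=-N..N. D * (\<Sum>j=-K..K. cmod (f j) * cmod (g (k - j))))"
    unfolding l1_def by (rule sum_mono) (use assms(3) in \<open>auto simp: conv_def\<close>)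
  also have "\<dots> = D * (\<Sum>j=-K..K. cmod (f j) * (\<Sum>k=-N..N. cmod (g (k - j))))"
    by (simp add: sum_distrib_left[symmetric] sum.swap[of _ "{-K..K}" "{-N..N}"])
  also have "\<dots> \<le> D * (\<Sum>j=-K..K. cmod (f j) * l1 K g)"
    by (intro mult_left_mono sum_mono l1_shift assms) auto
  finally show ?thesis by (simp add: l1_def sum_distrib_right mult.assoc)
qed

lemma norm_conv_le: "cmod (conv K f g k) \<le> conv K (\<lambda>j. cmod (f j)) (\<lambda>j. cmod (g j)) k"
  unfolding conv_def by (rule order_trans[OF norm_sum]) (simp add: norm_mult)

lemma conv_mono:
  fixes f g f' g' :: "int \<Rightarrow> real"
  assumes "\<And>j. f j \<le> f' j" "\<And>j. g j \<le> g' j" "\<And>j. 0 \<le> f' j" "\<And>j. 0 \<le> g j"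
  shows "conv K f g k \<le> conv K f' g' k"
  unfolding conv_def by (intro sum_mono mult_mono assms)

section \<open>The inner product and the transport form\<close>

lemma ip_cauchy_schwarz: "\<bar>ip N f g\<bar> \<le> l2 N f * l2 N g"
proof -
  have "\<bar>ip N f g\<bar> \<le> (\<Sum>k=-N..N. \<bar>cmod (f k)\<bar> * \<bar>cmod (g k)\<bar>)"
    unfolding ip_def
    by (rule order_trans[OF sum_abs], rule sum_mono)
       (metis abs_Re_le_cmod abs_norm_cancel complex_mod_cnj norm_mult)
  also have "\<dots> \<le> l2 N f * l2 N g" unfolding l2_def by (rule L2_set_mult_ineq)
  finally show ?thesis .
qed

lemma ip_self: "ip N f f = (l2 N f)\<^sup>2"
  unfolding ip_def l2_power2 by (simp add: complex_mult_cnj cmod_def)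

lemma ip_add_left: "ip N (\<lambda>k. f k + g k) h = ip N f h + ip N g h"
  and ip_diff_left: "ip N (\<lambda>k. f k - g k) h = ip N f h - ip N g h"
  and ip_add_right: "ip N h (\<lambda>k. f k + g k) = ip N h f + ip N h g"
  and ip_scale_left: "ip N (\<lambda>k. of_real c * f k) h = c * ip N f h"
  by (simp_all add: ip_def sum.distrib sum_subtractf algebra_simps sum_distrib_left)

lemma ip_commute: "ip N f g = ip N g f"
  unfolding ip_def by (simp add: mult.commute)

lemma ip_cong: "(\<And>k. \<bar>k\<bar> \<le> N \<Longrightarrow> f k = f' k) \<Longrightarrow> (\<And>k. \<bar>k\<bar> \<le> N \<Longrightarrow> g k = g' k) \<Longrightarrow> ip N f g = ip N f' g'"
  unfolding ip_def by (rule sum.cong) auto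

lemma ip_skew: 
  fixes b :: "int \<Rightarrow> real"
  shows "ip N (\<lambda>k. \<i> * of_real (b k) * f k) g = - ip N (\<lambda>k. \<i> * of_real (b k) * g k) f"
  unfolding ip_def by (simp add: sum_negf[symmetric] algebra_simps)

lemma transport_eq:
  "transport N W f g = (\<Sum>k=-N..N. \<Sum>j=-N..N. Re (\<i> * of_int k * W (k - j) * f j * cnj (g k)))"
  unfolding transport_def ip_def conv_def
  by (intro sum.cong refl) (simp add: sum_distrib_left sum_distrib_right Re_sum mult_ac)

text \<open>Exchanging the summation indices turns the factor k of the second form into -j, since
  \<open>herm W\<close> conjugates the kernel. The remaining factor k - j differentiates
  \<open>W\<close> alone, and no derivative of \<open>f\<close> or \<open>g\<close> is left.\<close>

lemma transport_sym:
  assumes "herm W"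
  shows "transport N W f g + transport N W g f
    = ip N (conv N f (\<lambda>k. \<i> * of_int k * W k)) g"
proof -
  have "transport N W g f = (\<Sum>k=-N..N. \<Sum>j=-N..N. Re (\<i> * of_int j * W (j - k) * g k * cnj (f j)))"
    unfolding transport_eq by (rule sum.swap)
  also have "\<dots> = (\<Sum>k=-N..N. \<Sum>j=-N..N. Re (- \<i> * of_int j * W (k - j) * f j * cnj (g k)))"
  proof (intro sum.cong refl)
    fix k j
    have "W (j - k) = cnj (W (k - j))" using assms unfolding herm_def by (metis minus_diff_eq)
    then have "\<i> * of_int j * W (j - k) * g k * cnj (f j) = cnj (- \<i> * of_int j * W (k - j) * f j * cnj (g k))"
      by simp
    then show "Re (\<i> * of_int j * W (j - k) * g k * cnj (f j)) = Re (- \<i> * of_int j * W (k - j) * f j * cnj (g k))"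
      by (metis cnj.simps(1))
  qed
  finally have "transport N W f g + transport N W g f =
     (\<Sum>k=-N..N. \<Sum>j=-N..N. Re (f j * (\<i> * of_int (k - j) * W (k - j)) * cnj (g k)))"
    unfolding transport_eq by (simp add: sum.distrib[symmetric] algebra_simps)
  also have "\<dots> = ip N (conv N f (\<lambda>k. \<i> * of_int k * W k)) g"
    unfolding ip_def conv_def by (simp add: sum_distrib_right Re_sum)
  finally show ?thesis .
qed

text \<open>The derivative is estimated by the highest frequency. The resulting factor N is
  affordable wherever the time step or the smallness of an error can absorb it.\<close>

lemma transport_le:
  assumes "supp N W" "supp N f"
  shows "\<bar>transport N W f g\<bar> \<le> real_of_int N * l1 N W * l2 N f * l2 N g"
proof -
  have "l2 N (\<lambda>k. \<i> * of_int k * conv N f W k) \<le> real_of_int N * l2 N f * l1 N W" if "0 \<le> N"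
  proof (rule young_l2')
    show "cmod (\<i> * of_int k * conv N f W k) \<le> real_of_int N * conv N (\<lambda>j. cmod (f j)) (\<lambda>j. cmod (W j)) k"
      if "\<bar>k\<bar> \<le> N" for k
      using that norm_conv_le[of N f W k] by (auto simp: norm_mult intro!: mult_mono)
  qed (use assms that in auto)
  then have "l2 N (\<lambda>k. \<i> * of_int k * conv N f W k) * l2 N g \<le> real_of_int N * l2 N f * l1 N W * l2 N g" if "0 \<le> N"
    using that by (intro mult_right_mono l2_nonneg) auto
  then have "\<bar>transport N W f g\<bar> \<le> real_of_int N * l2 N f * l1 N W * l2 N g" if "0 \<le> N"
    using that ip_cauchy_schwarz[of N "\<lambda>k. \<i> * of_int k * conv N f W k" g] unfolding transport_def by linarith
  moreover have "\<bar>transport N W f g\<bar> \<le> real_of_int N * l2 N f * l1 N W * l2 N g" if "N < 0"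
    using that by (simp add: transport_def ip_def l1_def)
  ultimately show ?thesis by (cases "0 \<le> N") (auto simp: mult_ac)
qed

lemma transport_sym_le:
  assumes "herm W" "supp N W" "supp N f"
  shows "\<bar>transport N W f g + transport N W g f\<bar> \<le> l1 N (\<lambda>k. of_real (wt k) * W k) * l2 N f * l2 N g"
proof -
  have "l2 N (conv N f (\<lambda>k. \<i> * of_int k * W k)) \<le> 1 * l2 N f * l1 N (\<lambda>k. of_real (wt k) * W k)"
  proof (rule young_l2')
    fix k show "cmod (conv N f (\<lambda>k. \<i> * of_int k * W k) k) \<le> 1 * conv N (\<lambda>j. cmod (f j)) (\<lambda>j. cmod (of_real (wt j) * W j)) k"
      unfolding mult_1 by (rule order_trans[OF norm_conv_le], rule conv_mono)
        (auto simp: norm_mult abs_of_pos[OF wt_pos] abs_le_wt intro!: mult_right_mono)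
  qed (use assms in \<open>auto simp: supp_def\<close>)
  then have "l2 N (conv N f (\<lambda>k. \<i> * of_int k * W k)) * l2 N g \<le> 1 * l2 N f * l1 N (\<lambda>k. of_real (wt k) * W k) * l2 N g"
    by (intro mult_right_mono l2_nonneg)
  then show ?thesis
    using ip_cauchy_schwarz[of N "conv N f (\<lambda>k. \<i> * of_int k * W k)" g]
    unfolding transport_sym[OF assms(1)] by (simp add: mult_ac)
qed

text \<open>The Fourier form of u u_x = (u^2)_x / 2: averaging over the two orders of the factors
  replaces j by k / 2.\<close>

lemma conv_deriv_square:
  fixes a :: "int \<Rightarrow> complex"
  assumes "supp K a"
  shows "conv K a (\<lambda>j. \<i> * of_int j * a j) k = \<i> * of_int k / 2 * conv K a a k"
proof -
  have "conv K a (\<lambda>k. \<i> * of_int k * a k) k = conv K (\<lambda>k. \<i> * of_int k * a k) a k"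
    by (rule conv_commute) (use assms in \<open>auto simp: supp_def\<close>)
  then have "2 * conv K a (\<lambda>k. \<i> * of_int k * a k) k
      = conv K a (\<lambda>k. \<i> * of_int k * a k) k + conv K (\<lambda>k. \<i> * of_int k * a k) a k" by simp
  also have "\<dots> = \<i> * of_int k * conv K a a k"
    unfolding conv_def by (simp add: sum.distrib[symmetric] sum_distrib_left algebra_simps)
  finally show ?thesis by (simp add: mult.commute)
qed

text \<open>By \<open>transport_sym\<close> twice the form equals the pairing of e e_x with e, which
  \<open>conv_deriv_square\<close> identifies as half the form; hence both vanish.\<close>

lemma transport_cubic:
  assumes "herm e" "supp N e"
  shows "transport N e e e = 0"
proof -
  have "ip N (conv N e (\<lambda>k. \<i> * of_int k * e k)) e = ip N (\<lambda>k. of_real (1/2) * (\<i> * of_int k * conv N e e k)) e"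
    by (intro ip_cong) (auto simp: conv_deriv_square[OF assms(2)])
  also have "\<dots> = 1/2 * transport N e e e" unfolding ip_scale_left transport_def ..
  finally show ?thesis using transport_sym[OF assms(1), of N e e] by simp
qed

lemma transport_diff: "transport N (\<lambda>k. W k - W' k) f g = transport N W f g - transport N W' f g"
  and transport_add_right: "transport N W f (\<lambda>k. g k + g' k) = transport N W f g + transport N W f g'"
  unfolding transport_eq by (simp_all add: sum_subtractf[symmetric] sum.distrib[symmetric] algebra_simps)

text \<open>Cauchy-Schwarz gives the square root of 2N + 1; the cruder 2N is a whole power of N, and
  r >= 16 leaves room for exactly this.\<close>

lemma l1_le_l2:
  assumes "1 \<le> N"
  shows "l1 N f \<le> 2 * real_of_int N * l2 N f"
proof -
  have N: "1 \<le> real_of_int N" using assms by simp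
  have "l1 N f \<le> L2_set (\<lambda>k. 1) {-N..N} * l2 N f"
    using L2_set_mult_ineq[of "\<lambda>k. 1" "\<lambda>k. cmod (f k)" "{-N..N}"] by (simp add: l1_def l2_def)
  moreover have "L2_set (\<lambda>k. 1) {-N..N} \<le> sqrt ((2 * real_of_int N)\<^sup>2)"
    unfolding L2_set_def
  proof (rule real_sqrt_le_mono)
    have "1 * 1 \<le> real_of_int N * real_of_int N" "1 * real_of_int N \<le> real_of_int N * real_of_int N"
      by (intro mult_mono; use N in simp)+
    moreover have "(\<Sum>k=-N..N. 1\<^sup>2) = 2 * real_of_int N + 1" using assms by simp
    moreover have "(2 * real_of_int N)\<^sup>2 = 4 * (real_of_int N * real_of_int N)" by (simp add: power2_eq_square)
    ultimately show "(\<Sum>k=-N..N. 1\<^sup>2) \<le> (2 * real_of_int N)\<^sup>2" by linarith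
  qed
  moreover have "sqrt ((2 * real_of_int N)\<^sup>2) = 2 * real_of_int N" by (rule real_sqrt_unique) (use N in auto)
  ultimately show ?thesis using l2_nonneg[of N f] by (metis mult_right_mono order_trans)
qed

lemma l2_le_l1: "l2 N f \<le> l1 N f"
  unfolding l2_def l1_def by (rule L2_set_le_sum) auto

lemma l2_le_sup:
  assumes "0 \<le> N" "\<And>k. \<bar>k\<bar> \<le> N \<Longrightarrow> cmod (f k) \<le> D"
  shows "l2 N f \<le> (2 * real_of_int N + 1) * D"
proof -
  have "l1 N f \<le> (\<Sum>k=-N..N. D)" unfolding l1_def by (rule sum_mono) (use assms in auto)
  then show ?thesis using l2_le_l1[of N f] assms by simp
qed

section \<open>The normal form correction\<close>

text \<open>This is -k divided by the phase of the interaction. The factor k of the phase cancels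
  against the derivative in the nonlinearity, so k = 0 causes no singularity.\<close>

definition res_coeff :: "int \<Rightarrow> int \<Rightarrow> real" where
  "res_coeff k j = - 1 / (real_of_int (k - j) * real_of_int j *
     (3 + 5 / 2 * (real_of_int k ^ 2 + real_of_int (k - j) ^ 2 + real_of_int j ^ 2)))"

text \<open>The cubic part is 3yz(y + z) and the quintic part 5yz(y + z)(y^2 + yz + z^2), where y^2
  + yz + z^2 is half of (y + z)^2 + y^2 + z^2.\<close>

lemma resonance_poly:
  "(y + z) ^ 3 + (y + z) ^ 5 - (z ^ 3 + z ^ 5) - (y ^ 3 + y ^ 5)
      = (y + z) * (z * y * (3 + 5 / 2 * ((y + z) ^ 2 + z ^ 2 + y ^ 2)))" for y z :: real
proof -
  have 3: "(y+z)^3 = y^3+3*y^2*z+3*y*z^2+z^3" by (simp add: power3_eq_cube power2_eq_square algebra_simps)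
  have 2: "(y+z)^2 = y^2+2*y*z+z^2" by (simp add: power2_eq_square algebra_simps)
  have "(y+z)^5 = (y+z)^2 * (y+z)^3" by (simp only: power_add[symmetric], simp)
  also have "\<dots> = (y^2+2*y*z+z^2) * (y^3+3*y^2*z+3*y*z^2+z^3)" unfolding 2 3 ..
  finally have 5: "(y+z)^5 = (y^2+2*y*z+z^2) * (y^3+3*y^2*z+3*y*z^2+z^3)" .
  have 6: "y^5 = y*y*y*y*y" "z^5 = z*z*z*z*z" by (simp_all add: eval_nat_numeral)
  show ?thesis unfolding 5 3 2 6 
    by (simp add: power3_eq_cube power2_eq_square algebra_simps)
qed
lemma resonance_factor:
  "disp k - disp (k - j) - disp j = real_of_int k * (real_of_int (k - j) * real_of_int j *
     (3 + 5 / 2 * (real_of_int k ^ 2 + real_of_int (k - j) ^ 2 + real_of_int j ^ 2)))"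
proof -
  obtain z where k: "k = j + z" by (metis add_diff_cancel_left' diff_add_cancel add.commute)
  have z: "j + z - j = z" by simp
  show ?thesis unfolding k z disp_def of_int_add by (rule resonance_poly)
qed

lemma res_coeff_disp:
  assumes "j \<noteq> 0" "j \<noteq> k"
  shows "res_coeff k j * (disp k - disp (k - j) - disp j) = - real_of_int k"
proof -
  have "0 < 3 + 5 / 2 * (real_of_int k ^ 2 + real_of_int (k - j) ^ 2 + real_of_int j ^ 2)"
    by (intro add_pos_nonneg) auto
  moreover have "real_of_int (k - j) \<noteq> 0" "real_of_int j \<noteq> 0" using assms by auto
  ultimately have "real_of_int (k - j) * real_of_int j *
     (3 + 5 / 2 * (real_of_int k ^ 2 + real_of_int (k - j) ^ 2 + real_of_int j ^ 2)) \<noteq> 0"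
    by (metis mult_eq_0_iff less_irrefl)
  moreover have "- 1 / x * (y * x) = - y" if "x \<noteq> 0" for x y :: real using that by simp
  ultimately show ?thesis unfolding resonance_factor res_coeff_def by blast
qed

text \<open>In the worst case k and j are neighbours; the factor j is still at least N and the
  quadratic factor at least N^2.\<close>

lemma res_coeff_bound:
  assumes "1 \<le> N" "N < \<bar>j\<bar>" "\<bar>k\<bar> \<le> N"
  shows "\<bar>res_coeff k j\<bar> \<le> 1 / real_of_int N ^ 3"
proof -
  have 1: "1 \<le> \<bar>real_of_int (k - j)\<bar>" and 2: "real_of_int N \<le> \<bar>real_of_int j\<bar>"
    using assms by linarith+
  have 3: "real_of_int N ^ 2 \<le> 3 + 5 / 2 * (real_of_int k ^ 2 + real_of_int (k - j) ^ 2 + real_of_int j ^ 2)"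
  proof -
    have "real_of_int N ^ 2 \<le> real_of_int j ^ 2"
      using 2 assms(1) by (intro abs_le_square_iff[THEN iffD1]) auto
    moreover have "0 \<le> real_of_int k ^ 2" "0 \<le> real_of_int (k - j) ^ 2" "0 \<le> real_of_int j ^ 2" by auto
    moreover have "X \<le> C \<Longrightarrow> 0 \<le> A \<Longrightarrow> 0 \<le> B \<Longrightarrow> 0 \<le> C \<Longrightarrow> X \<le> 3 + 5 / 2 * (A + B + C)" for A B C X :: real
      by (simp add: field_simps)
    ultimately show ?thesis by blast
  qed
  have "1 * real_of_int N * real_of_int N ^ 2 \<le> \<bar>real_of_int (k - j)\<bar> * \<bar>real_of_int j\<bar> *
     \<bar>3 + 5 / 2 * (real_of_int k ^ 2 + real_of_int (k - j) ^ 2 + real_of_int j ^ 2)\<bar>"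
    using assms(1) by (intro mult_mono 1 2 order_trans[OF 3 abs_ge_self]) auto
  then have "real_of_int N ^ 3 \<le> \<bar>real_of_int (k - j)\<bar> * \<bar>real_of_int j\<bar> *
     \<bar>3 + 5 / 2 * (real_of_int k ^ 2 + real_of_int (k - j) ^ 2 + real_of_int j ^ 2)\<bar>"
    by (simp add: power3_eq_cube power2_eq_square mult.assoc)
  then show ?thesis
    unfolding res_coeff_def abs_divide abs_mult using assms(1) by (simp add: frac_le)
qed

text \<open>The upper end 2N keeps both modes of a corrected interaction, j and k - j with
  \<bar>k\<bar> \<le> N, inside [-3N, 3N], the range in which the equation for the profile is
  used.\<close>

definition band :: "int \<Rightarrow> int set" where
  "band N = {-2*N..2*N} - {-N..N}"

lemma finite_band [simp]: "finite (band N)" by (simp add: band_def)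

lemma bandD: "j \<in> band N \<Longrightarrow> N < \<bar>j\<bar> \<and> \<bar>j\<bar> \<le> 2 * N" by (auto simp: band_def)

definition nform :: "int \<Rightarrow> (int \<Rightarrow> complex) \<Rightarrow> int \<Rightarrow> complex" where
  "nform N a k = (if \<bar>k\<bar> \<le> N then \<Sum>j\<in>band N. of_real (res_coeff k j) * a (k - j) * a j else 0)"

definition cutoff :: "int \<Rightarrow> (int \<Rightarrow> 'a) \<Rightarrow> int \<Rightarrow> 'a::zero" where
  "cutoff N a k = (if \<bar>k\<bar> \<le> N then a k else 0)"

lemma supp_nform: "supp N (nform N a)" and supp_cutoff: "supp N (cutoff N a)"
  by (auto simp: supp_def nform_def cutoff_def)

lemma supp_mono: "supp N f \<Longrightarrow> N \<le> K \<Longrightarrow> supp K f"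
  by (auto simp: supp_def)

lemma supp_add: "supp N f \<Longrightarrow> supp N g \<Longrightarrow> supp N (\<lambda>k. f k + g k)"
  and supp_diff: "supp N f \<Longrightarrow> supp N g \<Longrightarrow> supp N (\<lambda>k. f k - (g k ::'a::group_add))"
  by (auto simp: supp_def)

lemma herm_add: "herm f \<Longrightarrow> herm g \<Longrightarrow> herm (\<lambda>k. f k + g k)"
  and herm_diff: "herm f \<Longrightarrow> herm g \<Longrightarrow> herm (\<lambda>k. f k - g k)"
  and herm_cutoff: "herm f \<Longrightarrow> herm (cutoff N f)"
  by (auto simp: herm_def cutoff_def)

lemma res_coeff_uminus: "res_coeff (- k) (- j) = res_coeff k j"
proof -
  have "real_of_int (- k - - j) = - real_of_int (k - j)" by simp
  then show ?thesis unfolding res_coeff_def by (simp only: of_int_minus power2_minus mult_minus_left mult_minus_right minus_minus)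
qed

lemma herm_nform: assumes "herm a" shows "herm (nform N a)"
  unfolding herm_def
proof
  fix k
  have "(\<Sum>j\<in>band N. of_real (res_coeff (-k) j) * a (- k - j) * a j)
      = (\<Sum>j\<in>band N. of_real (res_coeff (-k) (-j)) * a (- k - - j) * a (-j))"
    by (rule sum.reindex_bij_witness[of _ uminus uminus]) (auto simp: band_def)
  also have "\<dots> = (\<Sum>j\<in>band N. cnj (of_real (res_coeff k j) * a (k - j) * a j))"
  proof (rule sum.cong)
    fix j
    have "a (- k - - j) = cnj (a (k - j))" "a (- j) = cnj (a j)"
      using assms unfolding herm_def by (metis minus_diff_minus, metis)
    then show "of_real (res_coeff (-k) (-j)) * a (- k - - j) * a (-j) = cnj (of_real (res_coeff k j) * a (k - j) * a j)"
      by (simp only: res_coeff_uminus complex_cnj_mult complex_cnj_complex_of_real)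
  qed simp
  finally show "nform N a (- k) = cnj (nform N a k)"
    unfolding nform_def by simp
qed

text \<open>The product a(k - j) a(j) rotates with disp (k - j) + disp j instead of disp k. By
  \<open>res_coeff_disp\<close> this mismatch produces exactly the band part of the nonlinearity;
  the last sum arises when the time derivative falls on the nonlinear part of a factor.\<close>

lemma nform_time_derivative:
  assumes "\<bar>k\<bar> \<le> N" "1 \<le> N"
    and da: "\<And>k. \<bar>k\<bar> \<le> 3 * N \<Longrightarrow> da k = \<i> * of_real (disp k) * a k - n k"
  shows "(\<Sum>j\<in>band N. of_real (res_coeff k j) * (da (k - j) * a j + a (k - j) * da j))
    = \<i> * of_real (disp k) * nform N a k + \<i> * of_int k * (\<Sum>j\<in>band N. a (k - j) * a j)
      - (\<Sum>j\<in>band N. of_real (res_coeff k j) * (n (k - j) * a j + a (k - j) * n j))"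
proof -
  have "of_real (res_coeff k j) * (da (k - j) * a j + a (k - j) * da j)
     = \<i> * of_real (disp k) * (of_real (res_coeff k j) * a (k - j) * a j)
       + \<i> * of_int k * (a (k - j) * a j)
       - of_real (res_coeff k j) * (n (k - j) * a j + a (k - j) * n j)" if "j \<in> band N" for j
  proof -
    have j: "j \<noteq> 0" "j \<noteq> k" using bandD[OF that] assms by auto
    have "complex_of_real (res_coeff k j * (disp k - disp (k - j) - disp j)) = - of_int k"
      unfolding res_coeff_disp[OF j] by simp
    then have k: "of_int k = - (complex_of_real (res_coeff k j) * (of_real (disp k) - of_real (disp (k - j)) - of_real (disp j)))"
      by simp
    have "da (k - j) = \<i> * of_real (disp (k - j)) * a (k - j) - n (k - j)"
      "da j = \<i> * of_real (disp j) * a j - n j"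
      using bandD[OF that] assms(1) by (auto intro!: da)
    note d = this
    show ?thesis unfolding k d by (simp add: algebra_simps)
  qed
  then show ?thesis using assms(1)
    by (simp add: nform_def sum.distrib sum_subtractf sum_distrib_left)
qed

lemma conv_index:
  assumes "supp N f" "N \<le> K"
  shows "conv K f g k = conv N f g k"
  unfolding conv_def by (rule sum.mono_neutral_right) (use assms in \<open>auto simp: supp_def\<close>)

lemma conv_add_left: "conv K (\<lambda>k. f k + g k) h k = conv K f h k + conv K g h k"
  and conv_add_right: "conv K h (\<lambda>k. f k + g k) k = conv K h f k + conv K h g k"
  unfolding conv_def distrib_left distrib_right sum.distrib by (rule refl)+

lemma conv_square:
  fixes f g :: "int \<Rightarrow> complex"
  assumes "supp K f" "supp K g"
  shows "conv K (\<lambda>k. f k + g k) (\<lambda>k. f k + g k) k = conv K f f k + 2 * conv K f g k + conv K g g k"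
  unfolding conv_add_left conv_add_right conv_commute[OF assms(2,1)] by simp

section \<open>Weighted norms and high-frequency tails\<close>

definition wl1 :: "nat \<Rightarrow> int \<Rightarrow> (int \<Rightarrow> complex) \<Rightarrow> real" where
  "wl1 s K f = l1 K (\<lambda>k. of_real (wt k ^ s) * f k)"

definition wl2 :: "nat \<Rightarrow> int \<Rightarrow> (int \<Rightarrow> complex) \<Rightarrow> real" where
  "wl2 s K f = l2 K (\<lambda>k. of_real (wt k ^ s) * f k)"

lemma cmod_wt_power_mult: "cmod (of_real (wt k ^ s) * z) = wt k ^ s * cmod z"
  using wt_pos[of k] by (simp add: norm_mult norm_power)

lemma wl1_sum: "wl1 s K f = (\<Sum>k=-K..K. wt k ^ s * cmod (f k))"
  unfolding wl1_def l1_def cmod_wt_power_mult ..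

lemma tail_pow:
  assumes "0 < x" "x \<le> wt k"
  shows "cmod z \<le> (1 / x ^ s) * cmod (of_real (wt k ^ s) * z)"
proof -
  have "x ^ s \<le> wt k ^ s" using assms by (intro power_mono) auto
  then have "x ^ s * cmod z \<le> wt k ^ s * cmod z" by (rule mult_right_mono) simp
  then show ?thesis unfolding cmod_wt_power_mult using assms by (simp add: field_simps)
qed

text \<open>The sequence \<open>b\<close> may be any part of \<open>a\<close> that avoids the modes
  of weight below \<open>x\<close>; this serves upper parts and complements of cutoffs
  alike.\<close>

lemma l2_tail:
  assumes "0 < x" "\<And>k. b k = a k \<or> b k = 0" "\<And>k. b k \<noteq> 0 \<Longrightarrow> x \<le> wt k"
  shows "l2 K b \<le> wl2 s K a / x ^ s"
proof -
  have "l2 K b \<le> (1 / x ^ s) * wl2 s K a" unfolding wl2_def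
  proof (rule l2_mono)
    fix k show "cmod (b k) \<le> 1 / x ^ s * cmod (complex_of_real (wt k ^ s) * a k)"
      using tail_pow[of x k "a k" s] assms(2)[of k] assms(3)[of k] assms(1) by (cases "b k = 0") auto
  qed (use assms in auto)
  then show ?thesis by simp
qed

lemma l1_tail:
  assumes "0 < x" "\<And>k. b k = a k \<or> b k = 0" "\<And>k. b k \<noteq> 0 \<Longrightarrow> x \<le> wt k"
  shows "l1 K b \<le> wl1 s K a / x ^ s"
proof -
  have "l1 K b \<le> (1 / x ^ s) * wl1 s K a" unfolding wl1_def
  proof (rule l1_mono)
    fix k show "cmod (b k) \<le> 1 / x ^ s * cmod (complex_of_real (wt k ^ s) * a k)"
      using tail_pow[of x k "a k" s] assms(2)[of k] assms(3)[of k] assms(1) by (cases "b k = 0") auto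
  qed
  then show ?thesis by simp
qed

lemma wl1_mono: "s \<le> s' \<Longrightarrow> wl1 s K f \<le> wl1 s' K f"
  unfolding wl1_sum by (intro sum_mono mult_right_mono power_increasing) (auto simp: wt_ge_1)

lemma wl1_0: "wl1 0 K f = l1 K f" by (simp add: wl1_def)

lemma wl1_nonneg: "0 \<le> wl1 s K f" and wl2_nonneg: "0 \<le> wl2 s K f"
  by (auto simp: wl1_def wl2_def l1_nonneg l2_nonneg)

text \<open>
  Here \<open>a\<close> stands for the coefficients of the exact solution cut off at some huge \<open>K\<close>, so that only finite
  sums occur, and \<open>n\<close> for those of \<open>u u\<^sub>x\<close>, which therefore agree with the convolution only up to an error
  that is made small by the choice of \<open>K\<close>.
\<close>

locale profile =
  fixes N K :: int and r :: nat and M :: real and a n :: "int \<Rightarrow> complex"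
  assumes N1: "1 \<le> N" and NK: "3 * N \<le> K" and M1: "1 \<le> M" and suppa: "supp K a"
    and wl1a: "wl1 1 K a \<le> M" and wl2a: "wl2 r K a \<le> M"
    and n_close: "\<And>k. \<bar>k\<bar> \<le> 3 * N \<Longrightarrow>
      cmod (n k - \<i> * of_int k / 2 * conv K a a k) \<le> 1 / real_of_int N ^ (r + 1)"
begin

abbreviation (input) "rN \<equiv> real_of_int N"
abbreviation (input) "P \<equiv> 1 / rN ^ r"

definition above :: "int \<Rightarrow> int \<Rightarrow> complex" where
  "above L k = (if L \<le> \<bar>k\<bar> then a k else 0)"

section \<open>High-frequency parts and the size of the correction\<close>

lemma rN1: "1 \<le> rN" using N1 by simp

lemma P0: "0 \<le> P" using rN1 by simp

lemma supp_above: "supp K (above L)"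
  using suppa by (simp add: supp_def above_def)

lemma l2_above:
  assumes "N \<le> L"
  shows "l2 K (above L) \<le> M * P"
proof -
  have "l2 K (above L) \<le> wl2 r K a / rN ^ r"
    by (rule l2_tail) (use N1 assms in \<open>auto simp: above_def wt_def split: if_splits\<close>)
  also have "\<dots> \<le> M / rN ^ r" by (intro divide_right_mono wl2a) (use N1 in auto)
  finally show ?thesis by simp
qed

lemma l1_above:
  assumes "N \<le> L"
  shows "l1 K (above L) \<le> M / rN"
proof -
  have "l1 K (above L) \<le> wl1 1 K a / rN ^ 1"
    by (rule l1_tail) (use N1 assms in \<open>auto simp: above_def wt_def split: if_splits\<close>)
  also have "\<dots> \<le> M / rN ^ 1" by (intro divide_right_mono wl1a) (use N1 in auto)
  finally show ?thesis by simp
qed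

lemma l1a: "l1 K a \<le> M"
  using wl1_mono[of 0 1 K a] wl1a by (simp add: wl1_0)

lemma l1_above': "N \<le> L \<Longrightarrow> l1 K (above L) \<le> M"
proof -
  assume "N \<le> L"
  from l1_above[OF this] have "l1 K (above L) \<le> M / rN" .
  also have "\<dots> \<le> M / 1" by (rule divide_left_mono) (use rN1 M1 in auto)
  finally show ?thesis by simp
qed

lemma l1_cutoff: "l1 K (cutoff N a) \<le> M"
proof -
  have "l1 K (cutoff N a) \<le> 1 * l1 K a" by (rule l1_mono) (simp add: cutoff_def)
  then show ?thesis using l1a by simp
qed

lemma freq_powers: "rN * (1 / rN ^ 3) \<le> 1" "1 / rN ^ 3 \<le> 1" "0 \<le> 1 / rN ^ 3" "rN * (1 / rN) = 1"
proof -
  have "rN ^ 1 \<le> rN ^ 3" by (rule power_increasing) (use rN1 in auto)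
  then show "rN * (1 / rN ^ 3) \<le> 1" using rN1 by simp
qed (use rN1 in \<open>auto simp: one_le_power\<close>)

lemma nform_le:
  assumes "\<bar>k\<bar> \<le> N"
  shows "cmod (nform N a k) \<le> (1 / rN ^ 3) * conv K (\<lambda>j. cmod (above (N + 1) j)) (\<lambda>j. cmod (a j)) k"
proof -
  have "cmod (nform N a k) \<le> (\<Sum>j\<in>band N. cmod (of_real (res_coeff k j) * a (k - j) * a j))"
    using assms by (simp add: nform_def norm_sum)
  also have "\<dots> \<le> (\<Sum>j\<in>band N. (1 / rN ^ 3) * (cmod (above (N + 1) j) * cmod (a (k - j))))"
  proof (rule sum_mono)
    fix j assume j: "j \<in> band N"
    have "\<bar>res_coeff k j\<bar> * (cmod (a j) * cmod (a (k - j))) \<le> (1 / rN ^ 3) * (cmod (a j) * cmod (a (k - j)))"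
      by (rule mult_right_mono[OF res_coeff_bound]) (use N1 bandD[OF j] assms in auto)
    then show "cmod (of_real (res_coeff k j) * a (k - j) * a j) \<le> (1 / rN ^ 3) * (cmod (above (N + 1) j) * cmod (a (k - j)))"
      using bandD[OF j] by (simp add: norm_mult above_def mult_ac)
  qed
  also have "\<dots> \<le> (\<Sum>j=-K..K. (1 / rN ^ 3) * (cmod (above (N + 1) j) * cmod (a (k - j))))"
    by (rule sum_mono2) (use NK N1 in \<open>auto simp: band_def\<close>)
  finally show ?thesis by (simp add: conv_def sum_distrib_left)
qed

lemma l2_nform: "l2 N (nform N a) \<le> (1 / rN ^ 3) * (M * P) * M"
proof -
  have "l2 N (nform N a) \<le> (1 / rN ^ 3) * l2 K (above (N + 1)) * l1 K a"
    by (rule young_l2'[OF supp_above suppa _ nform_le]) (use N1 in auto)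
  also have "\<dots> \<le> (1 / rN ^ 3) * (M * P) * M"
    by (intro mult_mono mult_left_mono l2_above l1a mult_nonneg_nonneg l1_nonneg l2_nonneg) (use N1 M1 in auto)
  finally show ?thesis .
qed

lemma l1_nform: "l1 N (nform N a) \<le> (1 / rN ^ 3) * M * M"
proof -
  have "l1 N (nform N a) \<le> (1 / rN ^ 3) * l1 K (above (N + 1)) * l1 K a"
    by (rule young_l1[OF suppa _ nform_le]) (use N1 in auto)
  also have "\<dots> \<le> (1 / rN ^ 3) * M * M"
    by (intro mult_mono mult_left_mono l1_above' l1a mult_nonneg_nonneg l1_nonneg l2_nonneg) (use N1 M1 in auto)
  finally show ?thesis .
qed

lemma suppK_nform: "supp K (nform N a)" and suppK_cutoff: "supp K (cutoff N a)"
  using supp_nform[of N a] supp_cutoff[of N a] NK N1 by (auto intro: supp_mono)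

lemma l2K_nform: "l2 K (nform N a) \<le> (1 / rN ^ 3) * (M * P) * M"
  using l2_supp_le[OF supp_nform] l2_nform by (rule order_trans)

lemma l1K_nform: "l1 K (nform N a) \<le> (1 / rN ^ 3) * M * M"
  using l1_supp_le[OF supp_nform] l1_nform by (rule order_trans)

section \<open>The comparison function and its residual\<close>

definition comparison :: "int \<Rightarrow> complex" where
  "comparison k = cutoff N a k + nform N a k"

lemma comparison_eq: "comparison = (\<lambda>k. cutoff N a k + nform N a k)"
  by (rule ext) (rule comparison_def)

lemma supp_comparison: "supp N comparison"
  unfolding comparison_eq by (rule supp_add[OF supp_cutoff supp_nform])

lemma M_pow: "M ^ 2 \<le> M ^ 4" "M ^ 3 \<le> M ^ 4" "M \<le> M ^ 4" "1 \<le> M ^ 4" "0 \<le> M ^ 4"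
  using M1 power_increasing[of 1 4 M] by (auto intro: power_increasing one_le_power)

text \<open>The terms in which differentiating the correction hits the nonlinearity; they are cubic
  in the solution.\<close>

definition quadr_rest :: "int \<Rightarrow> complex" where
  "quadr_rest k = (\<Sum>j\<in>band N. of_real (res_coeff k j) * (n (k - j) * a j + a (k - j) * n j))"

text \<open>The defect with which \<open>comparison\<close> solves the Galerkin system, see
  \<open>deriv_cutoff_nform\<close>.\<close>

definition residual :: "int \<Rightarrow> complex" where
  "residual k = - n k + \<i> * of_int k * (\<Sum>j\<in>band N. a (k - j) * a j) - quadr_rest k
     + \<i> * of_int k / 2 * conv N comparison comparison k"

text \<open>The band sum removes every low-high interaction up to 2N, but it carries the factor ik
  where the nonlinearity has ik/2, so pairs of two high modes are subtracted twice; the term with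
  \<open>above (N + 1)\<close> in both places gives one half back. What is left has two high
  factors, or a factor \<open>nform\<close>, or is cubic.\<close>

lemma residual_split:
  assumes "\<bar>k\<bar> \<le> N"
  shows "residual k = - (n k - \<i> * of_int k / 2 * conv K a a k)
    - \<i> * of_int k * conv K (above (2 * N + 1)) (above N) k
    + \<i> * of_int k / 2 * conv K (above (N + 1)) (above (N + 1)) k
    + \<i> * of_int k * conv K (cutoff N a) (nform N a) k
    + \<i> * of_int k / 2 * conv K (nform N a) (nform N a) k - quadr_rest k"
proof -
  have a: "a = (\<lambda>k. cutoff N a k + above (N + 1) k)"
    by (auto simp: cutoff_def above_def)
  have 1: "conv K a a k = conv K (cutoff N a) (cutoff N a) k
     + 2 * conv K (cutoff N a) (above (N + 1)) k + conv K (above (N + 1)) (above (N + 1)) k"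
    by (subst (1 2) a) (rule conv_square[OF suppK_cutoff supp_above])
  have 2: "conv K (above (N + 1)) a k = conv K (cutoff N a) (above (N + 1)) k + conv K (above (N + 1)) (above (N + 1)) k"
    by (subst (1) a) (simp only: conv_add_right conv_commute[OF supp_above suppK_cutoff])
  \<comment> \<open>If \<bar>k\<bar> \<le> N and \<bar>j\<bar> > 2N, the partner k - j lies above N
    as well, so replacing \<open>a\<close> by \<open>above N\<close> changes nothing.\<close>
  have 3: "conv K (above (N + 1)) a k = (\<Sum>j\<in>band N. a (k - j) * a j) + conv K (above (2 * N + 1)) (above N) k"
  proof -
    have "conv K (above (N + 1)) a k = (\<Sum>j=-K..K. (if j \<in> band N then a (k - j) * a j else 0) + above (2 * N + 1) j * above N (k - j))"
      unfolding conv_def by (rule sum.cong) (use assms in \<open>auto simp: above_def band_def\<close>)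
    also have "\<dots> = (\<Sum>j\<in>{-K..K} \<inter> band N. a (k - j) * a j) + conv K (above (2 * N + 1)) (above N) k"
      unfolding conv_def by (simp add: sum.distrib sum.inter_restrict)
    also have "{-K..K} \<inter> band N = band N" using NK N1 by (auto simp: band_def)
    finally show ?thesis .
  qed
  have 4: "conv N comparison comparison k = conv K (cutoff N a) (cutoff N a) k
     + 2 * conv K (cutoff N a) (nform N a) k + conv K (nform N a) (nform N a) k"
  proof -
    have "conv N comparison comparison k = conv K comparison comparison k"
      by (rule conv_index[OF supp_comparison, symmetric]) (use NK N1 in simp)
    also have "\<dots> = conv K (cutoff N a) (cutoff N a) k
     + 2 * conv K (cutoff N a) (nform N a) k + conv K (nform N a) (nform N a) k"
      unfolding comparison_eq by (rule conv_square[OF suppK_cutoff suppK_nform])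
    finally show ?thesis .
  qed
  from 2 3 have 5: "(\<Sum>j\<in>band N. a (k - j) * a j) = conv K (cutoff N a) (above (N + 1)) k
    + conv K (above (N + 1)) (above (N + 1)) k - conv K (above (2 * N + 1)) (above N) k"
    by (simp add: algebra_simps)
  show ?thesis unfolding residual_def 1 4 5 by (simp add: field_simps)
qed

text \<open>The power r + 1 in \<open>n_close\<close> pays for the sum over the 2N + 1
  modes.\<close>

lemma n_l2_small: "l2 N (\<lambda>k. n k - \<i> * of_int k / 2 * conv K a a k) \<le> 3 * P"
proof -
  have "l2 N (\<lambda>k. n k - \<i> * of_int k / 2 * conv K a a k) \<le> (2 * rN + 1) * (1 / rN ^ (r + 1))"
    by (rule l2_le_sup) (use N1 n_close in auto)
  also have "\<dots> \<le> (3 * rN) * (1 / rN ^ (r + 1))"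
    by (rule mult_right_mono) (use rN1 in auto)
  also have "\<dots> = 3 * P" using rN1 by (simp add: field_simps)
  finally show ?thesis .
qed

text \<open>The factor N lost to the derivative is regained in each application: two high factors
  supply the 1/N of \<open>l1_above\<close>, and otherwise \<open>nform\<close> supplies
  N^(-3).\<close>

lemma l2_deriv_conv:
  assumes "supp K f" "supp K g" "l2 K f \<le> A" "l1 K g \<le> B" "\<bar>c\<bar> \<le> 1"
  shows "l2 N (\<lambda>k. \<i> * of_int k * of_real c * conv K f g k) \<le> rN * A * B"
proof -
  have "l2 N (\<lambda>k. \<i> * of_int k * of_real c * conv K f g k) \<le> rN * l2 K f * l1 K g"
  proof (rule young_l2'[OF assms(1,2)])
    fix k assume k: "\<bar>k\<bar> \<le> N"
    have "cmod (\<i> * of_int k * of_real c * conv K f g k) = (\<bar>real_of_int k\<bar> * \<bar>c\<bar>) * cmod (conv K f g k)"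
      by (simp add: norm_mult)
    also have "\<dots> \<le> (rN * 1) * conv K (\<lambda>j. cmod (f j)) (\<lambda>j. cmod (g j)) k"
      by (intro mult_mono norm_conv_le) (use k assms(5) in auto)
    finally show "cmod (\<i> * of_int k * of_real c * conv K f g k) \<le> rN * conv K (\<lambda>j. cmod (f j)) (\<lambda>j. cmod (g j)) k"
      by simp
  qed (use N1 in auto)
  also have "\<dots> \<le> rN * A * B"
    by (intro mult_mono mult_left_mono assms mult_nonneg_nonneg l1_nonneg l2_nonneg order_trans[OF l2_nonneg assms(3)]) (use N1 in auto)
  finally show ?thesis .
qed

text \<open>The weight distributes the derivative over both factors. The constant is 1 for the
  convolution plus 7 for the error \<open>n_close\<close> on 6N + 1 modes.\<close>

lemma n_wl1: "l1 (3 * N) n \<le> 8 * M ^ 2"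
proof -
  have "l1 (3 * N) (\<lambda>k. \<i> * of_int k / 2 * conv K a a k) \<le> 1 * wl1 1 K a * wl1 1 K a"
    unfolding wl1_def
  proof (rule young_l1)
    fix k
    have "cmod (\<i> * of_int k / 2 * conv K a a k) \<le> wt k * conv K (\<lambda>j. cmod (a j)) (\<lambda>j. cmod (a j)) k"
      unfolding norm_mult
      by (intro mult_mono norm_conv_le) (use abs_le_wt[of k] wt_pos[of k] in \<open>auto simp: norm_mult norm_divide\<close>)
    also have "\<dots> \<le> conv K (\<lambda>j. wt j * cmod (a j)) (\<lambda>j. wt j * cmod (a j)) k"
      unfolding conv_def sum_distrib_left
    proof (rule sum_mono)
      fix j show "wt k * (cmod (a j) * cmod (a (k - j))) \<le> wt j * cmod (a j) * (wt (k - j) * cmod (a (k - j)))"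
        using mult_right_mono[OF wt_mult[of k j], of "cmod (a j) * cmod (a (k - j))"] by (simp add: mult_ac)
    qed
    finally show "cmod (\<i> * of_int k / 2 * conv K a a k) \<le> 1 * conv K (\<lambda>j. cmod (of_real (wt j ^ 1) * a j)) (\<lambda>j. cmod (of_real (wt j ^ 1) * a j)) k"
      unfolding cmod_wt_power_mult by simp
  qed (use suppa in \<open>auto simp: supp_def\<close>)
  also have "\<dots> \<le> 1 * M * M"
    by (intro mult_mono wl1a) (use M1 wl1_nonneg[of 1 K a] in auto)
  finally have 1: "l1 (3 * N) (\<lambda>k. \<i> * of_int k / 2 * conv K a a k) \<le> M ^ 2" by (simp add: power2_eq_square)
  have "l1 (3 * N) (\<lambda>k. n k - \<i> * of_int k / 2 * conv K a a k) \<le> (\<Sum>k=-(3*N)..3*N. 1 / rN ^ (r + 1))"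
    unfolding l1_def by (rule sum_mono) (use n_close in auto)
  also have "\<dots> = (6 * rN + 1) * (1 / rN ^ (r + 1))" using N1 by simp
  also have "\<dots> \<le> (7 * rN) * (1 / rN ^ (r + 1))"
    by (rule mult_right_mono) (use rN1 in auto)
  also have "\<dots> = 7 * P" using rN1 by (simp add: field_simps)
  also have "\<dots> \<le> 7 * M ^ 2"
    using rN1 M1 by (intro mult_left_mono) (auto intro: order_trans[of _ 1] one_le_power)
  finally show ?thesis
    using l1_triangle[of "3*N" "\<lambda>k. n k - \<i> * of_int k / 2 * conv K a a k" "\<lambda>k. \<i> * of_int k / 2 * conv K a a k"] 1
    by simp
qed

definition nhigh :: "int \<Rightarrow> complex" where
  "nhigh k = (if N < \<bar>k\<bar> \<and> \<bar>k\<bar> \<le> 2 * N then n k else 0)"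

text \<open>Halving the threshold costs 2^r; this is the origin of that factor in the later
  constants.\<close>

lemma half_above: "l2 K (\<lambda>k. if N < 2 * \<bar>k\<bar> then a k else 0) \<le> 2 ^ r * (M * P)"
proof -
  have "l2 K (\<lambda>k. if N < 2 * \<bar>k\<bar> then a k else 0) \<le> wl2 r K a / (rN / 2) ^ r"
  proof (rule l2_tail)
    fix k assume "(if N < 2 * \<bar>k\<bar> then a k else 0) \<noteq> 0"
    then show "rN / 2 \<le> wt k" by (auto simp: wt_def split: if_splits)
  qed (use N1 in auto)
  also have "\<dots> \<le> M / (rN / 2) ^ r" by (intro divide_right_mono wl2a) (use N1 in auto)
  finally show ?thesis by (simp add: power_divide field_simps)
qed

text \<open>Here the derivative in the nonlinearity really costs a factor N. That is harmless,
  because \<open>nhigh\<close> only occurs together with \<open>res_coeff\<close>, which is of order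
  N^(-3).\<close>

lemma l2_nhigh: "l2 K nhigh \<le> rN * (9 * 2 ^ r * M ^ 2 * P)"
proof -
  let ?b = "\<lambda>k. if N < 2 * \<bar>k\<bar> then a k else 0"
  have sb: "supp K ?b" using suppa by (simp add: supp_def)
  have maj: "cmod (\<i> * of_int k / 2 * conv K a a k) \<le> 2 * rN * conv K (\<lambda>j. cmod (?b j)) (\<lambda>j. cmod (a j)) k"
    if k: "N < \<bar>k\<bar>" "\<bar>k\<bar> \<le> 2 * N" for k
  proof -
    have "conv K (\<lambda>j. cmod (a j)) (\<lambda>j. cmod (a j)) k \<le> conv K (\<lambda>j. cmod (?b j)) (\<lambda>j. cmod (a j)) k + conv K (\<lambda>j. cmod (a j)) (\<lambda>j. cmod (?b j)) k"
      unfolding conv_def sum.distrib[symmetric]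
    proof (rule sum_mono)
      fix j
      \<comment> \<open>one of two modes that add up to \<open>\<bar>k\<bar> > N\<close> exceeds \<open>N / 2\<close>\<close>
      have "\<bar>k\<bar> \<le> \<bar>j\<bar> + \<bar>k - j\<bar>" by linarith
      then have "N < 2 * \<bar>j\<bar> \<or> N < 2 * \<bar>k - j\<bar>"
        using k(1) by (cases "N < 2 * \<bar>j\<bar>") auto
      then show "cmod (a j) * cmod (a (k - j)) \<le> cmod (?b j) * cmod (a (k - j)) + cmod (a j) * cmod (?b (k - j))"
        by auto
    qed
    also have "conv K (\<lambda>j. cmod (a j)) (\<lambda>j. cmod (?b j)) k = conv K (\<lambda>j. cmod (?b j)) (\<lambda>j. cmod (a j)) k"
      by (rule conv_commute[OF supp_cmod[OF suppa] supp_cmod[OF sb]])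
    finally have "cmod (conv K a a k) \<le> 2 * conv K (\<lambda>j. cmod (?b j)) (\<lambda>j. cmod (a j)) k"
      using norm_conv_le[of K a a k] by simp
    moreover have "cmod (\<i> * of_int k / 2) \<le> rN" using k by (simp add: norm_mult norm_divide)
    ultimately have "cmod (\<i> * of_int k / 2) * cmod (conv K a a k) \<le> rN * (2 * conv K (\<lambda>j. cmod (?b j)) (\<lambda>j. cmod (a j)) k)"
      by (intro mult_mono) (use N1 in auto)
    then show ?thesis by (simp add: norm_mult)
  qed
  have "l2 (2 * N) (\<lambda>k. if N < \<bar>k\<bar> then \<i> * of_int k / 2 * conv K a a k else 0) \<le> 2 * rN * l2 K ?b * l1 K a"
  proof (rule young_l2'[OF sb suppa])
    fix k assume k: "\<bar>k\<bar> \<le> 2 * N"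
    have "0 \<le> 2 * rN * conv K (\<lambda>j. cmod (?b j)) (\<lambda>j. cmod (a j)) k"
      unfolding conv_def by (intro mult_nonneg_nonneg sum_nonneg) (use N1 in auto)
    then show "cmod (if N < \<bar>k\<bar> then \<i> * of_int k / 2 * conv K a a k else 0)
        \<le> 2 * rN * conv K (\<lambda>j. cmod (?b j)) (\<lambda>j. cmod (a j)) k"
      using maj[of k] k by (cases "N < \<bar>k\<bar>") (simp_all only: if_True if_False norm_zero)
  qed (use N1 in simp)
  also have "\<dots> \<le> 2 * rN * (2 ^ r * (M * P)) * M"
    by (intro mult_mono mult_left_mono half_above l1a mult_nonneg_nonneg l1_nonneg l2_nonneg) (use N1 M1 in auto)
  finally have 1: "l2 (2 * N) (\<lambda>k. if N < \<bar>k\<bar> then \<i> * of_int k / 2 * conv K a a k else 0) \<le> 2 * rN * (2 ^ r * (M * P)) * M" .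
  have "l2 (2 * N) (\<lambda>k. if N < \<bar>k\<bar> then n k - \<i> * of_int k / 2 * conv K a a k else 0) \<le> (2 * real_of_int (2 * N) + 1) * (1 / rN ^ (r + 1))"
    by (rule l2_le_sup) (use N1 n_close in auto)
  also have "\<dots> \<le> (5 * rN) * (1 / rN ^ (r + 1))"
    by (rule mult_right_mono) (use rN1 in auto)
  also have "\<dots> = 5 * P" using rN1 by (simp add: field_simps)
  finally have 2: "l2 (2 * N) (\<lambda>k. if N < \<bar>k\<bar> then n k - \<i> * of_int k / 2 * conv K a a k else 0) \<le> 5 * P" .
  have "l2 K nhigh \<le> l2 (2 * N) nhigh"
    by (rule l2_supp_le) (auto simp: supp_def nhigh_def)
  also have "\<dots> = l2 (2 * N) (\<lambda>k. (if N < \<bar>k\<bar> then n k - \<i> * of_int k / 2 * conv K a a k else 0) +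
     (if N < \<bar>k\<bar> then \<i> * of_int k / 2 * conv K a a k else 0))"
    by (rule l2_cong) (auto simp: nhigh_def)
  also have "\<dots> \<le> 5 * P + 2 * rN * (2 ^ r * (M * P)) * M"
    by (rule order_trans[OF l2_triangle add_mono[OF 2 1]])
  also have "5 * P \<le> rN * (7 * 2 ^ r * M ^ 2 * P)"
  proof -
    have "5 * 1 * 1 * P \<le> 7 * 2 ^ r * M ^ 2 * P"
      by (intro mult_right_mono mult_mono P0) (use M1 in \<open>auto intro: one_le_power\<close>)
    then have h: "5 * P \<le> 7 * 2 ^ r * M ^ 2 * P" by simp
    have "1 * (5 * P) \<le> rN * (7 * 2 ^ r * M ^ 2 * P)"
      by (rule mult_mono[OF rN1 h]) (use rN1 in auto)
    then show ?thesis by simp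
  qed
  finally show ?thesis by (simp add: power2_eq_square algebra_simps)
qed

text \<open>The smallness comes from the index j in the band. In \<open>q1\<close> it belongs to
  \<open>a\<close>, and n(k - j) needs only an l1 bound; in \<open>q2\<close> it belongs to
  \<open>n\<close>, and the N lost in \<open>l2_nhigh\<close> is absorbed by the multiplier. The
  constant is 8 + 9.\<close>

lemma l2_quadr_rest: "l2 N quadr_rest \<le> 17 * 2 ^ r * M ^ 3 * P"
proof -
  define q1 where "q1 k = (\<Sum>j\<in>band N. of_real (res_coeff k j) * (n (k - j) * a j))" for k
  define q2 where "q2 k = (\<Sum>j\<in>band N. of_real (res_coeff k j) * (a (k - j) * n j))" for k
  have q: "quadr_rest = (\<lambda>k. q1 k + q2 k)"
    by (rule ext) (simp add: quadr_rest_def q1_def q2_def sum.distrib distrib_left)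
  have b: "band N \<subseteq> {-K..K}" using NK N1 by (auto simp: band_def)
  have sn: "supp K (cutoff (3 * N) n)" "supp K nhigh"
    using NK N1 by (auto simp: supp_def cutoff_def nhigh_def)
  have "l2 N q1 \<le> (1 / rN ^ 3) * l2 K (above (N + 1)) * l1 K (cutoff (3 * N) n)"
  proof (rule young_l2'[OF supp_above sn(1)])
    fix k assume k: "\<bar>k\<bar> \<le> N"
    have "cmod (q1 k) \<le> (\<Sum>j\<in>band N. (1 / rN ^ 3) * (cmod (above (N + 1) j) * cmod (cutoff (3 * N) n (k - j))))"
      unfolding q1_def
    proof (rule sum_norm_le)
      fix j assume j: "j \<in> band N"
      have "\<bar>res_coeff k j\<bar> * (cmod (a j) * cmod (n (k - j))) \<le> (1 / rN ^ 3) * (cmod (a j) * cmod (n (k - j)))"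
        by (rule mult_right_mono[OF res_coeff_bound]) (use N1 bandD[OF j] k in auto)
      moreover have "\<bar>k - j\<bar> \<le> 3 * N" using bandD[OF j] k by linarith
      ultimately show "cmod (of_real (res_coeff k j) * (n (k - j) * a j)) \<le> (1 / rN ^ 3) * (cmod (above (N + 1) j) * cmod (cutoff (3 * N) n (k - j)))"
        using bandD[OF j] by (simp add: norm_mult above_def cutoff_def mult_ac)
    qed
    also have "\<dots> \<le> (\<Sum>j=-K..K. (1 / rN ^ 3) * (cmod (above (N + 1) j) * cmod (cutoff (3 * N) n (k - j))))"
      by (rule sum_mono2) (use b N1 in auto)
    finally show "cmod (q1 k) \<le> 1 / rN ^ 3 * conv K (\<lambda>j. cmod (above (N + 1) j)) (\<lambda>j. cmod (cutoff (3 * N) n j)) k"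
      by (simp add: conv_def sum_distrib_left)
  qed (use N1 in auto)
  also have "\<dots> \<le> 1 * (M * P) * (8 * M ^ 2)"
  proof (intro mult_mono mult_nonneg_nonneg l1_nonneg l2_nonneg l2_above)
    have "l1 K (cutoff (3 * N) n) \<le> l1 (3 * N) (cutoff (3 * N) n)" by (rule l1_supp_le[OF supp_cutoff])
    also have "\<dots> = l1 (3 * N) n" unfolding l1_def by (rule sum.cong) (auto simp: cutoff_def)
    finally show "l1 K (cutoff (3 * N) n) \<le> 8 * M ^ 2" using n_wl1 by simp
  qed (use freq_powers M1 P0 N1 in auto)
  also have "\<dots> \<le> 8 * 2 ^ r * M ^ 3 * P"
  proof -
    have "8 * 1 * M ^ 3 * P \<le> 8 * 2 ^ r * M ^ 3 * P"
      by (intro mult_right_mono mult_left_mono P0) (use M1 in auto)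
    then show ?thesis by (simp add: power3_eq_cube power2_eq_square mult_ac)
  qed
  finally have 1: "l2 N q1 \<le> 8 * 2 ^ r * M ^ 3 * P" .
  have "l2 N q2 \<le> (1 / rN ^ 3) * l2 K nhigh * l1 K a"
  proof (rule young_l2'[OF sn(2) suppa])
    fix k assume k: "\<bar>k\<bar> \<le> N"
    have "cmod (q2 k) \<le> (\<Sum>j\<in>band N. (1 / rN ^ 3) * (cmod (nhigh j) * cmod (a (k - j))))"
      unfolding q2_def
    proof (rule sum_norm_le)
      fix j assume j: "j \<in> band N"
      have "\<bar>res_coeff k j\<bar> * (cmod (n j) * cmod (a (k - j))) \<le> (1 / rN ^ 3) * (cmod (n j) * cmod (a (k - j)))"
        by (rule mult_right_mono[OF res_coeff_bound]) (use N1 bandD[OF j] k in auto)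
      then show "cmod (of_real (res_coeff k j) * (a (k - j) * n j)) \<le> (1 / rN ^ 3) * (cmod (nhigh j) * cmod (a (k - j)))"
        using bandD[OF j] k by (simp add: norm_mult nhigh_def mult_ac)
    qed
    also have "\<dots> \<le> (\<Sum>j=-K..K. (1 / rN ^ 3) * (cmod (nhigh j) * cmod (a (k - j))))"
      by (rule sum_mono2) (use b N1 in auto)
    finally show "cmod (q2 k) \<le> 1 / rN ^ 3 * conv K (\<lambda>j. cmod (nhigh j)) (\<lambda>j. cmod (a j)) k"
      by (simp add: conv_def sum_distrib_left)
  qed (use N1 in auto)
  also have "\<dots> \<le> (1 / rN ^ 3) * (rN * (9 * 2 ^ r * M ^ 2 * P)) * M"
    by (intro mult_mono mult_left_mono mult_nonneg_nonneg l1_nonneg l2_nonneg l2_nhigh l1a) (use N1 M1 in auto)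
  also have "\<dots> = (rN * (1 / rN ^ 3)) * (9 * 2 ^ r * M ^ 3 * P)"
    by (simp add: power3_eq_cube power2_eq_square mult_ac)
  also have "\<dots> \<le> 1 * (9 * 2 ^ r * M ^ 3 * P)"
    by (rule mult_right_mono[OF freq_powers(1)]) (use M1 P0 in auto)
  finally have 2: "l2 N q2 \<le> 9 * 2 ^ r * M ^ 3 * P" by simp
  show ?thesis unfolding q using l2_triangle[of N q1 q2] 1 2 by linarith
qed

text \<open>Four quadratic terms contribute 1 each, \<open>n_l2_small\<close> contributes 3 and the
  cubic part 17, after all powers of M have been raised to the fourth.\<close>

lemma l2_residual: "l2 N residual \<le> 24 * 2 ^ r * M ^ 4 * P"
proof -
  let ?g = "\<lambda>k. n k - \<i> * of_int k / 2 * conv K a a k"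
  let ?A = "\<lambda>k. \<i> * of_int k * of_real 1 * conv K (above (2 * N + 1)) (above N) k"
  let ?B = "\<lambda>k. \<i> * of_int k * of_real (1/2) * conv K (above (N + 1)) (above (N + 1)) k"
  let ?C = "\<lambda>k. \<i> * of_int k * of_real 1 * conv K (nform N a) (cutoff N a) k"
  let ?D = "\<lambda>k. \<i> * of_int k * of_real (1/2) * conv K (nform N a) (nform N a) k"
  have r: "l2 N residual = l2 N (\<lambda>k. ((((?B k + ?C k) + ?D k) - ?A k) - ?g k) - quadr_rest k)"
  proof (rule l2_cong)
    fix k assume "\<bar>k\<bar> \<le> N"
    from residual_split[OF this] show "residual k = ((((?B k + ?C k) + ?D k) - ?A k) - ?g k) - quadr_rest k"
      by (simp add: conv_commute[OF suppK_nform suppK_cutoff])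
  qed
  have A: "l2 N ?A \<le> rN * (M * P) * (M / rN)" and B: "l2 N ?B \<le> rN * (M * P) * (M / rN)"
    by (rule l2_deriv_conv[OF supp_above supp_above l2_above l1_above]; use N1 in simp)+
  have C: "l2 N ?C \<le> rN * ((1 / rN ^ 3) * (M * P) * M) * M"
    by (rule l2_deriv_conv[OF suppK_nform suppK_cutoff l2K_nform l1_cutoff]) simp
  have D: "l2 N ?D \<le> rN * ((1 / rN ^ 3) * (M * P) * M) * ((1 / rN ^ 3) * M * M)"
    by (rule l2_deriv_conv[OF suppK_nform suppK_nform l2K_nform l1K_nform]) simp
  have AA: "rN * (M * P) * (M / rN) = M ^ 2 * P" using rN1 by (simp add: power2_eq_square)
  have "rN * ((1 / rN ^ 3) * (M * P) * M) * M = (rN * (1 / rN ^ 3)) * (M ^ 3 * P)"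
    by (simp add: power3_eq_cube mult_ac)
  also have "\<dots> \<le> 1 * (M ^ 3 * P)" by (rule mult_right_mono[OF freq_powers(1)]) (use M1 P0 in auto)
  finally have CC: "rN * ((1 / rN ^ 3) * (M * P) * M) * M \<le> M ^ 3 * P" by simp
  have "rN * ((1 / rN ^ 3) * (M * P) * M) * ((1 / rN ^ 3) * M * M) = (rN * (1 / rN ^ 3)) * (1 / rN ^ 3) * (M ^ 4 * P)"
    by (simp add: eval_nat_numeral mult_ac)
  also have "\<dots> \<le> 1 * 1 * (M ^ 4 * P)" by (intro mult_right_mono mult_mono freq_powers) (use M1 P0 freq_powers in auto)
  finally have DD: "rN * ((1 / rN ^ 3) * (M * P) * M) * ((1 / rN ^ 3) * M * M) \<le> M ^ 4 * P" by simp
  have "l2 N residual \<le> l2 N ?B + l2 N ?C + l2 N ?D + l2 N ?A + l2 N ?g + l2 N quadr_rest"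
    unfolding r
    by (rule order_trans[OF l2_minus] add_right_mono order_trans[OF l2_triangle] order_refl)+
  also have "\<dots> \<le> M ^ 2 * P + M ^ 3 * P + M ^ 4 * P + M ^ 2 * P + 3 * P + 17 * 2 ^ r * M ^ 3 * P"
    using A B C D n_l2_small l2_quadr_rest AA CC DD by linarith
  also have "\<dots> \<le> M ^ 4 * P + M ^ 4 * P + M ^ 4 * P + M ^ 4 * P + 3 * M ^ 4 * P + 17 * 2 ^ r * M ^ 4 * P"
    by (intro add_mono mult_right_mono mult_left_mono M_pow P0) (use M_pow in auto)
  also have "\<dots> = 7 * 1 * M ^ 4 * P + 17 * 2 ^ r * M ^ 4 * P" by (simp add: algebra_simps)
  also have "\<dots> \<le> 7 * 2 ^ r * M ^ 4 * P + 17 * 2 ^ r * M ^ 4 * P"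
    by (intro add_right_mono mult_right_mono mult_left_mono P0 M_pow) auto
  finally show ?thesis by (simp add: algebra_simps)
qed

text \<open>This norm controls the symmetric part of the transport by the comparison function. On
  the correction the weight costs 2N, which its N^(-3) outweighs.\<close>

lemma wl1_comparison: "l1 N (\<lambda>k. of_real (wt k) * comparison k) \<le> 3 * M ^ 2"
proof -
  have "l1 N (\<lambda>k. of_real (wt k) * comparison k) \<le> l1 N (\<lambda>k. of_real (wt k) * cutoff N a k) + l1 N (\<lambda>k. of_real (wt k) * nform N a k)"
    unfolding comparison_def distrib_left by (rule l1_triangle)
  also have "l1 N (\<lambda>k. of_real (wt k) * cutoff N a k) \<le> 1 * l1 N (\<lambda>k. of_real (wt k ^ 1) * a k)"
    by (rule l1_mono) (auto simp: cutoff_def)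
  also have "\<dots> \<le> 1 * wl1 1 K a" unfolding wl1_def by (intro mult_left_mono l1_index_mono) (use NK N1 in auto)
  also have "\<dots> \<le> 1 * M" using wl1a by simp
  also have "l1 N (\<lambda>k. of_real (wt k) * nform N a k) \<le> (1 + rN) * l1 N (nform N a)"
    by (rule l1_mono) (simp only: cmod_wt_mult, rule mult_right_mono, auto simp: wt_def)
  also have "\<dots> \<le> (2 * rN) * ((1 / rN ^ 3) * M * M)"
    by (intro mult_mono l1_nform l1_nonneg) (use rN1 in auto)
  also have "\<dots> = 2 * (rN * (1 / rN ^ 3)) * M ^ 2" by (simp add: power2_eq_square)
  also have "\<dots> \<le> 2 * 1 * M ^ 2" by (intro mult_right_mono mult_left_mono freq_powers) auto
  also have "1 * M \<le> M ^ 2" using M1 by (simp add: power2_eq_square)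
  finally show ?thesis by simp
qed

lemma l2_nform_le: "l2 N (nform N a) \<le> M ^ 2 * P"
proof -
  have "l2 N (nform N a) \<le> (1 / rN ^ 3) * (M ^ 2 * P)" using l2_nform by (simp add: power2_eq_square mult_ac)
  also have "\<dots> \<le> 1 * (M ^ 2 * P)" by (intro mult_right_mono freq_powers) (use P0 in auto)
  finally show ?thesis by simp
qed

end

section \<open>Differential inequalities and the Galerkin error\<close>

lemma within_nonpos_imp_le:
  fixes f :: "real \<Rightarrow> real"
  assumes "a \<le> b"
    and "\<And>t. a \<le> t \<Longrightarrow> t \<le> b \<Longrightarrow> (f has_real_derivative f' t) (at t within {a..b})"
    and "\<And>t. a \<le> t \<Longrightarrow> t \<le> b \<Longrightarrow> f' t \<le> 0"
  shows "f b \<le> f a"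
proof (rule DERIV_nonpos_imp_decreasing_open[OF assms(1)])
  fix x assume "a < x" "x < b"
  then show "\<exists>y. (f has_real_derivative y) (at x) \<and> y \<le> 0"
    using assms(2)[of x] assms(3)[of x] by (auto simp: at_within_Icc_at)
next
  show "continuous_on {a..b} f"
    by (rule DERIV_continuous_on) (use assms(2) in auto)
qed

lemma gronwall_within:
  fixes y :: "real \<Rightarrow> real"
  assumes "0 \<le> t" "t \<le> T" "0 \<le> L" "0 \<le> D" "0 \<le> y 0"
    and "\<And>s. 0 \<le> s \<Longrightarrow> s \<le> T \<Longrightarrow> (y has_real_derivative y' s) (at s within {0..T})"
    and "\<And>s. 0 \<le> s \<Longrightarrow> s \<le> T \<Longrightarrow> y' s \<le> L * y s + D"
  shows "y t \<le> exp (L * T) * (y 0 + D * T)"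
proof -
  \<comment> \<open>The exponential is the integrating factor; since it is at most 1, subtracting D
    s takes care of the source term, and z decreases.\<close>
  define z where "z s = exp (- (L * s)) * y s - D * s" for s
  have "z t \<le> z 0"
  proof (rule within_nonpos_imp_le[OF assms(1), where f' = "\<lambda>s. exp (- (L * s)) * (y' s - L * y s) - D"])
    fix s assume s: "0 \<le> s" "s \<le> t"
    have "(y has_real_derivative y' s) (at s within {0..t})"
      by (rule DERIV_subset[OF assms(6)]) (use s assms in auto)
    then show "(z has_real_derivative exp (- (L * s)) * (y' s - L * y s) - D) (at s within {0..t})"
      unfolding z_def by (auto intro!: derivative_eq_intros simp: algebra_simps)
    have "exp (- (L * s)) * (y' s - L * y s) \<le> 1 * D"
    proof (cases "y' s - L * y s \<le> 0")
      case True
      then show ?thesis using assms(4) by (smt (verit) exp_gt_zero mult_nonneg_nonpos)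
    next
      case False
      have "y' s - L * y s \<le> D" using assms(7)[of s] s assms(2) by linarith
      then show ?thesis
        using False s assms(3,4) by (intro mult_mono) auto
    qed
    then show "exp (- (L * s)) * (y' s - L * y s) - D \<le> 0" by simp
  qed
  then have "exp (- (L * t)) * y t \<le> y 0 + D * t" by (simp add: z_def)
  then have "exp (L * t) * (exp (- (L * t)) * y t) \<le> exp (L * t) * (y 0 + D * t)"
    by (rule mult_left_mono) simp
  then have "y t \<le> exp (L * t) * (y 0 + D * t)" by (simp add: mult.assoc[symmetric] exp_add[symmetric])
  also have "\<dots> \<le> exp (L * T) * (y 0 + D * T)"
    using assms by (intro mult_mono add_left_mono mult_left_mono) (auto intro: mult_left_mono)
  finally show ?thesis .
qed

lemma deriv_cmod_power2:
  assumes "(f has_vector_derivative f') (at t within S)"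
  shows "((\<lambda>s. (cmod (f s))\<^sup>2) has_real_derivative 2 * Re (f' * cnj (f t))) (at t within S)"
proof -
  have r: "((\<lambda>s. Re (f s)) has_real_derivative Re f') (at t within S)"
    and i: "((\<lambda>s. Im (f s)) has_real_derivative Im f') (at t within S)"
    using bounded_linear.has_vector_derivative[OF bounded_linear_Re assms]
      bounded_linear.has_vector_derivative[OF bounded_linear_Im assms]
    by (auto simp: has_real_derivative_iff_has_vector_derivative)
  have "((\<lambda>s. (Re (f s))\<^sup>2 + (Im (f s))\<^sup>2) has_real_derivative 2 * Re f' * Re (f t) + 2 * Im f' * Im (f t)) (at t within S)"
    by (rule DERIV_cong[OF DERIV_add[OF DERIV_power[OF r, of 2] DERIV_power[OF i, of 2]]]) simp
  then show ?thesis by (simp add: cmod_power2 algebra_simps)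
qed

lemma deriv_l2_power2:
  assumes "\<And>k. \<bar>k\<bar> \<le> N \<Longrightarrow> ((\<lambda>s. e s k) has_vector_derivative e' k) (at t within S)"
  shows "((\<lambda>s. (l2 N (e s))\<^sup>2) has_real_derivative 2 * ip N e' (e t)) (at t within S)"
proof -
  have "((\<lambda>s. \<Sum>k=-N..N. (cmod (e s k))\<^sup>2) has_real_derivative (\<Sum>k=-N..N. 2 * Re (e' k * cnj (e t k)))) (at t within S)"
    by (intro DERIV_sum deriv_cmod_power2 assms) auto
  then show ?thesis by (simp add: l2_power2 ip_def sum_distrib_left)
qed

lemma deriv_cutoff_nform:
  assumes "\<bar>k\<bar> \<le> N" "1 \<le> N" and prof: "profile N K r M (a t) n"
    and da: "\<And>k. \<bar>k\<bar> \<le> 3 * N \<Longrightarrow>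
      ((\<lambda>s. a s k) has_vector_derivative (\<i> * of_real (disp k) * a t k - n k)) (at t within S)"
  shows "((\<lambda>s. cutoff N (a s) k + nform N (a s) k) has_vector_derivative
    (\<i> * of_real (disp k) * (cutoff N (a t) k + nform N (a t) k)
     - \<i> * of_int k / 2 * conv N (profile.comparison N (a t)) (profile.comparison N (a t)) k
     + profile.residual N (a t) n k)) (at t within S)"
proof -
  let ?d = "\<lambda>k. \<i> * of_real (disp k) * a t k - n k"
  have "((\<lambda>s. a s k + (\<Sum>j\<in>band N. of_real (res_coeff k j) * (a s (k - j) * a s j))) has_vector_derivative
     (?d k + (\<Sum>j\<in>band N. of_real (res_coeff k j) * (a t (k - j) * ?d j + ?d (k - j) * a t j)))) (at t within S)"
  proof (intro has_vector_derivative_add has_vector_derivative_sum)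
    show "((\<lambda>s. a s k) has_vector_derivative ?d k) (at t within S)" using assms by (intro da) auto
    fix j assume j: "j \<in> band N"
    show "((\<lambda>s. of_real (res_coeff k j) * (a s (k - j) * a s j)) has_vector_derivative
       of_real (res_coeff k j) * (a t (k - j) * ?d j + ?d (k - j) * a t j)) (at t within S)"
      by (intro has_vector_derivative_mult_right has_vector_derivative_mult da)
        (use bandD[OF j] assms(1) in auto)
  qed
  moreover have "(\<lambda>s. cutoff N (a s) k + nform N (a s) k) = (\<lambda>s. a s k + (\<Sum>j\<in>band N. of_real (res_coeff k j) * (a s (k - j) * a s j)))"
    using assms(1) by (simp add: cutoff_def nform_def mult.assoc)
  moreover have "?d k + (\<Sum>j\<in>band N. of_real (res_coeff k j) * (a t (k - j) * ?d j + ?d (k - j) * a t j))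
     = \<i> * of_real (disp k) * (cutoff N (a t) k + nform N (a t) k)
     - \<i> * of_int k / 2 * conv N (profile.comparison N (a t)) (profile.comparison N (a t)) k
     + profile.residual N (a t) n k"
    using nform_time_derivative[OF assms(1,2), of ?d "a t" n] assms(1)
    by (simp add: profile.residual_def[OF prof] profile.quadr_rest_def[OF prof] cutoff_def add.commute distrib_left)
  ultimately show ?thesis by simp
qed

text \<open>Gronwall's bound with rate 3 M^2 from \<open>wl1_comparison\<close> plus 1 from pairing
  the residual with the error. The initial value M^4 is the squared correction at time 0, the source
  is that of \<open>l2_residual\<close>, and the final M^2 removes the correction at time t.\<close>

definition spatial_const :: "nat \<Rightarrow> real \<Rightarrow> real \<Rightarrow> real" where
  "spatial_const r M T = sqrt (exp ((3 * M ^ 2 + 1) * T) * (M ^ 4 + (24 * 2 ^ r * M ^ 4)\<^sup>2 * T)) + M ^ 2"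

text \<open>The energy method is applied to the distance from the comparison function. The rotation
  and the cubic term drop out, and the transport by \<open>W\<close> enters only through its
  symmetric part, so nothing of order N remains besides the residual.\<close>

lemma galerkin_error:
  fixes a n c :: "real \<Rightarrow> int \<Rightarrow> complex"
  assumes N1: "1 \<le> N" and M1: "1 \<le> M" and t: "0 \<le> t" "t \<le> T"
    and prof: "\<And>s. 0 \<le> s \<Longrightarrow> s \<le> T \<Longrightarrow> profile N K r M (a s) (n s)"
    and herm_a: "\<And>s. 0 \<le> s \<Longrightarrow> s \<le> T \<Longrightarrow> herm (a s)"
    and herm_c: "\<And>s. 0 \<le> s \<Longrightarrow> s \<le> T \<Longrightarrow> herm (c s)"
    and supp_c: "\<And>s. 0 \<le> s \<Longrightarrow> s \<le> T \<Longrightarrow> supp N (c s)"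
    and da: "\<And>s k. 0 \<le> s \<Longrightarrow> s \<le> T \<Longrightarrow> \<bar>k\<bar> \<le> 3 * N \<Longrightarrow>
      ((\<lambda>s. a s k) has_vector_derivative (\<i> * of_real (disp k) * a s k - n s k)) (at s within {0..T})"
    and dc: "\<And>s k. 0 \<le> s \<Longrightarrow> s \<le> T \<Longrightarrow> \<bar>k\<bar> \<le> N \<Longrightarrow>
      ((\<lambda>s. c s k) has_vector_derivative
        (\<i> * of_real (disp k) * c s k - \<i> * of_int k / 2 * conv N (c s) (c s) k)) (at s within {0..T})"
    and init: "\<And>k. \<bar>k\<bar> \<le> N \<Longrightarrow> c 0 k = a 0 k"
  shows "l2 N (\<lambda>k. c t k - a t k) \<le> spatial_const r M T / real_of_int N ^ r"
proof -
  define W where "W s k = cutoff N (a s) k + nform N (a s) k" for s k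
  define e where "e s k = c s k - W s k" for s k
  define R where "R s = profile.residual N (a s) (n s)" for s
  define P where "P = 1 / real_of_int N ^ r"
  define e' where "e' s k = \<i> * of_real (disp k) * e s k - \<i> * of_int k * conv N (e s) (W s) k
    - \<i> * of_int k / 2 * conv N (e s) (e s) k - R s k" for s k
  define D where "D = (24 * 2 ^ r * M ^ 4 * P)\<^sup>2"
  have W: "profile.comparison N (a s) = W s" if "0 \<le> s" "s \<le> T" for s
    unfolding W_def by (rule profile.comparison_eq[OF prof[OF that]])
  have suppW: "supp N (W s)" if "0 \<le> s" "s \<le> T" for s
    unfolding W_def by (rule supp_add[OF supp_cutoff supp_nform])
  have suppe: "supp N (e s)" if "0 \<le> s" "s \<le> T" for s
    unfolding e_def using that by (intro supp_diff supp_c suppW)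
  have hermW: "herm (W s)" if "0 \<le> s" "s \<le> T" for s
    unfolding W_def using that by (intro herm_add herm_cutoff herm_nform herm_a)
  have herme: "herm (e s)" if "0 \<le> s" "s \<le> T" for s
    unfolding e_def using that by (intro herm_diff herm_c hermW)
  have de: "((\<lambda>s. e s k) has_vector_derivative e' s k) (at s within {0..T})"
    if s: "0 \<le> s" "s \<le> T" and k: "\<bar>k\<bar> \<le> N" for s k
  proof -
    have "((\<lambda>s. e s k) has_vector_derivative
       ((\<i> * of_real (disp k) * c s k - \<i> * of_int k / 2 * conv N (c s) (c s) k)
        - (\<i> * of_real (disp k) * W s k - \<i> * of_int k / 2 * conv N (W s) (W s) k + R s k))) (at s within {0..T})"
      unfolding e_def
    proof (rule has_vector_derivative_diff[OF dc[OF s k]])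
      show "((\<lambda>s. W s k) has_vector_derivative
        (\<i> * of_real (disp k) * W s k - \<i> * of_int k / 2 * conv N (W s) (W s) k + R s k)) (at s within {0..T})"
        using deriv_cutoff_nform[of k N K r M a s "n s", OF k N1 prof[OF s] da[OF s]] unfolding W[OF s] unfolding W_def R_def .
    qed
    moreover have "conv N (c s) (c s) k = conv N (W s) (W s) k + 2 * conv N (e s) (W s) k + conv N (e s) (e s) k"
    proof -
      have "c s = (\<lambda>k. W s k + e s k)" by (simp add: e_def)
      then have "conv N (c s) (c s) k = conv N (\<lambda>k. W s k + e s k) (\<lambda>k. W s k + e s k) k" by simp
      also have "\<dots> = conv N (W s) (W s) k + 2 * conv N (W s) (e s) k + conv N (e s) (e s) k"
        by (rule conv_square[OF suppW[OF s] suppe[OF s]])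
      also have "conv N (W s) (e s) k = conv N (e s) (W s) k"
        by (rule conv_commute[OF suppW[OF s] suppe[OF s]])
      finally show ?thesis .
    qed
    then have "(\<i> * of_real (disp k) * c s k - \<i> * of_int k / 2 * conv N (c s) (c s) k)
        - (\<i> * of_real (disp k) * W s k - \<i> * of_int k / 2 * conv N (W s) (W s) k + R s k) = e' s k"
      unfolding e'_def e_def[of s k] by (simp add: field_simps)
    ultimately show ?thesis by simp
  qed
  have energy: "2 * ip N (e' s) (e s) \<le> (3 * M ^ 2 + 1) * (l2 N (e s))\<^sup>2 + D" if s: "0 \<le> s" "s \<le> T" for s
  proof -
    have "ip N (e' s) (e s) = ip N (\<lambda>k. \<i> * of_real (disp k) * e s k) (e s) - transport N (W s) (e s) (e s)
        - ip N (\<lambda>k. of_real (1/2) * (\<i> * of_int k * conv N (e s) (e s) k)) (e s) - ip N (R s) (e s)"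
      unfolding e'_def transport_def ip_diff_left[symmetric] by simp
    also have "ip N (\<lambda>k. of_real (1/2) * (\<i> * of_int k * conv N (e s) (e s) k)) (e s) = 0"
      unfolding ip_scale_left transport_def[symmetric] transport_cubic[OF herme[OF s] suppe[OF s]] by simp
    also have "ip N (\<lambda>k. \<i> * of_real (disp k) * e s k) (e s) = 0"
      using ip_skew[of N disp "e s" "e s"] by simp
    finally have 1: "2 * ip N (e' s) (e s) = - (transport N (W s) (e s) (e s) + transport N (W s) (e s) (e s)) - 2 * ip N (R s) (e s)"
      by simp
    have "\<bar>transport N (W s) (e s) (e s) + transport N (W s) (e s) (e s)\<bar>
      \<le> l1 N (\<lambda>k. of_real (wt k) * W s k) * l2 N (e s) * l2 N (e s)"
      by (rule transport_sym_le[OF hermW[OF s] suppW[OF s] suppe[OF s]])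
    also have "\<dots> \<le> 3 * M ^ 2 * l2 N (e s) * l2 N (e s)"
      using profile.wl1_comparison[OF prof[OF s]] unfolding W[OF s]
      by (intro mult_right_mono l2_nonneg) auto
    finally have 2: "\<bar>transport N (W s) (e s) (e s) + transport N (W s) (e s) (e s)\<bar> \<le> 3 * M ^ 2 * (l2 N (e s))\<^sup>2"
      by (simp add: power2_eq_square mult.assoc)
    have "\<bar>2 * ip N (R s) (e s)\<bar> \<le> 2 * (l2 N (R s) * l2 N (e s))"
      using ip_cauchy_schwarz[of N "R s" "e s"] by simp
    also have "\<dots> \<le> (l2 N (R s))\<^sup>2 + (l2 N (e s))\<^sup>2"
      using sum_squares_bound[of "l2 N (R s)" "l2 N (e s)"] by simp
    also have "(l2 N (R s))\<^sup>2 \<le> D"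
      unfolding D_def R_def P_def
      by (rule power_mono[OF profile.l2_residual[OF prof[OF s]] l2_nonneg])
    finally have 3: "\<bar>2 * ip N (R s) (e s)\<bar> \<le> D + (l2 N (e s))\<^sup>2" by simp
    show ?thesis using 1 2 3 by (simp add: algebra_simps)
  qed
  have T0: "0 \<le> T" using t by simp
  have D0: "0 \<le> D" by (simp add: D_def)
  have P0: "0 \<le> P" unfolding P_def using N1 by simp
  \<comment> \<open>The Galerkin solution starts at the cut-off profile, so the initial distance is
    the correction alone.\<close>
  have init2: "l2 N (e 0) \<le> M ^ 2 * P"
  proof -
    have "l2 N (e 0) \<le> 1 * l2 N (nform N (a 0))"
      by (rule l2_mono) (auto simp: e_def W_def init cutoff_def)
    then show ?thesis using profile.l2_nform_le[OF prof[OF order_refl T0]] unfolding P_def by simp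
  qed
  have "(l2 N (e t))\<^sup>2 \<le> exp ((3 * M ^ 2 + 1) * T) * ((l2 N (e 0))\<^sup>2 + D * T)"
    by (rule gronwall_within[OF t, where y = "\<lambda>s. (l2 N (e s))\<^sup>2" and y' = "\<lambda>s. 2 * ip N (e' s) (e s)"])
       (use D0 in \<open>auto intro!: deriv_l2_power2 de energy\<close>)
  also have "\<dots> \<le> exp ((3 * M ^ 2 + 1) * T) * ((M ^ 2 * P)\<^sup>2 + D * T)"
    by (intro mult_left_mono add_right_mono power_mono init2 l2_nonneg) auto
  also have "\<dots> = (exp ((3 * M ^ 2 + 1) * T) * (M ^ 4 + (24 * 2 ^ r * M ^ 4)\<^sup>2 * T)) * P\<^sup>2"
    unfolding D_def by (simp add: power_mult_distrib algebra_simps flip: power_mult)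
  finally have "l2 N (e t) \<le> sqrt ((exp ((3 * M ^ 2 + 1) * T) * (M ^ 4 + (24 * 2 ^ r * M ^ 4)\<^sup>2 * T)) * P\<^sup>2)"
    by (rule real_le_rsqrt)
  then have 1: "l2 N (e t) \<le> sqrt (exp ((3 * M ^ 2 + 1) * T) * (M ^ 4 + (24 * 2 ^ r * M ^ 4)\<^sup>2 * T)) * P"
    using P0 by (simp add: real_sqrt_mult)
  have "l2 N (\<lambda>k. c t k - a t k) = l2 N (\<lambda>k. e t k + nform N (a t) k)"
    by (rule l2_cong) (auto simp: e_def W_def cutoff_def)
  also have "\<dots> \<le> l2 N (e t) + l2 N (nform N (a t))" by (rule l2_triangle)
  also have "\<dots> \<le> sqrt (exp ((3 * M ^ 2 + 1) * T) * (M ^ 4 + (24 * 2 ^ r * M ^ 4)\<^sup>2 * T)) * P + M ^ 2 * P"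
    using 1 profile.l2_nform_le[OF prof[OF t]] unfolding P_def by (rule add_mono)
  also have "\<dots> = spatial_const r M T * P" by (simp add: spatial_const_def distrib_right)
  finally show ?thesis by (simp add: P_def)
qed

section \<open>Leapfrog time stepping\<close>

lemma wl1_conv_le:
  assumes "supp N g" 
    and "\<And>k. cmod (h k) \<le> D * wt k ^ p * cmod (conv N f g k)" "0 \<le> D" 
  shows "wl1 s N h \<le> D * wl1 (s + p) N f * wl1 (s + p) N g"
  unfolding wl1_def
proof (rule young_l1)
  fix k
  have "cmod (of_real (wt k ^ s) * h k) \<le> wt k ^ s * (D * wt k ^ p * cmod (conv N f g k))"
    unfolding cmod_wt_power_mult by (intro mult_left_mono assms) (simp add: less_imp_le wt_pos)
  also have "\<dots> = D * (wt k ^ (s + p) * cmod (conv N f g k))" by (simp add: power_add mult_ac)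
  also have "\<dots> \<le> D * (wt k ^ (s + p) * conv N (\<lambda>j. cmod (f j)) (\<lambda>j. cmod (g j)) k)"
    by (intro mult_left_mono norm_conv_le assms(3)) (simp add: less_imp_le wt_pos)
  also have "wt k ^ (s + p) * conv N (\<lambda>j. cmod (f j)) (\<lambda>j. cmod (g j)) k
     \<le> conv N (\<lambda>j. cmod (of_real (wt j ^ (s + p)) * f j)) (\<lambda>j. cmod (of_real (wt j ^ (s + p)) * g j)) k"
    unfolding conv_def sum_distrib_left cmod_wt_power_mult
  proof (rule sum_mono)
    fix j
    have "wt k ^ (s + p) \<le> wt j ^ (s + p) * wt (k - j) ^ (s + p)"
      unfolding power_mult_distrib[symmetric] by (intro power_mono wt_mult) (simp add: less_imp_le wt_pos)
    then have "wt k ^ (s + p) * (cmod (f j) * cmod (g (k - j))) \<le> wt j ^ (s + p) * wt (k - j) ^ (s + p) * (cmod (f j) * cmod (g (k - j)))"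
      by (rule mult_right_mono) simp
    then show "wt k ^ (s + p) * (cmod (f j) * cmod (g (k - j))) \<le> wt j ^ (s + p) * cmod (f j) * (wt (k - j) ^ (s + p) * cmod (g (k - j)))"
      by (simp add: mult_ac)
  qed
  finally show "cmod (of_real (wt k ^ s) * h k) \<le> D * conv N (\<lambda>j. cmod (of_real (wt j ^ (s + p)) * f j)) (\<lambda>j. cmod (of_real (wt j ^ (s + p)) * g j)) k"
    using assms(3) by (simp add: mult_left_mono)
qed (use assms in \<open>auto simp: supp_def\<close>)

lemma disp_le: "\<bar>disp k\<bar> \<le> 2 * wt k ^ 5"
proof -
  have "\<bar>disp k\<bar> \<le> \<bar>real_of_int k\<bar> ^ 3 + \<bar>real_of_int k\<bar> ^ 5"
    unfolding disp_def by (rule order_trans[OF abs_triangle_ineq]) (simp add: power_abs)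
  also have "\<dots> \<le> wt k ^ 3 + wt k ^ 5" by (intro add_mono power_mono abs_le_wt) auto
  also have "wt k ^ 3 \<le> wt k ^ 5" by (rule power_increasing) (auto simp: wt_ge_1)
  finally show ?thesis by simp
qed

lemma wl1_disp:
  assumes "\<And>k. \<bar>k\<bar> \<le> N \<Longrightarrow> cmod (h k) \<le> \<bar>disp k\<bar> * cmod (f k)"
  shows "wl1 s N h \<le> 2 * wl1 (s + 5) N f"
  unfolding wl1_def
proof (rule l1_mono)
  fix k assume k: "\<bar>k\<bar> \<le> N"
  have "cmod (h k) \<le> 2 * wt k ^ 5 * cmod (f k)"
    using order_trans[OF assms[OF k] mult_right_mono[OF disp_le norm_ge_zero]] .
  then have "wt k ^ s * cmod (h k) \<le> wt k ^ s * (2 * wt k ^ 5 * cmod (f k))"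
    by (rule mult_left_mono) (simp add: less_imp_le wt_pos)
  then show "cmod (of_real (wt k ^ s) * h k) \<le> 2 * cmod (of_real (wt k ^ (s + 5)) * f k)"
    unfolding cmod_wt_power_mult by (simp add: power_add mult_ac)
qed

lemma wl1_diff: "wl1 s N (\<lambda>k. f k - g k) \<le> wl1 s N f + wl1 s N g"
  unfolding wl1_sum sum.distrib[symmetric]
  by (rule sum_mono) (simp add: distrib_left[symmetric] mult_left_mono norm_triangle_ineq4 less_imp_le wt_pos)

text \<open>
  The values at \<open>c\<close> of the first three time derivatives along the Galerkin flow.
\<close>

definition flow1 :: "int \<Rightarrow> (int \<Rightarrow> complex) \<Rightarrow> int \<Rightarrow> complex" where
  "flow1 N c k = \<i> * of_real (disp k) * c k - cutoff N (\<lambda>k. \<i> * of_int k / 2 * conv N c c k) k"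

definition flow2 :: "int \<Rightarrow> (int \<Rightarrow> complex) \<Rightarrow> int \<Rightarrow> complex" where
  "flow2 N c k = \<i> * of_real (disp k) * flow1 N c k - cutoff N (\<lambda>k. \<i> * of_int k * conv N (flow1 N c) c k) k"

definition flow3 :: "int \<Rightarrow> (int \<Rightarrow> complex) \<Rightarrow> int \<Rightarrow> complex" where
  "flow3 N c k = \<i> * of_real (disp k) * flow2 N c k
    - cutoff N (\<lambda>k. \<i> * of_int k * (conv N (flow2 N c) c k + conv N (flow1 N c) (flow1 N c) k)) k"

lemma supp_flow:
  assumes "supp N c"
  shows "supp N (flow1 N c)" "supp N (flow2 N c)" "supp N (flow3 N c)"
  using assms by (auto simp: supp_def flow1_def flow2_def flow3_def cutoff_def)

lemma wl1_cutoff_conv: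
  assumes "supp N g"
  shows "wl1 s N (cutoff N (\<lambda>k. \<i> * of_int k * conv N f g k)) \<le> wl1 (s + 1) N f * wl1 (s + 1) N g"
proof -
  have "wl1 s N (cutoff N (\<lambda>k. \<i> * of_int k * conv N f g k)) \<le> 1 * wl1 (s + 1) N f * wl1 (s + 1) N g"
    by (rule wl1_conv_le[OF assms])
       (auto simp: cutoff_def norm_mult wt_pos less_imp_le abs_le_wt intro!: mult_right_mono)
  then show ?thesis by simp
qed

text \<open>A time derivative costs the five space derivatives of \<open>disp\<close>, the quadratic
  term only one: 15, 10, 5, 0. The i-th derivative is a polynomial of degree i + 1 in
  \<open>c\<close>, whence the powers of \<open>K0\<close>.\<close>

lemma wl1_flow:
  assumes "supp N c" and c: "wl1 15 N c \<le> K0" and K0: "1 \<le> K0"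
  shows "wl1 10 N (flow1 N c) \<le> 3 * K0 ^ 2" "wl1 5 N (flow2 N c) \<le> 9 * K0 ^ 3" "wl1 0 N (flow3 N c) \<le> 36 * K0 ^ 4"
proof -
  have cs: "wl1 s N c \<le> K0" if "s \<le> 15" for s using wl1_mono[OF that] c by (rule order_trans)
  have K: "K0 \<le> K0 ^ 2" "K0 ^ 2 \<le> K0 ^ 3" "K0 ^ 3 \<le> K0 ^ 4"
    using K0 power_increasing[of 1 2 K0] by (auto intro: power_increasing)
  have "wl1 10 N (flow1 N c) \<le> wl1 10 N (\<lambda>k. \<i> * of_real (disp k) * c k) + wl1 10 N (cutoff N (\<lambda>k. \<i> * of_int k / 2 * conv N c c k))"
    unfolding flow1_def by (rule wl1_diff)
  also have "wl1 10 N (\<lambda>k. \<i> * of_real (disp k) * c k) \<le> 2 * wl1 (10 + 5) N c"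
    by (rule wl1_disp) (simp add: norm_mult)
  also have "wl1 10 N (cutoff N (\<lambda>k. \<i> * of_int k / 2 * conv N c c k)) \<le> 1 * wl1 (10 + 1) N c * wl1 (10 + 1) N c"
  proof (rule wl1_conv_le[OF assms(1)])
    fix k
    have "cmod (\<i> * of_int k / 2) \<le> 1 * wt k ^ 1" by (auto simp: norm_mult norm_divide wt_def)
    then have "cmod (\<i> * of_int k / 2) * cmod (conv N c c k) \<le> 1 * wt k ^ 1 * cmod (conv N c c k)"
      by (rule mult_right_mono) simp
    then show "cmod (cutoff N (\<lambda>k. \<i> * of_int k / 2 * conv N c c k) k) \<le> 1 * wt k ^ 1 * cmod (conv N c c k)"
      using wt_pos[of k] by (cases "\<bar>k\<bar> \<le> N") (simp_all only: cutoff_def if_True if_False norm_mult, auto)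
  qed simp
  also have "2 * wl1 (10 + 5) N c + 1 * wl1 (10 + 1) N c * wl1 (10 + 1) N c \<le> 2 * K0 + 1 * K0 * K0"
    by (intro add_mono mult_mono mult_left_mono cs wl1_nonneg) (use K0 in auto)
  finally show f1: "wl1 10 N (flow1 N c) \<le> 3 * K0 ^ 2" using K by (simp add: power2_eq_square)
  have f1s: "wl1 s N (flow1 N c) \<le> 3 * K0 ^ 2" if "s \<le> 10" for s using wl1_mono[OF that] f1 by (rule order_trans)
  have "wl1 5 N (flow2 N c) \<le> wl1 5 N (\<lambda>k. \<i> * of_real (disp k) * flow1 N c k) + wl1 5 N (cutoff N (\<lambda>k. \<i> * of_int k * conv N (flow1 N c) c k))"
    unfolding flow2_def by (rule wl1_diff)
  also have "wl1 5 N (\<lambda>k. \<i> * of_real (disp k) * flow1 N c k) \<le> 2 * wl1 (5 + 5) N (flow1 N c)"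
    by (rule wl1_disp) (simp add: norm_mult)
  also have "wl1 5 N (cutoff N (\<lambda>k. \<i> * of_int k * conv N (flow1 N c) c k)) \<le> wl1 (5 + 1) N (flow1 N c) * wl1 (5 + 1) N c"
    by (rule wl1_cutoff_conv[OF assms(1)])
  also have "2 * wl1 (5 + 5) N (flow1 N c) + wl1 (5 + 1) N (flow1 N c) * wl1 (5 + 1) N c \<le> 2 * (3 * K0 ^ 2) + 3 * K0 ^ 2 * K0"
    by (intro add_mono mult_mono mult_left_mono cs f1s wl1_nonneg) (use K0 in auto)
  also have "\<dots> = 6 * K0 ^ 2 + 3 * K0 ^ 3" by (simp add: power2_eq_square power3_eq_cube)
  finally show f2: "wl1 5 N (flow2 N c) \<le> 9 * K0 ^ 3" using K by simp
  have f2s: "wl1 s N (flow2 N c) \<le> 9 * K0 ^ 3" if "s \<le> 5" for s using wl1_mono[OF that] f2 by (rule order_trans)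
  have "flow3 N c = (\<lambda>k. (\<i> * of_real (disp k) * flow2 N c k - cutoff N (\<lambda>k. \<i> * of_int k * conv N (flow2 N c) c k) k)
      - cutoff N (\<lambda>k. \<i> * of_int k * conv N (flow1 N c) (flow1 N c) k) k)"
    by (rule ext) (auto simp: flow3_def cutoff_def algebra_simps)
  then have "wl1 0 N (flow3 N c) \<le> wl1 0 N (\<lambda>k. \<i> * of_real (disp k) * flow2 N c k - cutoff N (\<lambda>k. \<i> * of_int k * conv N (flow2 N c) c k) k)
     + wl1 0 N (cutoff N (\<lambda>k. \<i> * of_int k * conv N (flow1 N c) (flow1 N c) k))"
    by (simp only: wl1_diff)
  also have "wl1 0 N (\<lambda>k. \<i> * of_real (disp k) * flow2 N c k - cutoff N (\<lambda>k. \<i> * of_int k * conv N (flow2 N c) c k) k)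
     \<le> wl1 0 N (\<lambda>k. \<i> * of_real (disp k) * flow2 N c k) + wl1 0 N (cutoff N (\<lambda>k. \<i> * of_int k * conv N (flow2 N c) c k))"
    by (rule wl1_diff)
  also have "wl1 0 N (\<lambda>k. \<i> * of_real (disp k) * flow2 N c k) \<le> 2 * wl1 (0 + 5) N (flow2 N c)"
    by (rule wl1_disp) (simp add: norm_mult)
  also have "wl1 0 N (cutoff N (\<lambda>k. \<i> * of_int k * conv N (flow2 N c) c k)) \<le> wl1 (0 + 1) N (flow2 N c) * wl1 (0 + 1) N c"
    by (rule wl1_cutoff_conv[OF assms(1)])
  also have "wl1 0 N (cutoff N (\<lambda>k. \<i> * of_int k * conv N (flow1 N c) (flow1 N c) k)) \<le> wl1 (0 + 1) N (flow1 N c) * wl1 (0 + 1) N (flow1 N c)"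
    by (rule wl1_cutoff_conv[OF supp_flow(1)[OF assms(1)]])
  also have "2 * wl1 (0 + 5) N (flow2 N c) + wl1 (0 + 1) N (flow2 N c) * wl1 (0 + 1) N c + wl1 (0 + 1) N (flow1 N c) * wl1 (0 + 1) N (flow1 N c)
     \<le> 2 * (9 * K0 ^ 3) + 9 * K0 ^ 3 * K0 + 3 * K0 ^ 2 * (3 * K0 ^ 2)"
    by (intro add_mono mult_mono mult_left_mono cs f1s f2s wl1_nonneg) (use K0 in auto)
  also have "\<dots> = 18 * K0 ^ 3 + 18 * K0 ^ 4" by (simp add: eval_nat_numeral)
  finally show "wl1 0 N (flow3 N c) \<le> 36 * K0 ^ 4" using K by simp
qed

lemma deriv_conv:
  fixes f g :: "real \<Rightarrow> int \<Rightarrow> complex"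
  assumes "\<And>k. ((\<lambda>s. f s k) has_vector_derivative f' k) (at t within S)"
    and "\<And>k. ((\<lambda>s. g s k) has_vector_derivative g' k) (at t within S)"
  shows "((\<lambda>s. conv N (f s) (g s) k) has_vector_derivative (conv N (f t) g' k + conv N f' (g t) k)) (at t within S)"
  unfolding conv_def sum.distrib[symmetric]
  by (intro has_vector_derivative_sum has_vector_derivative_mult assms)

lemma deriv_cutoff:
  assumes "((\<lambda>s. f s k) has_vector_derivative f' k) (at t within S)"
  shows "((\<lambda>s. cutoff N (f s) k) has_vector_derivative cutoff N f' k) (at t within S)"
  using assms by (auto simp: cutoff_def)

lemma deriv_flow1:
  assumes "supp N (c t)"
    and "\<And>k. ((\<lambda>s. c s k) has_vector_derivative flow1 N (c t) k) (at t within S)"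
  shows "((\<lambda>s. flow1 N (c s) k) has_vector_derivative flow2 N (c t) k) (at t within S)"
proof -
  have eq: "(\<lambda>s. flow1 N (c s) k) = (\<lambda>s. \<i> * of_real (disp k) * c s k - cutoff N (\<lambda>k. \<i> * of_int k / 2 * conv N (c s) (c s) k) k)"
    by (rule ext) (rule flow1_def)
  have "((\<lambda>s. flow1 N (c s) k) has_vector_derivative
     (\<i> * of_real (disp k) * flow1 N (c t) k
      - cutoff N (\<lambda>k. \<i> * of_int k / 2 * (conv N (c t) (flow1 N (c t)) k + conv N (flow1 N (c t)) (c t) k)) k)) (at t within S)"
    unfolding eq
    by (intro has_vector_derivative_diff has_vector_derivative_mult_right deriv_cutoff deriv_conv assms)
  moreover have "conv N (c t) (flow1 N (c t)) k = conv N (flow1 N (c t)) (c t) k" for k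
    by (rule conv_commute[OF assms(1) supp_flow(1)[OF assms(1)]])
  then have "cutoff N (\<lambda>k. \<i> * of_int k / 2 * (conv N (c t) (flow1 N (c t)) k + conv N (flow1 N (c t)) (c t) k)) k
     = cutoff N (\<lambda>k. \<i> * of_int k * conv N (flow1 N (c t)) (c t) k) k" by (simp add: cutoff_def)
  ultimately show ?thesis by (simp only: flow2_def)
qed

lemma deriv_flow2:
  assumes "supp N (c t)"
    and "\<And>k. ((\<lambda>s. c s k) has_vector_derivative flow1 N (c t) k) (at t within S)"
  shows "((\<lambda>s. flow2 N (c s) k) has_vector_derivative flow3 N (c t) k) (at t within S)"
proof -
  have eq: "(\<lambda>s. flow2 N (c s) k) = (\<lambda>s. \<i> * of_real (disp k) * flow1 N (c s) k - cutoff N (\<lambda>k. \<i> * of_int k * conv N (flow1 N (c s)) (c s) k) k)"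
    by (rule ext) (rule flow2_def)
  have "((\<lambda>s. flow2 N (c s) k) has_vector_derivative
     (\<i> * of_real (disp k) * flow2 N (c t) k
      - cutoff N (\<lambda>k. \<i> * of_int k * (conv N (flow1 N (c t)) (flow1 N (c t)) k + conv N (flow2 N (c t)) (c t) k)) k)) (at t within S)"
    unfolding eq
    by (intro has_vector_derivative_diff has_vector_derivative_mult_right deriv_cutoff deriv_conv deriv_flow1 assms)
  then show ?thesis by (simp add: flow3_def add.commute)
qed

section \<open>Taylor expansion of the central difference\<close>

lemma deriv_ip:
  assumes "\<And>k. ((\<lambda>s. f s k) has_vector_derivative f' k) (at t within S)"
  shows "((\<lambda>s. ip N (f s) g) has_real_derivative ip N f' g) (at t within S)"
  unfolding ip_def has_real_derivative_iff_has_vector_derivative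
  by (intro has_vector_derivative_sum bounded_linear.has_vector_derivative[OF bounded_linear_Re] has_vector_derivative_mult_left assms)

lemma deriv_transport:
  assumes "\<And>k. ((\<lambda>s. W s k) has_vector_derivative W' k) (at t within S)"
  shows "((\<lambda>s. transport N (W s) f g) has_real_derivative transport N W' f g) (at t within S)"
  unfolding transport_eq has_real_derivative_iff_has_vector_derivative
  by (intro has_vector_derivative_sum bounded_linear.has_vector_derivative[OF bounded_linear_Re]
      has_vector_derivative_mult_left has_vector_derivative_mult_right assms)

lemma abs_diff_le_deriv:
  fixes f :: "real \<Rightarrow> real"
  assumes "a \<le> b" "\<And>t. a \<le> t \<Longrightarrow> t \<le> b \<Longrightarrow> (f has_real_derivative f' t) (at t within {a..b})"
    and "\<And>t. a \<le> t \<Longrightarrow> t \<le> b \<Longrightarrow> \<bar>f' t\<bar> \<le> B"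
  shows "\<bar>f b - f a\<bar> \<le> B * (b - a)"
proof -
  have "f b - B * b \<le> f a - B * a"
    by (rule within_nonpos_imp_le[OF assms(1), where f' = "\<lambda>t. f' t - B"])
       (use assms in \<open>auto intro!: derivative_eq_intros simp: abs_le_iff\<close>)
  moreover have "- f b - B * b \<le> - f a - B * a"
    by (rule within_nonpos_imp_le[OF assms(1), where f = "\<lambda>t. - f t - B * t" and f' = "\<lambda>t. - f' t - B"])
       (use assms(3) in \<open>auto intro!: derivative_eq_intros assms(2) simp: abs_le_iff\<close>)
  ultimately show ?thesis by (simp add: abs_le_iff algebra_simps)
qed

text \<open>Three mean value estimates, going back from \<open>f2\<close> to \<open>f\<close>, take
  the place of Taylor's formula, at the price of 2 instead of 1/3. Derivatives are taken within
  [0, T] because t - h and t + h may be its end points.\<close>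

lemma central_difference:
  fixes f :: "real \<Rightarrow> real"
  assumes h: "0 \<le> h" "0 \<le> t - h" "t + h \<le> T"
    and d1: "\<And>s. 0 \<le> s \<Longrightarrow> s \<le> T \<Longrightarrow> (f has_real_derivative f1 s) (at s within {0..T})"
    and d2: "\<And>s. 0 \<le> s \<Longrightarrow> s \<le> T \<Longrightarrow> (f1 has_real_derivative f2 s) (at s within {0..T})"
    and d3: "\<And>s. 0 \<le> s \<Longrightarrow> s \<le> T \<Longrightarrow> (f2 has_real_derivative f3 s) (at s within {0..T})"
    and B: "\<And>s. 0 \<le> s \<Longrightarrow> s \<le> T \<Longrightarrow> \<bar>f3 s\<bar> \<le> B"
  shows "\<bar>f (t + h) - f (t - h) - 2 * h * f1 t\<bar> \<le> 2 * B * h ^ 3"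
proof -
  have shift: "((\<lambda>s. g (t + c * s)) has_real_derivative c * g' (t + c * s)) (at s within {0..h})"
    if g: "\<And>s. 0 \<le> s \<Longrightarrow> s \<le> T \<Longrightarrow> (g has_real_derivative g' s) (at s within {0..T})"
      and c: "c = 1 \<or> c = -1" and s: "0 \<le> s" "s \<le> h" for g g' :: "real \<Rightarrow> real" and c s
  proof -
    have "(g has_real_derivative g' (t + c * s)) (at (t + c * s) within (\<lambda>s. t + c * s) ` {0..h})"
      by (rule DERIV_subset[OF g]) (use c s h in auto)
    moreover have "((\<lambda>s. t + c * s) has_real_derivative c) (at s within {0..h})"
      by (auto intro!: derivative_eq_intros)
    ultimately have "((\<lambda>s. g (t + c * s)) has_real_derivative g' (t + c * s) * c) (at s within {0..h})"
      by (rule DERIV_chain'[rotated, of "\<lambda>s. t + c * s", unfolded o_def] DERIV_image_chain[unfolded o_def])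
    then show ?thesis by (simp add: mult.commute)
  qed
  note plus = shift[where c = 1, simplified] and minus = shift[where c = "-1", simplified]
  have e2: "\<bar>f2 (t + s) - f2 (t - s)\<bar> \<le> 2 * B * h" if s: "0 \<le> s" "s \<le> h" for s
  proof -
    have "\<bar>f2 (t + s) - f2 (t - s)\<bar> \<le> B * ((t + s) - (t - s))"
    proof (rule abs_diff_le_deriv[where f' = f3])
      fix x assume "t - s \<le> x" "x \<le> t + s"
      then show "(f2 has_real_derivative f3 x) (at x within {t - s..t + s})" "\<bar>f3 x\<bar> \<le> B"
        using s h by (auto intro!: DERIV_subset[OF d3] B)
    qed (use s in auto)
    also have "\<dots> = 2 * B * s" by simp
    also have "\<dots> \<le> 2 * B * h" using s B[of t] h by (intro mult_left_mono) auto
    finally show ?thesis .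
  qed
  have e1: "\<bar>f1 (t + s) + f1 (t - s) - 2 * f1 t\<bar> \<le> 2 * B * h * h" if s: "0 \<le> s" "s \<le> h" for s
  proof -
    have "\<bar>(f1 (t + s) + f1 (t - s) - 2 * f1 t) - (f1 (t + 0) + f1 (t - 0) - 2 * f1 t)\<bar> \<le> 2 * B * h * (s - 0)"
    proof (rule abs_diff_le_deriv[where f' = "\<lambda>s. f2 (t + s) - f2 (t - s)"])
      fix x assume x: "0 \<le> x" "x \<le> s"
      have "((\<lambda>s. f1 (t + s) + f1 (t - s) - 2 * f1 t) has_real_derivative f2 (t + x) + - f2 (t - x) - 0) (at x within {0..h})"
        by (intro DERIV_diff DERIV_add plus minus d2 DERIV_const) (use x s in auto)
      then have "((\<lambda>s. f1 (t + s) + f1 (t - s) - 2 * f1 t) has_real_derivative f2 (t + x) - f2 (t - x)) (at x within {0..h})"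
        by simp
      then show "((\<lambda>s. f1 (t + s) + f1 (t - s) - 2 * f1 t) has_real_derivative f2 (t + x) - f2 (t - x)) (at x within {0..s})"
        by (rule DERIV_subset) (use s in auto)
      show "\<bar>f2 (t + x) - f2 (t - x)\<bar> \<le> 2 * B * h" using e2 x s by simp
    qed (use s in auto)
    then have "\<bar>f1 (t + s) + f1 (t - s) - 2 * f1 t\<bar> \<le> 2 * B * h * s" by simp
    also have "\<dots> \<le> 2 * B * h * h" using s B[of t] h by (intro mult_left_mono) auto
    finally show ?thesis .
  qed
  have "\<bar>(f (t + h) - f (t - h) - 2 * h * f1 t) - (f (t + 0) - f (t - 0) - 2 * 0 * f1 t)\<bar> \<le> 2 * B * h * h * (h - 0)"
  proof (rule abs_diff_le_deriv[where f' = "\<lambda>s. f1 (t + s) + f1 (t - s) - 2 * f1 t"])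
    fix x assume x: "0 \<le> x" "x \<le> h"
    have "((\<lambda>s. f (t + s) - f (t - s) - 2 * s * f1 t) has_real_derivative f1 (t + x) - - f1 (t - x) - 2 * 1 * f1 t) (at x within {0..h})"
      by (intro DERIV_diff DERIV_add plus minus d1 DERIV_cmult_right DERIV_cmult DERIV_ident) (use x in auto)
    then show "((\<lambda>s. f (t + s) - f (t - s) - 2 * s * f1 t) has_real_derivative f1 (t + x) + f1 (t - x) - 2 * f1 t) (at x within {0..h})"
      by simp
    show "\<bar>f1 (t + x) + f1 (t - x) - 2 * f1 t\<bar> \<le> 2 * B * h * h" using e1 x by simp
  qed (use h in auto)
  then show ?thesis by (simp add: power3_eq_cube mult_ac)
qed

text \<open>For x at most 1/2, multiplication by 1 + 2x undoes the factor 1 - x, and (1 + x)(1 + 2x)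
  is at most 1 + 4x.\<close>

lemma discrete_gronwall:
  fixes x A B D :: real
  assumes "0 \<le> x" "x \<le> 1/2" "0 \<le> D" "0 \<le> A"
    and "A * (1 - x) \<le> (1 + x) * B + D" "0 \<le> B"
  shows "A \<le> (1 + 4 * x) * B + 2 * D"
proof -
  have "A * (1 - x) * (1 + 2 * x) \<le> ((1 + x) * B + D) * (1 + 2 * x)"
    using assms by (intro mult_right_mono) auto
  moreover have "1 \<le> (1 - x) * (1 + 2 * x)"
    using assms mult_left_mono[OF assms(2), of x] by (simp add: algebra_simps)
  then have "A * 1 \<le> A * ((1 - x) * (1 + 2 * x))" using assms(4) by (rule mult_left_mono)
  moreover have "(1 + x) * (1 + 2 * x) \<le> 1 + 4 * x"
    using assms mult_left_mono[OF assms(2), of x] by (simp add: algebra_simps)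
  then have "(1 + x) * (1 + 2 * x) * B \<le> (1 + 4 * x) * B" using assms(6) by (rule mult_right_mono)
  moreover have "D * (1 + 2 * x) \<le> D * 2" using assms by (intro mult_left_mono) auto
  ultimately show ?thesis by (simp add: algebra_simps)
qed

lemma young_two: "w * (z + x) \<le> w\<^sup>2 + (z\<^sup>2 + x\<^sup>2) / (2::real)"
  using sum_squares_bound[of w z] sum_squares_bound[of w x] by (simp add: field_simps)

text \<open>In \<open>energy_step\<close> the transport terms account for 4 K0^2, the quadratic and
  truncation terms together for K0^2; the rest is margin.\<close>

definition lf_rate :: "real \<Rightarrow> real" where "lf_rate K0 = 6 * K0 ^ 2"

text \<open>With h^4 taken out, 2 D0^2 bounds the initial energy and the term with T the sum of the
  truncation errors of all steps; the outer 2 leads from the energy back to norms.\<close>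

definition lf_const :: "real \<Rightarrow> real \<Rightarrow> real \<Rightarrow> real" where
  "lf_const K0 D0 T = sqrt (2 * (exp (8 * lf_rate K0 * T) * (2 * D0 ^ 2 + 2 * (72 * K0 ^ 4) ^ 2 * T)))"

text \<open>The reciprocal of a sum imposes several smallness conditions at once: 4 + 2 K0 for the
  coercivity of the energy, 4 \<open>lf_rate\<close> for the discrete Gronwall step, 2
  \<open>lf_const\<close> for the bootstrap, and 1 for a value of at most 1. As
  \<open>lf_const\<close> does not refer to the step, there is no circularity.\<close>

definition lf_step :: "real \<Rightarrow> real \<Rightarrow> real \<Rightarrow> real" where
  "lf_step K0 D0 T = 1 / (5 + 2 * K0 + 4 * lf_rate K0 + 2 * lf_const K0 D0 T)"

locale leapfrog =
  fixes N :: int and h K0 D0 T :: real and M :: nat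
    and c :: "real \<Rightarrow> int \<Rightarrow> complex" and v :: "nat \<Rightarrow> int \<Rightarrow> complex"
  assumes N1: "1 \<le> N" and h0: "0 < h" and T0: "0 \<le> T" and MT: "real M * h \<le> T"
    and K0: "1 \<le> K0" and D0: "0 \<le> D0" and cfl: "real_of_int N ^ 5 * h \<le> lf_step K0 D0 T"
    and supp_c: "\<And>t. 0 \<le> t \<Longrightarrow> t \<le> T \<Longrightarrow> supp N (c t)"
    and herm_c: "\<And>t. 0 \<le> t \<Longrightarrow> t \<le> T \<Longrightarrow> herm (c t)"
    and dc: "\<And>t k. 0 \<le> t \<Longrightarrow> t \<le> T \<Longrightarrow> ((\<lambda>s. c s k) has_vector_derivative flow1 N (c t) k) (at t within {0..T})"
    and wl1_c: "\<And>t. 0 \<le> t \<Longrightarrow> t \<le> T \<Longrightarrow> wl1 15 N (c t) \<le> K0"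
    and supp_v: "\<And>m. m \<le> M \<Longrightarrow> supp N (v m)"
    and herm_v: "\<And>m. m \<le> M \<Longrightarrow> herm (v m)"
    and scheme: "\<And>m k. 1 \<le> m \<Longrightarrow> m + 1 \<le> M \<Longrightarrow> \<bar>k\<bar> \<le> N \<Longrightarrow>
      v (m + 1) k - v (m - 1) k = 2 * of_real h * flow1 N (v m) k"
    and v0: "\<And>k. \<bar>k\<bar> \<le> N \<Longrightarrow> v 0 k = c 0 k"
    and v1: "l2 N (\<lambda>k. c h k - v 1 k) \<le> D0 * h ^ 2"
begin

section \<open>Errors, truncation and the leapfrog energy\<close>

definition tm :: "nat \<Rightarrow> real" where "tm m = real m * h"

lemma tm: "m \<le> M \<Longrightarrow> 0 \<le> tm m \<and> tm m \<le> T"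
proof -
  assume "m \<le> M"
  then have "real m * h \<le> real M * h" using h0 by (intro mult_right_mono) auto
  then have "real m * h \<le> T" using MT by linarith
  then show ?thesis using h0 by (simp add: tm_def)
qed

definition err :: "nat \<Rightarrow> int \<Rightarrow> complex" where "err m k = c (tm m) k - v m k"

definition trunc :: "nat \<Rightarrow> int \<Rightarrow> complex" where
  "trunc m k = c (tm (m + 1)) k - c (tm (m - 1)) k - 2 * of_real h * flow1 N (c (tm m)) k"

lemma supp_err: "m \<le> M \<Longrightarrow> supp N (err m)"
  unfolding err_def[abs_def] using tm by (intro supp_diff supp_c supp_v) auto

lemma ip_flow3_le:
  assumes "0 \<le> t" "t \<le> T"
  shows "\<bar>ip N (flow3 N (c t)) g\<bar> \<le> 36 * K0 ^ 4 * l2 N g"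
proof -
  have "l2 N (flow3 N (c t)) \<le> wl1 0 N (flow3 N (c t))" using l2_le_l1 by (simp add: wl1_0)
  also have "\<dots> \<le> 36 * K0 ^ 4" by (rule wl1_flow[OF supp_c[OF assms] wl1_c[OF assms] K0])
  finally have "l2 N (flow3 N (c t)) * l2 N g \<le> 36 * K0 ^ 4 * l2 N g" by (rule mult_right_mono) (rule l2_nonneg)
  with ip_cauchy_schwarz show ?thesis by (rule order_trans)
qed

lemma l2_trunc:
  assumes "1 \<le> m" "m + 1 \<le> M"
  shows "l2 N (trunc m) \<le> 72 * K0 ^ 4 * h ^ 3"
proof -
  \<comment> \<open>testing with the truncation error itself reduces the claim to a scalar Taylor expansion\<close>
  let ?g = "trunc m"
  have t: "tm (m + 1) = tm m + h" "tm (m - 1) = tm m - h"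
    using assms by (auto simp: tm_def algebra_simps of_nat_diff)
  have 1: "\<bar>ip N (c (tm m + h)) ?g - ip N (c (tm m - h)) ?g - 2 * h * ip N (flow1 N (c (tm m))) ?g\<bar> \<le> 2 * (36 * K0 ^ 4 * l2 N ?g) * h ^ 3"
  proof (rule central_difference[where T = T])
    show "0 \<le> h" "0 \<le> tm m - h" "tm m + h \<le> T"
      using h0 tm[of "m - 1"] tm[of "m + 1"] assms t by auto
    fix s assume s: "0 \<le> s" "s \<le> T"
    note sc = supp_c[OF s]
    show "((\<lambda>s. ip N (c s) ?g) has_real_derivative ip N (flow1 N (c s)) ?g) (at s within {0..T})"
      by (intro deriv_ip dc s)
    show "((\<lambda>s. ip N (flow1 N (c s)) ?g) has_real_derivative ip N (flow2 N (c s)) ?g) (at s within {0..T})"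
      by (intro deriv_ip deriv_flow1 dc s sc)
    show "((\<lambda>s. ip N (flow2 N (c s)) ?g) has_real_derivative ip N (flow3 N (c s)) ?g) (at s within {0..T})"
      by (intro deriv_ip deriv_flow2 dc s sc)
    show "\<bar>ip N (flow3 N (c s)) ?g\<bar> \<le> 36 * K0 ^ 4 * l2 N ?g" by (rule ip_flow3_le[OF s])
  qed
  have "(l2 N ?g)\<^sup>2 = ip N ?g ?g" by (simp add: ip_self)
  also have "\<dots> = ip N (\<lambda>k. c (tm m + h) k - c (tm m - h) k - of_real (2 * h) * flow1 N (c (tm m)) k) ?g"
    by (rule ip_cong) (simp_all only: trunc_def t of_real_mult of_real_numeral)
  also have "\<dots> = ip N (c (tm m + h)) ?g - ip N (c (tm m - h)) ?g - 2 * h * ip N (flow1 N (c (tm m))) ?g"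
    unfolding ip_diff_left ip_scale_left ..
  also have "\<dots> \<le> 2 * (36 * K0 ^ 4 * l2 N ?g) * h ^ 3" using 1 by simp
  finally have "l2 N ?g * l2 N ?g \<le> (72 * K0 ^ 4 * h ^ 3) * l2 N ?g" by (simp add: power2_eq_square mult_ac)
  moreover have "0 \<le> 72 * K0 ^ 4 * h ^ 3" using h0 K0 by simp
  ultimately show ?thesis
    using l2_nonneg[of N ?g] by (cases "l2 N ?g = 0") (auto simp: mult_le_cancel_right)
qed

lemma err_step:
  assumes "1 \<le> m" "m + 1 \<le> M" "\<bar>k\<bar> \<le> N"
  shows "err (m + 1) k - err (m - 1) k = of_real (2 * h) * (\<i> * of_real (disp k) * err m k)
    - of_real (2 * h) * (\<i> * of_int k * conv N (err m) (c (tm m)) k)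
    + of_real h * (\<i> * of_int k * conv N (err m) (err m) k) + trunc m k"
proof -
  have m: "m \<le> M" using assms by simp
  have sc: "supp N (c (tm m))" using supp_c tm[OF m] by blast
  have "conv N (v m) (v m) k = conv N (c (tm m)) (c (tm m)) k - 2 * conv N (err m) (c (tm m)) k + conv N (err m) (err m) k"
  proof -
    have "c (tm m) = (\<lambda>k. v m k + err m k)" by (simp add: err_def)
    then have 1: "conv N (c (tm m)) (c (tm m)) k = conv N (v m) (v m) k + 2 * conv N (v m) (err m) k + conv N (err m) (err m) k"
      and 2: "conv N (err m) (c (tm m)) k = conv N (err m) (v m) k + conv N (err m) (err m) k"
      using conv_square[OF supp_v[OF m] supp_err[OF m]] by (simp_all only: conv_add_right)
    show ?thesis unfolding 1 2 conv_commute[OF supp_err[OF m] supp_v[OF m]] by simp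
  qed
  then have cc: "conv N (c (tm m)) (c (tm m)) k - conv N (v m) (v m) k = 2 * conv N (err m) (c (tm m)) k - conv N (err m) (err m) k"
    by simp
  have "flow1 N (c (tm m)) k - flow1 N (v m) k = \<i> * of_real (disp k) * err m k
     - \<i> * of_int k / 2 * (conv N (c (tm m)) (c (tm m)) k - conv N (v m) (v m) k)"
    using assms(3) by (simp add: flow1_def cutoff_def err_def algebra_simps)
  then have "flow1 N (c (tm m)) k - flow1 N (v m) k = \<i> * of_real (disp k) * err m k
     - \<i> * of_int k * conv N (err m) (c (tm m)) k + \<i> * of_int k / 2 * conv N (err m) (err m) k"
    unfolding cc by (simp add: algebra_simps)
  note d = this
  have "2 * of_real h * (flow1 N (c (tm m)) k - flow1 N (v m) k) = of_real (2 * h) * (\<i> * of_real (disp k) * err m k)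
    - of_real (2 * h) * (\<i> * of_int k * conv N (err m) (c (tm m)) k)
    + of_real h * (\<i> * of_int k * conv N (err m) (err m) k)"
    unfolding d by (simp add: algebra_simps)
  moreover have "err (m + 1) k - err (m - 1) k = 2 * of_real h * (flow1 N (c (tm m)) k - flow1 N (v m) k) + trunc m k"
    using scheme[OF assms] by (simp add: err_def trunc_def algebra_simps)
  ultimately show ?thesis by simp
qed

definition G :: "nat \<Rightarrow> real" where "G m = (l2 N (err (m + 1)))\<^sup>2 + (l2 N (err m))\<^sup>2"

definition A :: "nat \<Rightarrow> real" where "A m = ip N (\<lambda>k. \<i> * of_real (disp k) * err m k) (err (m + 1))"

definition Q :: "nat \<Rightarrow> real" where "Q m = transport N (c (tm m)) (err m) (err (m + 1))"

text \<open>
  The cross terms \<open>A\<close> and \<open>Q\<close> turn the contributions of the skew operators in the scheme into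
  telescoping differences; the step restriction makes \<open>energy\<close> equivalent to \<open>G\<close>.
\<close>

definition energy :: "nat \<Rightarrow> real" where "energy m = G m - 2 * h * A m + 2 * h * Q m"

abbreviation (input) "C1 \<equiv> lf_step K0 D0 T"

lemma lf_const_nonneg: "0 \<le> lf_const K0 D0 T"
  unfolding lf_const_def using K0 D0 T0 by simp

lemma lf_rate_pos: "6 \<le> lf_rate K0" "6 * K0 \<le> lf_rate K0"
  unfolding lf_rate_def using K0 one_le_power[OF K0, of 2] power_increasing[of 1 2 K0] by auto

lemma lf_step_bounds: "0 < C1" "C1 * 4 \<le> 1 - C1 * (2 * K0)" "4 * lf_rate K0 * C1 \<le> 1" "2 * lf_const K0 D0 T * C1 \<le> 1" "C1 \<le> 1"
proof -
  let ?s = "5 + 2 * K0 + 4 * lf_rate K0 + 2 * lf_const K0 D0 T"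
  have s: "0 < ?s" using lf_const_nonneg lf_rate_pos K0 by linarith
  have *: "y * C1 \<le> 1" if "y \<le> ?s" for y
    unfolding lf_step_def using s that by (simp add: divide_le_eq)
  show "0 < C1" using s by (simp add: lf_step_def)
  show "4 * lf_rate K0 * C1 \<le> 1" "2 * lf_const K0 D0 T * C1 \<le> 1"
    by (intro *; use lf_const_nonneg lf_rate_pos K0 in linarith)+
  have "(4 + 2 * K0) * C1 \<le> 1" by (intro *; use lf_const_nonneg lf_rate_pos K0 in linarith)
  then show "C1 * 4 \<le> 1 - C1 * (2 * K0)" by (simp add: algebra_simps)
  have "1 * C1 \<le> 1" by (intro *; use lf_const_nonneg lf_rate_pos K0 in linarith)
  then show "C1 \<le> 1" by simp
qed

lemma rN1: "1 \<le> real_of_int N" using N1 by simp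

lemma cfl': "real_of_int N ^ p * h \<le> C1" if "p \<le> 5"
proof -
  have "real_of_int N ^ p * h \<le> real_of_int N ^ 5 * h"
    using that rN1 h0 by (intro mult_right_mono power_increasing) auto
  then show ?thesis using cfl by simp
qed

lemma l1_c: "m \<le> M \<Longrightarrow> l1 N (c (tm m)) \<le> K0" and wl1_c': "m \<le> M \<Longrightarrow> l1 N (\<lambda>k. of_real (wt k) * c (tm m) k) \<le> K0"
  using wl1_c[of "tm m"] tm[of m] wl1_mono[of 0 15 N "c (tm m)"] wl1_mono[of 1 15 N "c (tm m)"]
  by (auto simp: wl1_def)

text \<open>On the modes in question \<open>disp\<close> is at most 2 N^5. This is the one place
  that uses the step restriction in full; elsewhere h, N h and N^2 h suffice.\<close>

lemma A_bound: "\<bar>2 * h * A m\<bar> \<le> 2 * C1 * G m"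
proof -
  have "l2 N (\<lambda>k. \<i> * of_real (disp k) * err m k) \<le> (2 * real_of_int N ^ 5) * l2 N (err m)"
  proof (rule l2_mono)
    fix k assume k: "\<bar>k\<bar> \<le> N"
    have "\<bar>disp k\<bar> \<le> \<bar>real_of_int k\<bar> ^ 3 + \<bar>real_of_int k\<bar> ^ 5"
      unfolding disp_def by (rule order_trans[OF abs_triangle_ineq]) (simp add: power_abs)
    also have "\<dots> \<le> real_of_int N ^ 3 + real_of_int N ^ 5" using k by (intro add_mono power_mono) auto
    also have "real_of_int N ^ 3 \<le> real_of_int N ^ 5" using rN1 by (intro power_increasing) auto
    finally show "cmod (\<i> * of_real (disp k) * err m k) \<le> 2 * real_of_int N ^ 5 * cmod (err m k)"
      by (simp add: norm_mult mult_right_mono)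
  qed (use N1 in auto)
  then have "\<bar>A m\<bar> \<le> (2 * real_of_int N ^ 5) * l2 N (err m) * l2 N (err (m + 1))"
    unfolding A_def by (rule order_trans[OF ip_cauchy_schwarz mult_right_mono]) (rule l2_nonneg)
  also have "\<dots> = real_of_int N ^ 5 * (2 * l2 N (err m) * l2 N (err (m + 1)))" by simp
  also have "\<dots> \<le> real_of_int N ^ 5 * G m"
    unfolding G_def using N1 sum_squares_bound[of "l2 N (err m)" "l2 N (err (m + 1))"] by (intro mult_left_mono) auto
  finally have "2 * h * \<bar>A m\<bar> \<le> 2 * h * (real_of_int N ^ 5 * G m)" using h0 by (intro mult_left_mono) auto
  also have "\<dots> = 2 * (real_of_int N ^ 5 * h) * G m" by simp
  also have "\<dots> \<le> 2 * C1 * G m" using cfl by (intro mult_right_mono mult_left_mono) (auto simp: G_def)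
  finally show ?thesis using h0 by (simp add: abs_mult)
qed

lemma Q_bound:
  assumes "m \<le> M"
  shows "\<bar>2 * h * Q m\<bar> \<le> C1 * K0 * G m"
proof -
  have sc: "supp N (c (tm m))" using supp_c tm[OF assms] by blast
  have "\<bar>Q m\<bar> \<le> real_of_int N * l1 N (c (tm m)) * l2 N (err m) * l2 N (err (m + 1))"
    unfolding Q_def by (rule transport_le[OF sc supp_err[OF assms]])
  also have "\<dots> \<le> real_of_int N * K0 * l2 N (err m) * l2 N (err (m + 1))"
    by (intro mult_right_mono mult_left_mono l1_c assms l2_nonneg) (use N1 in auto)
  finally have "2 * \<bar>Q m\<bar> \<le> (real_of_int N * K0) * (2 * l2 N (err m) * l2 N (err (m + 1)))" by simp
  also have "\<dots> \<le> (real_of_int N * K0) * G m"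
    unfolding G_def using N1 K0 sum_squares_bound[of "l2 N (err m)" "l2 N (err (m + 1))"] by (intro mult_left_mono) auto
  finally have "h * (2 * \<bar>Q m\<bar>) \<le> h * ((real_of_int N * K0) * G m)" using h0 by (intro mult_left_mono) auto
  also have "\<dots> = (real_of_int N ^ 1 * h) * (K0 * G m)" by simp
  also have "\<dots> \<le> C1 * (K0 * G m)" using cfl'[of 1] K0 by (intro mult_right_mono) (auto simp: G_def)
  finally show ?thesis using h0 by (simp add: abs_mult mult_ac)
qed

lemma energy_bounds:
  assumes "m \<le> M"
  shows "G m \<le> 2 * energy m" "energy m \<le> 2 * G m"
proof -
  have G: "0 \<le> G m" by (simp add: G_def)
  have "C1 * 2 + C1 * K0 \<le> 1 / 2" using lf_step_bounds(2) by simp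
  then have "(C1 * 2 + C1 * K0) * G m \<le> 1 / 2 * G m" using G by (rule mult_right_mono)
  then have "2 * C1 * G m + C1 * K0 * G m \<le> 1 / 2 * G m" by (simp add: algebra_simps)
  moreover have "g \<le> 2 * (g - a + q) \<and> g - a + q \<le> 2 * g"
    if "x + y \<le> 1 / 2 * g" "\<bar>a\<bar> \<le> x" "\<bar>q\<bar> \<le> y" "0 \<le> g" for g a q x y :: real
    using that by (auto simp: abs_le_iff)
  ultimately show "G m \<le> 2 * energy m" "energy m \<le> 2 * G m"
    using A_bound[of m] Q_bound[OF assms] G unfolding energy_def by blast+
qed

text \<open>Over one step the coefficient moves by O(h), while the derivative costs N; as N h is at
  most 1, the increment acts as a bounded form.\<close>

lemma transport_increment:
  assumes "1 \<le> m" "m \<le> M" "supp N f"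
  shows "\<bar>transport N (\<lambda>k. c (tm m) k - c (tm (m - 1)) k) f g\<bar> \<le> 3 * K0 ^ 2 * l2 N f * l2 N g"
proof -
  have t: "tm m - tm (m - 1) = h" using assms(1) by (simp add: tm_def algebra_simps of_nat_diff)
  have "\<bar>transport N (c (tm m)) f g - transport N (c (tm (m - 1))) f g\<bar>
    \<le> (real_of_int N * (3 * K0 ^ 2) * l2 N f * l2 N g) * (tm m - tm (m - 1))"
  proof (rule abs_diff_le_deriv[where f' = "\<lambda>s. transport N (flow1 N (c s)) f g"])
    show "tm (m - 1) \<le> tm m" using t h0 by simp
    fix s assume s: "tm (m - 1) \<le> s" "s \<le> tm m"
    have tt: "0 \<le> tm (m - 1)" "tm m \<le> T" using tm[of "m - 1"] tm[of m] assms by auto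
    have s': "0 \<le> s" "s \<le> T" using s tt by linarith+
    show "((\<lambda>s. transport N (c s) f g) has_real_derivative transport N (flow1 N (c s)) f g) (at s within {tm (m - 1)..tm m})"
      by (rule DERIV_subset[OF deriv_transport[OF dc[OF s']]]) (use tt in auto)
    have "\<bar>transport N (flow1 N (c s)) f g\<bar> \<le> real_of_int N * l1 N (flow1 N (c s)) * l2 N f * l2 N g"
      by (rule transport_le[OF supp_flow(1)[OF supp_c[OF s']] assms(3)])
    also have "\<dots> \<le> real_of_int N * (3 * K0 ^ 2) * l2 N f * l2 N g"
    proof (intro mult_right_mono mult_left_mono l2_nonneg)
      show "l1 N (flow1 N (c s)) \<le> 3 * K0 ^ 2"
        using wl1_mono[of 0 10 N "flow1 N (c s)"] wl1_flow(1)[OF supp_c[OF s'] wl1_c[OF s'] K0] by (simp add: wl1_0)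
    qed (use N1 in auto)
    finally show "\<bar>transport N (flow1 N (c s)) f g\<bar> \<le> real_of_int N * (3 * K0 ^ 2) * l2 N f * l2 N g" .
  qed
  also have "\<dots> = (real_of_int N ^ 1 * h) * (3 * K0 ^ 2 * l2 N f * l2 N g)" unfolding t by simp
  also have "\<dots> \<le> 1 * (3 * K0 ^ 2 * l2 N f * l2 N g)"
    using cfl'[of 1] lf_step_bounds(5) K0 by (intro mult_right_mono mult_nonneg_nonneg l2_nonneg) auto
  finally show ?thesis by (simp add: transport_diff)
qed

text \<open>One factor N is lost to the derivative and 2N to the passage from l2 to l1. Under the
  smallness assumption the quadratic term then behaves like a bounded linear one.\<close>

lemma quadratic_le:
  assumes "m \<le> M" "2 * real_of_int N ^ 2 * l2 N (err m) \<le> 1"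
  shows "\<bar>ip N (\<lambda>k. \<i> * of_int k * conv N (err m) (err m) k) g\<bar> \<le> l2 N (err m) * l2 N g"
proof -
  have "\<bar>transport N (err m) (err m) g\<bar> \<le> real_of_int N * l1 N (err m) * l2 N (err m) * l2 N g"
    by (rule transport_le[OF supp_err[OF assms(1)] supp_err[OF assms(1)]])
  also have "\<dots> \<le> real_of_int N * (2 * real_of_int N * l2 N (err m)) * l2 N (err m) * l2 N g"
    by (intro mult_right_mono mult_left_mono l2_nonneg l1_le_l2 N1) (use N1 in auto)
  also have "\<dots> = (2 * real_of_int N ^ 2 * l2 N (err m)) * (l2 N (err m) * l2 N g)"
    by (simp add: power2_eq_square)
  also have "\<dots> \<le> 1 * (l2 N (err m) * l2 N g)"
    by (intro mult_right_mono assms mult_nonneg_nonneg l2_nonneg)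
  finally show ?thesis by (simp add: transport_def)
qed

text \<open>Testing the error equation with the sum of the levels m + 1 and m - 1 makes the squares
  telescope. The dispersive part is skew and telescopes as well; the transport does so up to its
  symmetric part and the change of its coefficient in time.\<close>

lemma energy_identity:
  assumes "1 \<le> m" "m + 1 \<le> M"
  shows "energy m - energy (m - 1) =
    - 2 * h * (transport N (c (tm m)) (err m) (err (m - 1)) + transport N (c (tm m)) (err (m - 1)) (err m))
    + 2 * h * transport N (\<lambda>k. c (tm m) k - c (tm (m - 1)) k) (err (m - 1)) (err m)
    + h * ip N (\<lambda>k. \<i> * of_int k * conv N (err m) (err m) k) (\<lambda>k. err (m + 1) k + err (m - 1) k)
    + ip N (trunc m) (\<lambda>k. err (m + 1) k + err (m - 1) k)"
proof -
  obtain p where m: "m = Suc p" using assms(1) by (cases m) auto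
  let ?g = "\<lambda>k. err (m + 1) k + err (m - 1) k"
  let ?L = "\<lambda>k. \<i> * of_real (disp k) * err m k"
  have "G m - G (m - 1) = (l2 N (err (m + 1)))\<^sup>2 - (l2 N (err (m - 1)))\<^sup>2"
    unfolding G_def m by simp
  also have "\<dots> = ip N (\<lambda>k. err (m + 1) k - err (m - 1) k) ?g"
    unfolding ip_diff_left ip_add_right ip_self ip_commute[of N "err (m - 1)" "err (m + 1)"] by simp
  also have "\<dots> = ip N (\<lambda>k. of_real (2 * h) * ?L k - of_real (2 * h) * (\<i> * of_int k * conv N (err m) (c (tm m)) k)
    + of_real h * (\<i> * of_int k * conv N (err m) (err m) k) + trunc m k) ?g"
    by (rule ip_cong) (use err_step[OF assms] in auto)
  also have "\<dots> = 2 * h * ip N ?L ?g - 2 * h * transport N (c (tm m)) (err m) ?g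
    + h * ip N (\<lambda>k. \<i> * of_int k * conv N (err m) (err m) k) ?g + ip N (trunc m) ?g"
    unfolding ip_diff_left ip_add_left ip_scale_left transport_def ..
  also have "ip N ?L ?g = A m - A (m - 1)"
    unfolding ip_add_right ip_skew[of N disp "err m" "err (m - 1)"] A_def using m by simp
  also have "transport N (c (tm m)) (err m) ?g = Q m + transport N (c (tm m)) (err m) (err (m - 1))"
    unfolding transport_add_right Q_def by simp
  finally have 1: "G m - G (m - 1) = 2 * h * (A m - A (m - 1)) - 2 * h * (Q m + transport N (c (tm m)) (err m) (err (m - 1)))
    + h * ip N (\<lambda>k. \<i> * of_int k * conv N (err m) (err m) k) ?g + ip N (trunc m) ?g" .
  have 2: "Q (m - 1) = transport N (c (tm m)) (err (m - 1)) (err m)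
     - transport N (\<lambda>k. c (tm m) k - c (tm (m - 1)) k) (err (m - 1)) (err m)"
    unfolding transport_diff Q_def using m by simp
  show ?thesis
    using 1 unfolding energy_def 2 by (simp add: algebra_simps)
qed

lemma energy_step:
  assumes m: "1 \<le> m" "m + 1 \<le> M" and small: "2 * real_of_int N ^ 2 * l2 N (err m) \<le> 1"
  shows "energy m \<le> energy (m - 1) + lf_rate K0 * h * (G m + G (m - 1)) + (72 * K0 ^ 4)\<^sup>2 * h ^ 5"
proof -
  let ?x = "l2 N (err (m - 1))" and ?y = "l2 N (err m)" and ?z = "l2 N (err (m + 1))"
  let ?g = "\<lambda>k. err (m + 1) k + err (m - 1) k" and ?D = "72 * K0 ^ 4"
  have mM: "m \<le> M" "m - 1 \<le> M" using m by auto
  have g: "l2 N ?g \<le> ?z + ?x" by (rule l2_triangle)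
  have sc: "supp N (c (tm m))" "herm (c (tm m))" using supp_c herm_c tm[OF mM(1)] by blast+
  have "\<bar>transport N (c (tm m)) (err m) (err (m - 1)) + transport N (c (tm m)) (err (m - 1)) (err m)\<bar>
     \<le> l1 N (\<lambda>k. of_real (wt k) * c (tm m) k) * ?y * ?x"
    by (rule transport_sym_le[OF sc(2,1) supp_err[OF mM(1)]])
  also have "\<dots> \<le> K0 * ?y * ?x" by (intro mult_right_mono wl1_c' mM l2_nonneg)
  finally have 1: "\<bar>transport N (c (tm m)) (err m) (err (m - 1)) + transport N (c (tm m)) (err (m - 1)) (err m)\<bar> \<le> K0 * (?x * ?y)"
    by (simp add: mult_ac)
  have 2: "\<bar>transport N (\<lambda>k. c (tm m) k - c (tm (m - 1)) k) (err (m - 1)) (err m)\<bar> \<le> 3 * K0 ^ 2 * (?x * ?y)"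
    using transport_increment[OF m(1) mM(1) supp_err[OF mM(2)], of "err m"] by (simp add: mult_ac)
  have "\<bar>ip N (\<lambda>k. \<i> * of_int k * conv N (err m) (err m) k) ?g\<bar> \<le> ?y * l2 N ?g"
    by (rule quadratic_le[OF mM(1) small])
  also have "\<dots> \<le> ?y * (?z + ?x)" by (intro mult_left_mono g l2_nonneg)
  finally have 3: "\<bar>ip N (\<lambda>k. \<i> * of_int k * conv N (err m) (err m) k) ?g\<bar> \<le> ?y * (?z + ?x)" .
  have "\<bar>ip N (trunc m) ?g\<bar> \<le> l2 N (trunc m) * l2 N ?g" by (rule ip_cauchy_schwarz)
  also have "\<dots> \<le> (?D * h ^ 3) * (?z + ?x)"
    by (intro mult_mono l2_trunc m g l2_nonneg) (use h0 K0 in auto)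
  \<comment> \<open>Splitting off one factor h leaves h^5 per step from the truncation error, that
    is h^4 after T/h steps.\<close>
  also have "\<dots> = h * ((?D * h ^ 2) * (?z + ?x))" by (simp add: power2_eq_square power3_eq_cube)
  also have "\<dots> \<le> h * ((?D * h ^ 2)\<^sup>2 + (?z\<^sup>2 + ?x\<^sup>2) / 2)"
  proof (intro mult_left_mono)
    show "(?D * h ^ 2) * (?z + ?x) \<le> (?D * h ^ 2)\<^sup>2 + (?z\<^sup>2 + ?x\<^sup>2) / 2"
      by (rule young_two)
  qed (use h0 in auto)
  finally have 4: "\<bar>ip N (trunc m) ?g\<bar> \<le> h * ((?D * h ^ 2)\<^sup>2 + (?z\<^sup>2 + ?x\<^sup>2) / 2)" .
  have K: "K0 \<le> K0 ^ 2" "1 \<le> K0 ^ 2" using K0 power_increasing[of 1 2 K0] by (auto simp: one_le_power)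
  have xy: "2 * (?x * ?y) \<le> ?x\<^sup>2 + ?y\<^sup>2" and yz: "2 * (?y * ?z) \<le> ?y\<^sup>2 + ?z\<^sup>2"
    using sum_squares_bound[of ?x ?y] sum_squares_bound[of ?y ?z] by (simp_all add: mult_ac)
  have xy0: "0 \<le> ?x * ?y" by (intro mult_nonneg_nonneg l2_nonneg)
  have "2 * (K0 * (?x * ?y)) + 2 * (3 * K0 ^ 2 * (?x * ?y)) + ?y * (?z + ?x) + (?z\<^sup>2 + ?x\<^sup>2) / 2
     \<le> lf_rate K0 * (G m + G (m - 1))"
  proof -
    have "2 * (K0 * (?x * ?y)) + 2 * (3 * K0 ^ 2 * (?x * ?y)) \<le> 2 * (K0 ^ 2 * (?x * ?y)) + 2 * (3 * K0 ^ 2 * (?x * ?y))"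
      using mult_right_mono[OF K(1) xy0] by linarith
    also have "\<dots> = 4 * K0 ^ 2 * (2 * (?x * ?y))" by simp
    also have "\<dots> \<le> 4 * K0 ^ 2 * (?x\<^sup>2 + ?y\<^sup>2)" using xy by (intro mult_left_mono) auto
    also have "\<dots> \<le> 4 * K0 ^ 2 * (G m + G (m - 1))"
      using m(1) by (intro mult_left_mono) (auto simp: G_def)
    finally have a: "2 * (K0 * (?x * ?y)) + 2 * (3 * K0 ^ 2 * (?x * ?y)) \<le> 4 * K0 ^ 2 * (G m + G (m - 1))" .
    have "G m + G (m - 1) = ?z\<^sup>2 + ?y\<^sup>2 + ?y\<^sup>2 + ?x\<^sup>2" using m(1) by (simp add: G_def)
    moreover have "?y * (?z + ?x) \<le> ?y\<^sup>2 + (?z\<^sup>2 + ?x\<^sup>2) / 2" by (rule young_two)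
    moreover have "0 \<le> ?y\<^sup>2" by simp
    moreover have "p + b / 2 \<le> 1 * g" if "g = z + y + y + x" "p \<le> y + b / 2" "0 \<le> y" "b = z + x" for g p b x y z :: real
      using that by (simp add: field_simps)
    ultimately have "?y * (?z + ?x) + (?z\<^sup>2 + ?x\<^sup>2) / 2 \<le> 1 * (G m + G (m - 1))"
      by blast
    also have "\<dots> \<le> K0 ^ 2 * (G m + G (m - 1))" by (rule mult_right_mono[OF K(2)]) (simp add: G_def)
    finally have b: "?y * (?z + ?x) + (?z\<^sup>2 + ?x\<^sup>2) / 2 \<le> K0 ^ 2 * (G m + G (m - 1))" .
    have "0 \<le> K0 ^ 2 * (G m + G (m - 1))" by (simp add: G_def)
    with a b show ?thesis unfolding lf_rate_def by (simp add: mult.assoc)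
  qed
  then have 5: "h * (2 * (K0 * (?x * ?y)) + 2 * (3 * K0 ^ 2 * (?x * ?y)) + ?y * (?z + ?x) + (?z\<^sup>2 + ?x\<^sup>2) / 2)
     \<le> h * (lf_rate K0 * (G m + G (m - 1)))" using h0 by (intro mult_left_mono) auto
  have "energy m - energy (m - 1) \<le> 2 * h * (K0 * (?x * ?y)) + 2 * h * (3 * K0 ^ 2 * (?x * ?y)) + h * (?y * (?z + ?x))
     + h * ((?D * h ^ 2)\<^sup>2 + (?z\<^sup>2 + ?x\<^sup>2) / 2)"
  proof -
    let ?S = "transport N (c (tm m)) (err m) (err (m - 1)) + transport N (c (tm m)) (err (m - 1)) (err m)"
    let ?T = "transport N (\<lambda>k. c (tm m) k - c (tm (m - 1)) k) (err (m - 1)) (err m)"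
    let ?I = "ip N (\<lambda>k. \<i> * of_int k * conv N (err m) (err m) k) ?g"
    have "- ?S \<le> K0 * (?x * ?y)" using 1 by linarith
    then have "2 * h * (- ?S) \<le> 2 * h * (K0 * (?x * ?y))" using h0 by (intro mult_left_mono) auto
    moreover have "2 * h * ?T \<le> 2 * h * (3 * K0 ^ 2 * (?x * ?y))" using 2 h0 by (intro mult_left_mono) auto
    moreover have "h * ?I \<le> h * (?y * (?z + ?x))" using 3 h0 by (intro mult_left_mono) auto
    ultimately show ?thesis unfolding energy_identity[OF m] using 4 by linarith
  qed
  also have "\<dots> = h * (2 * (K0 * (?x * ?y)) + 2 * (3 * K0 ^ 2 * (?x * ?y)) + ?y * (?z + ?x) + (?z\<^sup>2 + ?x\<^sup>2) / 2) + h * (?D * h ^ 2)\<^sup>2"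
    by (simp add: distrib_left add_divide_distrib)
  also have "\<dots> \<le> h * (lf_rate K0 * (G m + G (m - 1))) + h * (?D * h ^ 2)\<^sup>2" using 5 by simp
  also have "h * (?D * h ^ 2)\<^sup>2 = ?D\<^sup>2 * h ^ 5"
    unfolding power_mult_distrib power_mult[symmetric] by (simp add: power_Suc[symmetric] mult.left_commute)
  finally show ?thesis by (simp add: mult_ac)
qed

section \<open>Growth of the energy and the bootstrap\<close>

lemma energy_nonneg: "m \<le> M \<Longrightarrow> 0 \<le> energy m"
  using order_trans[OF _ energy_bounds(1), of 0 m] by (simp add: G_def)

lemma energy_growth:
  assumes m: "1 \<le> m" "m + 1 \<le> M" and small: "2 * real_of_int N ^ 2 * l2 N (err m) \<le> 1"
  shows "energy m \<le> exp (8 * lf_rate K0 * h) * energy (m - 1) + 2 * ((72 * K0 ^ 4)\<^sup>2 * h ^ 5)"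
proof -
  \<comment> \<open>The factor 2 comes from estimating \<open>G\<close> by twice the energy at both
    levels; 4x then yields the exponent 8 \<open>lf_rate\<close> h.\<close>
  define x where "x = 2 * lf_rate K0 * h"
  have L: "0 \<le> lf_rate K0 * h" using lf_rate_pos h0 by simp
  have "lf_rate K0 * h \<le> lf_rate K0 * C1" using cfl'[of 0] lf_rate_pos by (intro mult_left_mono) auto
  then have x: "0 \<le> x" "x \<le> 1/2" using lf_step_bounds(3) L by (auto simp: x_def mult_ac)
  have "lf_rate K0 * h * (G m + G (m - 1)) \<le> lf_rate K0 * h * (2 * energy m + 2 * energy (m - 1))"
    using energy_bounds(1)[of m] energy_bounds(1)[of "m - 1"] m L by (intro mult_left_mono add_mono) auto
  also have "\<dots> = x * energy m + x * energy (m - 1)" by (simp add: x_def algebra_simps)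
  finally have "energy m * (1 - x) \<le> (1 + x) * energy (m - 1) + (72 * K0 ^ 4)\<^sup>2 * h ^ 5"
    using energy_step[OF assms] by (simp add: algebra_simps)
  then have "energy m \<le> (1 + 4 * x) * energy (m - 1) + 2 * ((72 * K0 ^ 4)\<^sup>2 * h ^ 5)"
    by (intro discrete_gronwall[OF x]) (use energy_nonneg[of m] energy_nonneg[of "m - 1"] m h0 in auto)
  also have "(1 + 4 * x) * energy (m - 1) \<le> exp (4 * x) * energy (m - 1)"
    using energy_nonneg[of "m - 1"] m exp_ge_add_one_self[of "4 * x"] by (intro mult_right_mono) auto
  finally show ?thesis by (simp add: x_def mult_ac)
qed

lemma err_0: "l2 N (err 0) = 0"
proof -
  have "err 0 k = 0" if "\<bar>k\<bar> \<le> N" for k using v0[OF that] by (simp add: err_def tm_def)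
  then show ?thesis unfolding l2_def L2_set_def by (simp add: abs_le_iff)
qed

lemma energy_0: "1 \<le> M \<Longrightarrow> energy 0 \<le> 2 * D0 ^ 2 * h ^ 4"
proof -
  have "l2 N (err 1) \<le> D0 * h ^ 2" using v1 unfolding err_def[abs_def] tm_def by simp
  then have "(l2 N (err 1))\<^sup>2 \<le> (D0 * h ^ 2)\<^sup>2" by (intro power_mono l2_nonneg)
  then have "G 0 \<le> D0 ^ 2 * h ^ 4" unfolding G_def using err_0 by (simp add: power_mult_distrib flip: power_mult)
  then show ?thesis using energy_bounds(2)[of 0] by simp
qed

lemma energy_to_err:
  assumes "energy m \<le> exp (8 * lf_rate K0 * T) * (2 * D0 ^ 2 * h ^ 4 + 2 * ((72 * K0 ^ 4)\<^sup>2 * h ^ 5) * real m)" "m + 1 \<le> M"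
  shows "l2 N (err (m + 1)) \<le> lf_const K0 D0 T * h ^ 2"
proof -
  have h5: "h ^ 5 = h * h ^ 4" by (simp add: eval_nat_numeral)
  have "(l2 N (err (m + 1)))\<^sup>2 \<le> G m" by (simp add: G_def)
  also have "\<dots> \<le> 2 * energy m" using energy_bounds assms(2) by simp
  also have "\<dots> \<le> 2 * (exp (8 * lf_rate K0 * T) * (2 * D0 ^ 2 * h ^ 4 + 2 * ((72 * K0 ^ 4)\<^sup>2 * h ^ 5) * real m))"
    using assms(1) by simp
  also have "\<dots> = 2 * (exp (8 * lf_rate K0 * T) * (2 * D0 ^ 2 + 2 * (72 * K0 ^ 4)\<^sup>2 * tm m)) * h ^ 4"
    unfolding tm_def h5 by (simp add: algebra_simps)
  also have "\<dots> \<le> 2 * (exp (8 * lf_rate K0 * T) * (2 * D0 ^ 2 + 2 * (72 * K0 ^ 4)\<^sup>2 * T)) * h ^ 4"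
    by (intro mult_right_mono mult_left_mono add_left_mono) (use tm[of m] assms(2) in auto)
  also have "\<dots> = (lf_const K0 D0 T * h ^ 2)\<^sup>2"
    unfolding lf_const_def power_mult_distrib using K0 D0 T0 by (simp flip: power_mult)
  finally show ?thesis
    by (rule power2_le_imp_le) (use lf_const_nonneg in auto)
qed

lemma small_err:
  assumes "l2 N (err m) \<le> lf_const K0 D0 T * h ^ 2"
  shows "2 * real_of_int N ^ 2 * l2 N (err m) \<le> 1"
proof -
  have "2 * real_of_int N ^ 2 * l2 N (err m) \<le> 2 * real_of_int N ^ 2 * (lf_const K0 D0 T * h ^ 2)"
    by (intro mult_left_mono assms) auto
  \<comment> \<open>The zeroth power of N lets \<open>cfl'\<close> apply to the bare step as
    well.\<close>
  also have "\<dots> = 2 * lf_const K0 D0 T * ((real_of_int N ^ 2 * h) * (real_of_int N ^ 0 * h))"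
    by (simp add: power2_eq_square)
  also have "\<dots> \<le> 2 * lf_const K0 D0 T * (C1 * 1)"
    by (intro mult_left_mono mult_mono cfl' order_trans[OF cfl' lf_step_bounds(5)]) (use lf_const_nonneg h0 lf_step_bounds in auto)
  also have "\<dots> \<le> 1" using lf_step_bounds(4) by simp
  finally show ?thesis .
qed

text \<open>The bound at \<open>m\<close> makes the error at level m + 1 of order h^2, hence small
  enough for the quadratic term of the next step. The exponent contains the current time, so each
  step contributes just one factor exp (8 \<open>lf_rate\<close> h).\<close>

lemma energy_all:
  "m + 1 \<le> M \<Longrightarrow> energy m \<le> exp (8 * lf_rate K0 * tm m) * (2 * D0 ^ 2 * h ^ 4 + 2 * ((72 * K0 ^ 4)\<^sup>2 * h ^ 5) * real m)"
proof (induction m)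
  case 0
  then show ?case using energy_0 by (simp add: tm_def)
next
  case (Suc m)
  let ?a = "8 * lf_rate K0" and ?d = "2 * ((72 * K0 ^ 4)\<^sup>2 * h ^ 5)"
  let ?s = "2 * D0 ^ 2 * h ^ 4 + ?d * real m"
  have IH: "energy m \<le> exp (?a * tm m) * ?s" using Suc by simp
  have s0: "0 \<le> ?s" using h0 by simp
  have a0: "0 \<le> ?a" using lf_rate_pos by simp
  have "exp (?a * tm m) * ?s \<le> exp (?a * T) * ?s"
    using a0 tm[of m] Suc.prems s0 by (intro mult_right_mono) (auto intro: mult_left_mono)
  then have "energy m \<le> exp (?a * T) * ?s" using IH by simp
  then have "l2 N (err (m + 1)) \<le> lf_const K0 D0 T * h ^ 2"
    by (rule energy_to_err) (use Suc.prems in simp)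
  then have "2 * real_of_int N ^ 2 * l2 N (err (Suc m)) \<le> 1" by (intro small_err) simp
  then have "energy (Suc m) \<le> exp (?a * h) * energy (Suc m - 1) + ?d"
    by (intro energy_growth) (use Suc.prems in auto)
  also have "\<dots> \<le> exp (?a * h) * (exp (?a * tm m) * ?s) + exp (?a * tm (Suc m)) * ?d"
  proof (intro add_mono mult_left_mono)
    have "1 * ?d \<le> exp (?a * tm (Suc m)) * ?d"
      using a0 tm[of "Suc m"] Suc.prems h0 by (intro mult_right_mono) auto
    then show "?d \<le> exp (?a * tm (Suc m)) * ?d" by simp
  qed (simp_all only: IH exp_ge_zero diff_Suc_1)
  also have "exp (?a * h) * (exp (?a * tm m) * ?s) = exp (?a * tm (Suc m)) * ?s"
  proof -
    have "?a * tm (Suc m) = ?a * h + ?a * tm m" by (simp add: tm_def algebra_simps)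
    then show ?thesis by (simp only: exp_add mult.assoc)
  qed
  finally show ?case unfolding distrib_left[symmetric] by (simp add: distrib_left add.assoc)
qed

theorem leapfrog_error:
  assumes "m \<le> M"
  shows "l2 N (\<lambda>k. c (tm m) k - v m k) \<le> lf_const K0 D0 T * h ^ 2"
proof (cases m)
  case 0
  then show ?thesis using err_0 lf_const_nonneg unfolding err_def[abs_def] by simp
next
  case (Suc p)
  have p: "p + 1 \<le> M" using assms Suc by simp
  have "exp (8 * lf_rate K0 * tm p) * (2 * D0 ^ 2 * h ^ 4 + 2 * ((72 * K0 ^ 4)\<^sup>2 * h ^ 5) * real p)
    \<le> exp (8 * lf_rate K0 * T) * (2 * D0 ^ 2 * h ^ 4 + 2 * ((72 * K0 ^ 4)\<^sup>2 * h ^ 5) * real p)"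
    using lf_rate_pos tm[of p] p h0 by (intro mult_right_mono) (auto intro: mult_left_mono)
  then have "l2 N (err (p + 1)) \<le> lf_const K0 D0 T * h ^ 2"
    using energy_all[OF p] by (intro energy_to_err p) linarith
  then show ?thesis using Suc unfolding err_def[abs_def] by simp
qed

end

section \<open>Fourier series\<close>

abbreviation circ :: "real measure" where "circ \<equiv> lebesgue_on {-pi..pi}"

definition mode :: "int \<Rightarrow> real \<Rightarrow> complex" where
  "mode k x = exp (\<i> * of_int k * of_real x)"

lemma mode_cis: "mode k x = cis (of_int k * x)"
  by (simp add: mode_def cis_conv_exp mult.assoc)

lemma mode_add: "mode j x * mode k x = mode (j + k) x"
  by (simp add: mode_cis cis_mult algebra_simps)

lemma norm_mode [simp]: "cmod (mode k x) = 1"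
  by (simp add: mode_cis)

lemma cnj_mode: "cnj (mode k x) = mode (- k) x"
  by (simp add: mode_cis cis_cnj)

lemma mode_0 [simp]: "mode 0 x = 1"
  by (simp add: mode_cis)

lemma continuous_mode: "continuous_on A (mode k)"
  unfolding mode_cis[abs_def] cis_conv_exp by (intro continuous_intros)

lemma finite_circ: "finite_measure circ"
  by (rule finite_measure_lebesgue_on) simp

lemma circ_integrable_continuous:
  fixes f :: "real \<Rightarrow> complex"
  assumes "continuous_on UNIV f"
  shows "integrable circ f"
  by (rule continuous_imp_integrable_real) (rule continuous_on_subset[OF assms subset_UNIV])

lemma circ_measurable_continuous:
  fixes f :: "real \<Rightarrow> 'a::{second_countable_topology, t2_space}"
  assumes "continuous_on {-pi..pi} f"
  shows "f \<in> borel_measurable circ"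
  by (rule continuous_imp_measurable_on_sets_lebesgue[OF assms]) simp

lemma mode_measurable [measurable]: "mode k \<in> borel_measurable circ"
  by (rule circ_measurable_continuous[OF continuous_mode])

lemma integrable_mode_mult:
  assumes "integrable circ f"
  shows "integrable circ (\<lambda>x. f x * mode k x)"
  by (rule Bochner_Integration.integrable_bound[OF assms])
     (use assms in \<open>auto intro!: borel_measurable_times simp: norm_mult\<close>)

lemma fourier_coeff_mode: "fourier_coeff f k = 1 / (2 * of_real pi) * (LINT x|circ. f x * mode (- k) x)"
  unfolding fourier_coeff_def mode_def by (simp add: mult.commute)

text \<open>An inductive description gives closure under products without any bookkeeping of
  degrees.\<close>

inductive trig_poly :: "(real \<Rightarrow> complex) \<Rightarrow> bool" where
  mode: "trig_poly (mode k)"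
| add: "trig_poly f \<Longrightarrow> trig_poly g \<Longrightarrow> trig_poly (\<lambda>x. f x + g x)"
| scale: "trig_poly f \<Longrightarrow> trig_poly (\<lambda>x. c * f x)"

lemma trig_poly_mode_mult: "trig_poly f \<Longrightarrow> trig_poly (\<lambda>x. mode k x * f x)"
proof (induction rule: trig_poly.induct)
  case (mode j)
  have "(\<lambda>x. mode k x * mode j x) = mode (k + j)" by (rule ext) (rule mode_add)
  then show ?case using trig_poly.mode[of "k + j"] by simp
next
  case (add f g)
  then show ?case using trig_poly.add by (simp add: distrib_left)
next
  case (scale f c)
  then show ?case using trig_poly.scale[OF scale.IH, of c] by (simp add: mult.left_commute)
qed

lemma trig_poly_mult: "trig_poly f \<Longrightarrow> trig_poly g \<Longrightarrow> trig_poly (\<lambda>x. f x * g x)"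
proof (induction rule: trig_poly.induct)
  case (mode k)
  then show ?case by (rule trig_poly_mode_mult)
next
  case (add f h)
  then show ?case using trig_poly.add[of "\<lambda>x. f x * g x" "\<lambda>x. h x * g x"] by (simp add: distrib_right)
next
  case (scale f c)
  then show ?case using trig_poly.scale[of "\<lambda>x. f x * g x" c] by (simp add: mult.assoc)
qed

lemma trig_poly_const: "trig_poly (\<lambda>x. c)"
  using trig_poly.scale[OF trig_poly.mode[of 0], of c] by simp

text \<open>A real-linear functional of cis x is a combination of cos x and sin x, hence of the
  modes 1 and -1; the other cases follow from closure under sums and products.\<close>

lemma trig_poly_real_polynomial:
  "real_polynomial_function p \<Longrightarrow> trig_poly (\<lambda>x. of_real (p (cis x)))"
proof (induction rule: real_polynomial_function.induct)
  case (linear f)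
  then interpret bounded_linear f .
  have cis: "cis x = cos x *\<^sub>R 1 + sin x *\<^sub>R \<i>" for x by (simp add: complex_eq_iff)
  have "of_real (f (cis x)) = (of_real (f 1) / 2 + of_real (f \<i>) / (2 * \<i>)) * mode 1 x
      + (of_real (f 1) / 2 - of_real (f \<i>) / (2 * \<i>)) * mode (- 1) x" for x
    unfolding cis add scaleR by (simp add: mode_cis complex_eq_iff field_simps)
  then show ?case
    using trig_poly.add[OF trig_poly.scale[OF trig_poly.mode[of 1]] trig_poly.scale[OF trig_poly.mode[of "-1"]]] by simp
next
  case (const c)
  then show ?case by (rule trig_poly_const)
next
  case (add f g)
  then show ?case using trig_poly.add by simp
next
  case (mult f g)
  then show ?case using trig_poly_mult by simp
qed

lemma integral_trig_poly_zero:
  assumes f: "integrable circ f" "\<And>k. fourier_coeff f k = 0"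
  shows "trig_poly p \<Longrightarrow> integrable circ (\<lambda>x. f x * p x) \<and> (LINT x|circ. f x * p x) = 0"
proof (induction rule: trig_poly.induct)
  case (mode k)
  have "(LINT x|circ. f x * mode k x) = 0"
    using f(2)[of "- k"] by (simp add: fourier_coeff_mode)
  then show ?case using integrable_mode_mult[OF f(1)] by simp
next
  case (add p q)
  then show ?case by (simp add: distrib_left)
next
  case (scale p c)
  then show ?case by (simp add: mult.left_commute)
qed

text \<open>Stone-Weierstrass on the unit circle: polynomials in the real and imaginary parts
  restrict to trigonometric polynomials, whose integrals against \<open>f\<close> vanish.\<close>

lemma integral_circle_zero:
  fixes F :: "complex \<Rightarrow> complex"
  assumes f: "integrable circ f" "\<And>k. fourier_coeff f k = 0"
    and F: "continuous_on (sphere 0 1) F"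
  shows "(LINT x|circ. f x * F (cis x)) = 0"
proof -
  have cF: "continuous_on {-pi..pi} (\<lambda>x. F (cis x))"
    by (rule continuous_on_compose2[OF F]) (auto simp: cis_conv_exp intro!: continuous_intros)
  have mF: "(\<lambda>x. F (cis x)) \<in> borel_measurable circ" by (rule circ_measurable_continuous[OF cF])
  have "cmod (LINT x|circ. f x * F (cis x)) \<le> e * (LINT x|circ. cmod (f x))" if e: "e > 0" for e
  proof -
    obtain g where g: "polynomial_function g" "\<And>z. z \<in> sphere 0 1 \<Longrightarrow> cmod (F z - g z) < e"
      using Stone_Weierstrass_polynomial_function[OF compact_sphere F e] by blast
    have "real_polynomial_function (Re \<circ> g)" "real_polynomial_function (Im \<circ> g)"
      using g(1) bounded_linear_Re bounded_linear_Im unfolding polynomial_function_def by blast+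
    then have "trig_poly (\<lambda>x. of_real ((Re \<circ> g) (cis x)) + \<i> * of_real ((Im \<circ> g) (cis x)))"
      by (intro trig_poly.add trig_poly.scale trig_poly_real_polynomial)
    then have "trig_poly (\<lambda>x. g (cis x))"
      by (simp add: complex_eq[symmetric])
    from integral_trig_poly_zero[OF f this]
    have gi: "integrable circ (\<lambda>x. f x * g (cis x))" and g0: "(LINT x|circ. f x * g (cis x)) = 0" by auto
    obtain B where B: "\<forall>x\<in>{-pi..pi}. cmod (F (cis x)) \<le> B"
      using compact_imp_bounded[OF compact_continuous_image[OF cF compact_Icc]] by (auto simp: bounded_iff)
    have Fi: "integrable circ (\<lambda>x. f x * F (cis x))"
    proof (rule Bochner_Integration.integrable_bound[of _ "\<lambda>x. B * cmod (f x)"])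
      show "AE x in circ. cmod (f x * F (cis x)) \<le> norm (B * cmod (f x))"
      proof (rule AE_I2)
        fix x assume "x \<in> space circ"
        then have "cmod (F (cis x)) \<le> B" using B by simp
        then have "cmod (f x) * cmod (F (cis x)) \<le> cmod (f x) * B" by (rule mult_left_mono) simp
        then have "cmod (f x * F (cis x)) \<le> B * cmod (f x)" by (simp add: norm_mult mult.commute)
        then show "cmod (f x * F (cis x)) \<le> norm (B * cmod (f x))" unfolding real_norm_def by linarith
      qed
    qed (use f mF in auto)
    have "cmod (LINT x|circ. f x * F (cis x)) = cmod (LINT x|circ. f x * F (cis x) - f x * g (cis x))"
      using g0 by (simp add: Bochner_Integration.integral_diff[OF Fi gi])
    also have "\<dots> \<le> (LINT x|circ. cmod (f x * F (cis x) - f x * g (cis x)))"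
      by (rule integral_norm_bound)
    also have "\<dots> \<le> (LINT x|circ. e * cmod (f x))"
    proof (rule integral_mono)
      show "integrable circ (\<lambda>x. cmod (f x * F (cis x) - f x * g (cis x)))" using Fi gi by auto
      show "integrable circ (\<lambda>x. e * cmod (f x))" using f by auto
      fix x
      have "cmod (f x) * cmod (F (cis x) - g (cis x)) \<le> cmod (f x) * e"
        using g(2)[of "cis x"] by (intro mult_left_mono) auto
      then show "cmod (f x * F (cis x) - f x * g (cis x)) \<le> e * cmod (f x)"
        by (simp add: norm_mult[symmetric] right_diff_distrib mult.commute)
    qed
    finally show ?thesis by simp
  qed
  then have "cmod (LINT x|circ. f x * F (cis x)) \<le> 0"
  proof -
    define A where "A = (LINT x|circ. cmod (f x))"
    assume *: "\<And>e. e > 0 \<Longrightarrow> cmod (LINT x|circ. f x * F (cis x)) \<le> e * (LINT x|circ. cmod (f x))"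
    have A: "0 \<le> A" unfolding A_def by (rule Bochner_Integration.integral_nonneg) simp
    have "cmod (LINT x|circ. f x * F (cis x)) \<le> 0 + e" if "e > 0" for e
    proof -
      have "cmod (LINT x|circ. f x * F (cis x)) \<le> e / (A + 1) * A"
        unfolding A_def[symmetric] using that A *[of "e / (A + 1)", folded A_def] by simp
      also have "\<dots> \<le> e" using that A by (simp add: field_simps)
      finally show ?thesis by simp
    qed
    then show ?thesis by (rule field_le_epsilon)
  qed
  then show ?thesis by simp
qed

text \<open>Although \<open>Arg\<close> jumps at -1, its absolute value is continuous on the circle;
  the cut-off factor below is built from this form.\<close>

lemma abs_Arg_arccos: "cmod z = 1 \<Longrightarrow> \<bar>Arg z\<bar> = arccos (Re z)"
proof -
  assume z: "cmod z = 1"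
  then have "z \<noteq> 0" by auto
  then have "Re z = cos \<bar>Arg z\<bar>" using z Arg_eq[of z] by (metis Re_exp cis.simps(1) cis_conv_exp cos_abs_real mult_1 of_real_1)
  then show ?thesis using Arg_bounded[of z] by (simp add: arccos_cos_eq_abs abs_le_iff)
qed

text \<open>
  The factor vanishes at \<open>z = -1\<close>, where \<open>Arg\<close> jumps, and for large \<open>n\<close> equals 1 at any other point.
\<close>

lemma continuous_on_circle_lift:
  fixes g :: "real \<Rightarrow> complex"
  assumes g: "continuous_on UNIV g" "\<And>x. cmod (g x) \<le> 1" and n: "0 \<le> n"
  shows "continuous_on (sphere 0 1) (\<lambda>z. of_real (min 1 (n * (pi - arccos (Re z)))) * g (Arg z))"
proof -
  have c1: "continuous_on (sphere 0 1) (\<lambda>z. min 1 (n * (pi - arccos (Re z))))"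
  proof (intro continuous_intros ballI)
    fix z :: complex assume "z \<in> sphere 0 1"
    then show "- 1 \<le> Re z \<and> Re z \<le> 1" using abs_Re_le_cmod[of z] by (simp add: abs_le_iff)
  qed
  have "continuous (at z within sphere 0 1) (\<lambda>z. of_real (min 1 (n * (pi - arccos (Re z)))) * g (Arg z))"
    if z: "z \<in> sphere 0 1" for z
  proof (cases "z \<in> \<real>\<^sub>\<le>\<^sub>0")
    case False
    have 1: "continuous (at z within sphere 0 1) (\<lambda>z. of_real (min 1 (n * (pi - arccos (Re z)))) :: complex)"
      using c1 z by (intro continuous_of_real) (auto simp: continuous_on_eq_continuous_within)
    have 2: "continuous (at z) (\<lambda>z. g (Arg z))"
      by (rule isCont_o2[OF continuous_at_Arg[OF False]]) (use g(1) in \<open>auto simp: continuous_on_eq_continuous_at\<close>)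
    show ?thesis by (rule continuous_mult[OF 1 continuous_at_imp_continuous_at_within[OF 2]])
  next
    case True
    then have z1: "z = -1" using z by (auto simp: nonpos_Reals_def)
    have "((\<lambda>z. min 1 (n * (pi - arccos (Re z)))) \<longlongrightarrow> min 1 (n * (pi - arccos (Re z)))) (at z within sphere 0 1)"
      using c1 z by (simp add: continuous_on_def)
    then have lim: "((\<lambda>z. min 1 (n * (pi - arccos (Re z)))) \<longlongrightarrow> 0) (at z within sphere 0 1)"
      using z1 by simp
    have "((\<lambda>z. of_real (min 1 (n * (pi - arccos (Re z)))) * g (Arg z)) \<longlongrightarrow> 0) (at z within sphere 0 1)"
    proof (rule Lim_null_comparison[OF _ tendsto_rabs_zero[OF lim]])
      show "\<forall>\<^sub>F z in at z within sphere 0 1. cmod (of_real (min 1 (n * (pi - arccos (Re z)))) * g (Arg z)) \<le> \<bar>min 1 (n * (pi - arccos (Re z)))\<bar>"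
        by (rule always_eventually) (use g(2) in \<open>auto simp: norm_mult intro: mult_left_le simp del: min_def\<close>)
    qed
    then show ?thesis using z1 by (simp add: continuous_within)
  qed
  then show ?thesis by (simp add: continuous_on_eq_continuous_within)
qed

text \<open>Orthogonality to continuous functions on the circle passes to a bounded multiplier of
  \<open>f\<close> by dominated convergence. As the multiplier is bounded, integrability of
  \<open>f\<close> is enough.\<close>

theorem fourier_uniqueness:
  assumes f: "integrable circ f" and zero: "\<And>k. fourier_coeff f k = 0"
  shows "AE x in circ. f x = 0"
proof -
  \<comment> \<open>a bounded function whose pairing with \<open>f\<close> is positive; it is an a.e. limit of functions on the circle\<close>
  define h where "h x = cnj (f x) / of_real (1 + cmod (f x))" for x
  have fm [measurable]: "f \<in> borel_measurable circ" using f by auto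
  have [measurable]: "(\<lambda>x. cnj (f x)) \<in> borel_measurable circ"
    by (rule measurable_compose[OF fm borel_measurable_continuous_onI]) (intro continuous_intros)
  have [measurable]: "(\<lambda>x. complex_of_real (1 + cmod (f x))) \<in> borel_measurable circ"
    by (rule measurable_compose[OF fm borel_measurable_continuous_onI]) (intro continuous_intros)
  have hm: "h \<in> borel_measurable circ" unfolding h_def by measurable
  have h1: "cmod (h x) \<le> 1" for x
  proof -
    have "cmod (h x) = cmod (f x) / (1 + cmod (f x))"
      unfolding h_def norm_divide norm_of_real complex_mod_cnj by simp
    then show ?thesis by (simp add: divide_le_eq add_pos_nonneg)
  qed
  have "h measurable_on {-pi..pi}"
    using hm measurable_on_iff_borel_measurable[of "{-pi..pi}" h] by simp
  then obtain Z g where Z: "negligible Z" and g: "\<And>n. continuous_on UNIV (g n)"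
    and lim: "\<And>x. x \<notin> Z \<Longrightarrow> (\<lambda>n. g n x) \<longlonglongrightarrow> (if x \<in> {-pi..pi} then h x else 0)"
    unfolding measurable_on_def by blast
  \<comment> \<open>The continuous approximants come without a bound. Clipping supplies one for
    dominated convergence and leaves the limit alone, since \<open>h\<close> has modulus at most
    1.\<close>
  define clip where "clip z = z / of_real (max 1 (cmod z))" for z :: complex
  have clip1: "cmod (clip z) \<le> 1" for z
    unfolding clip_def norm_divide by (simp add: divide_le_eq)
  have clip_cont: "continuous_on UNIV clip"
    unfolding clip_def by (intro continuous_intros) auto
  define F where "F n z = of_real (min 1 (real n * (pi - arccos (Re z)))) * clip (g n (Arg z))" for n z
  have F_cont: "continuous_on (sphere 0 1) (F n)" for n
    unfolding F_def
    by (rule continuous_on_circle_lift) (use clip1 in \<open>auto intro: continuous_on_compose2[OF clip_cont g]\<close>)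
  have F1: "cmod (F n z) \<le> 1" if "cmod z = 1" for n z
  proof -
    have "arccos (Re z) \<le> pi" using abs_Re_le_cmod[of z] that by (intro arccos_ubound) (auto simp: abs_le_iff)
    then have "\<bar>min 1 (real n * (pi - arccos (Re z)))\<bar> \<le> 1" by (auto simp: min_def)
    then have "\<bar>min 1 (real n * (pi - arccos (Re z)))\<bar> * cmod (clip (g n (Arg z))) \<le> 1 * 1"
      by (intro mult_mono clip1) auto
    then show ?thesis by (simp add: F_def norm_mult)
  qed
  have F_lim: "(\<lambda>n. F n (cis x)) \<longlonglongrightarrow> h x" if x: "x \<in> {-pi<..<pi}" "x \<notin> Z" for x
  proof -
    have Arg: "Arg (cis x) = x" using x by (intro Arg_cis) auto
    have "arccos (cos x) = \<bar>x\<bar>" using abs_Arg_arccos[of "cis x"] Arg by simp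
    then have F: "F n (cis x) = of_real (min 1 (real n * (pi - \<bar>x\<bar>))) * clip (g n x)" for n
      by (simp add: F_def Arg)
    have "(\<lambda>n. clip (g n x)) \<longlonglongrightarrow> clip (h x)"
      by (rule continuous_on_tendsto_compose[OF clip_cont]) (use lim[OF x(2)] x(1) in auto)
    moreover have "clip (h x) = h x" using h1[of x] by (simp add: clip_def max_def)
    moreover have "(\<lambda>n. min 1 (real n * (pi - \<bar>x\<bar>))) \<longlonglongrightarrow> 1"
    proof (rule tendsto_eventually)
      have d: "0 < pi - \<bar>x\<bar>" using x by auto
      then obtain n0 where n0: "1 < real n0 * (pi - \<bar>x\<bar>)" using reals_Archimedean3 by blast
      have "1 \<le> real n * (pi - \<bar>x\<bar>)" if "n \<ge> n0" for n
      proof -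
        have "real n0 * (pi - \<bar>x\<bar>) \<le> real n * (pi - \<bar>x\<bar>)" using that d by (intro mult_right_mono) auto
        with n0 show ?thesis by linarith
      qed
      then show "\<forall>\<^sub>F n in sequentially. min 1 (real n * (pi - \<bar>x\<bar>)) = 1"
        by (auto simp: eventually_sequentially min_def intro!: exI[of _ n0])
    qed
    ultimately have "(\<lambda>n. of_real (min 1 (real n * (pi - \<bar>x\<bar>))) * clip (g n x)) \<longlonglongrightarrow> of_real 1 * h x"
      by (intro tendsto_mult tendsto_of_real) auto
    then show ?thesis unfolding F by simp
  qed
  have "(\<lambda>n. LINT x|circ. f x * F n (cis x)) \<longlonglongrightarrow> (LINT x|circ. f x * h x)"
  proof (rule integral_dominated_convergence[where w = "\<lambda>x. cmod (f x)"])
    show "(\<lambda>x. f x * h x) \<in> borel_measurable circ" using hm by measurable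
    show "(\<lambda>x. f x * F n (cis x)) \<in> borel_measurable circ" for n
    proof (rule borel_measurable_times[OF fm])
      have "continuous_on {-pi..pi} (\<lambda>x. F n (cis x))"
        by (rule continuous_on_compose2[OF F_cont]) (auto simp: cis_conv_exp intro!: continuous_intros)
      then show "(\<lambda>x. F n (cis x)) \<in> borel_measurable circ" by (rule circ_measurable_continuous)
    qed
    show "integrable circ (\<lambda>x. cmod (f x))" using f by auto
    \<comment> \<open>Both end points are mapped to -1, where the cut-off factor vanishes; they are
      discarded as a null set.\<close>
    have "Z \<union> {-pi, pi} \<in> null_sets lebesgue"
      using Z by (simp add: negligible_iff_null_sets[symmetric])
    then have "AE x in lebesgue. x \<notin> Z \<union> {-pi, pi}" by (rule AE_not_in)
    then have "AE x in circ. x \<notin> Z \<union> {-pi, pi}"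
      by (subst AE_restrict_space_iff) (auto elim: eventually_mono)
    then show "AE x in circ. (\<lambda>n. f x * F n (cis x)) \<longlonglongrightarrow> f x * h x"
    proof (rule AE_mp[OF _ AE_I2], intro impI)
      fix x assume "x \<in> space circ" "x \<notin> Z \<union> {-pi, pi}"
      then have "x \<in> {-pi<..<pi}" "x \<notin> Z" by (auto simp: less_le)
      then show "(\<lambda>n. f x * F n (cis x)) \<longlonglongrightarrow> f x * h x" by (intro tendsto_mult F_lim tendsto_const)
    qed
    show "AE x in circ. cmod (f x * F n (cis x)) \<le> cmod (f x)" for n
      by (rule AE_I2) (use F1 in \<open>auto simp: norm_mult intro!: mult_left_le\<close>)
  qed
  then have fh0: "(LINT x|circ. f x * h x) = 0"
    using integral_circle_zero[OF f zero F_cont] by (simp add: LIMSEQ_const_iff)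
  define q where "q x = (cmod (f x))\<^sup>2 / (1 + cmod (f x))" for x
  have fh: "f x * h x = of_real (q x)" for x
    unfolding h_def q_def by (simp add: complex_norm_square[symmetric] flip: of_real_power)
  have qi: "integrable circ q"
  proof (rule Bochner_Integration.integrable_bound[of _ "\<lambda>x. cmod (f x)"])
    show "q \<in> borel_measurable circ" unfolding q_def by measurable
    show "AE x in circ. norm (q x) \<le> norm (cmod (f x))"
      by (rule AE_I2) (auto simp: q_def power2_eq_square divide_le_eq add_pos_nonneg algebra_simps)
  qed (use f in auto)
  have "of_real (LINT x|circ. q x) = (LINT x|circ. f x * h x)"
    unfolding fh by (rule integral_of_real[symmetric]) (rule qi)
  then have "(LINT x|circ. q x) = 0" using fh0 by simp
  moreover have "AE x in circ. 0 \<le> q x" by (simp add: q_def)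
  ultimately have AEq: "AE x in circ. q x = 0" using integral_nonneg_eq_0_iff_AE[OF qi] by blast
  have fq: "f x = 0" if "q x = 0" for x
  proof -
    have "1 + cmod (f x) \<noteq> 0" using norm_ge_zero[of "f x"] by linarith
    then show ?thesis using that by (simp add: q_def)
  qed
  from AEq show ?thesis
  proof eventually_elim
    case (elim x)
    then show ?case by (rule fq)
  qed
qed

section \<open>Square-integrable functions and trigonometric sums\<close>

definition tsum :: "int \<Rightarrow> (int \<Rightarrow> complex) \<Rightarrow> real \<Rightarrow> complex" where
  "tsum K c x = (\<Sum>k=-K..K. c k * mode k x)"

lemma periodic_mode: "periodic (mode k)"
proof -
  have "cis (of_int k * (x + 2 * pi)) = cis (of_int k * x)" for x
  proof -
    have "cis (of_int k * (x + 2 * pi)) = cis (of_int k * x) * cis (2 * pi * of_int k)"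
      by (simp add: cis_mult algebra_simps)
    also have "cis (2 * pi * of_int k) = 1" by (rule cis_multiple_2pi) simp
    finally show ?thesis by simp
  qed
  then show ?thesis by (simp add: periodic_def mode_cis)
qed

lemma L2_measurable: "f \<in> L2 \<Longrightarrow> f \<in> borel_measurable circ"
  and L2_square_integrable: "f \<in> L2 \<Longrightarrow> integrable circ (\<lambda>x. (cmod (f x))\<^sup>2)"
  by (auto simp: L2_def)

lemma integrable_circ_const: "integrable circ (\<lambda>x. c :: 'a::{banach, second_countable_topology})"
  by (rule finite_measure.integrable_const[OF finite_circ])

lemma measure_circ: "measure circ {-pi..pi} = 2 * pi"
  by (subst measure_restrict_space) auto

lemma integral_circ_const: "(LINT x|circ. c :: real) = 2 * pi * c"
  by (simp add: measure_circ)

lemma L2_mult_integrable: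
  assumes "f \<in> L2" "g \<in> L2"
  shows "integrable circ (\<lambda>x. f x * g x)"
proof (rule Bochner_Integration.integrable_bound[of _ "\<lambda>x. (cmod (f x))\<^sup>2 + (cmod (g x))\<^sup>2"])
  show "integrable circ (\<lambda>x. (cmod (f x))\<^sup>2 + (cmod (g x))\<^sup>2)"
    using assms by (intro Bochner_Integration.integrable_add L2_square_integrable)
  show "(\<lambda>x. f x * g x) \<in> borel_measurable circ"
    using assms by (intro borel_measurable_times L2_measurable)
  show "AE x in circ. cmod (f x * g x) \<le> norm ((cmod (f x))\<^sup>2 + (cmod (g x))\<^sup>2)"
  proof (rule AE_I2)
    fix x
    have "2 * cmod (f x) * cmod (g x) \<le> (cmod (f x))\<^sup>2 + (cmod (g x))\<^sup>2" by (rule sum_squares_bound)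
    moreover have "cmod (f x) * cmod (g x) \<le> 2 * cmod (f x) * cmod (g x)" by simp
    ultimately have "cmod (f x) * cmod (g x) \<le> (cmod (f x))\<^sup>2 + (cmod (g x))\<^sup>2" by (rule order_trans[rotated])
    then show "cmod (f x * g x) \<le> norm ((cmod (f x))\<^sup>2 + (cmod (g x))\<^sup>2)"
      by (simp add: norm_mult)
  qed
qed

lemma L2_continuous:
  assumes "continuous_on UNIV f" "periodic f"
  shows "f \<in> L2"
proof -
  have "f \<in> borel_measurable circ"
    by (rule circ_measurable_continuous) (rule continuous_on_subset[OF assms(1) subset_UNIV])
  moreover have "integrable circ (\<lambda>x. (cmod (f x))\<^sup>2)"
    by (rule continuous_imp_integrable_real)
       (intro continuous_intros continuous_on_subset[OF assms(1) subset_UNIV])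
  ultimately show ?thesis using assms(2) by (simp add: L2_def)
qed

lemma L2_mode: "mode k \<in> L2"
  by (rule L2_continuous[OF continuous_mode periodic_mode])

lemma L2_integrable: "f \<in> L2 \<Longrightarrow> integrable circ f"
  using L2_mult_integrable[OF _ L2_mode[of 0], of f] by simp

lemma L2_scale: "f \<in> L2 \<Longrightarrow> (\<lambda>x. c * f x) \<in> L2"
  by (auto simp: L2_def periodic_def norm_mult power_mult_distrib)

lemma L2_add:
  assumes "f \<in> L2" "g \<in> L2"
  shows "(\<lambda>x. f x + g x) \<in> L2"
proof -
  have "integrable circ (\<lambda>x. (cmod (f x + g x))\<^sup>2)"
  proof (rule Bochner_Integration.integrable_bound[of _ "\<lambda>x. 2 * ((cmod (f x))\<^sup>2 + (cmod (g x))\<^sup>2)"])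
    show "integrable circ (\<lambda>x. 2 * ((cmod (f x))\<^sup>2 + (cmod (g x))\<^sup>2))"
      using assms by (intro integrable_mult_right Bochner_Integration.integrable_add L2_square_integrable)
    show "(\<lambda>x. (cmod (f x + g x))\<^sup>2) \<in> borel_measurable circ"
      using L2_measurable[OF assms(1)] L2_measurable[OF assms(2)] by measurable
    show "AE x in circ. norm ((cmod (f x + g x))\<^sup>2) \<le> norm (2 * ((cmod (f x))\<^sup>2 + (cmod (g x))\<^sup>2))"
    proof (rule AE_I2)
      fix x
      have "(cmod (f x + g x))\<^sup>2 \<le> (cmod (f x) + cmod (g x))\<^sup>2"
        by (intro power_mono norm_triangle_ineq) simp
      also have "\<dots> \<le> 2 * ((cmod (f x))\<^sup>2 + (cmod (g x))\<^sup>2)"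
        using sum_squares_bound[of "cmod (f x)" "cmod (g x)"] by (simp add: power2_sum)
      finally show "norm ((cmod (f x + g x))\<^sup>2) \<le> norm (2 * ((cmod (f x))\<^sup>2 + (cmod (g x))\<^sup>2))" by simp
    qed
  qed
  then show ?thesis using assms by (auto simp: L2_def periodic_def)
qed

lemma L2_diff: "f \<in> L2 \<Longrightarrow> g \<in> L2 \<Longrightarrow> (\<lambda>x. f x - g x) \<in> L2"
  using L2_add[of f "\<lambda>x. (-1) * g x"] L2_scale[of g "-1"] by simp

lemma L2_zero: "(\<lambda>x. 0) \<in> L2"
  by (rule L2_continuous) (auto simp: periodic_def)

lemma L2_sum: "(\<And>i. i \<in> I \<Longrightarrow> f i \<in> L2) \<Longrightarrow> (\<lambda>x. \<Sum>i\<in>I. f i x) \<in> L2"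
  by (induction I rule: infinite_finite_induct) (auto intro!: L2_zero L2_add)

lemma L2_tsum: "tsum K c \<in> L2"
  unfolding tsum_def[abs_def] by (intro L2_sum L2_scale L2_mode)

lemma continuous_tsum: "continuous_on A (tsum K c)"
  unfolding tsum_def[abs_def] by (intro continuous_intros continuous_mode)

lemma fourier_coeff_add: "integrable circ f \<Longrightarrow> integrable circ g \<Longrightarrow>
    fourier_coeff (\<lambda>x. f x + g x) k = fourier_coeff f k + fourier_coeff g k"
  by (simp add: fourier_coeff_mode distrib_right Bochner_Integration.integral_add integrable_mode_mult distrib_left)

lemma fourier_coeff_diff: "integrable circ f \<Longrightarrow> integrable circ g \<Longrightarrow>
    fourier_coeff (\<lambda>x. f x - g x) k = fourier_coeff f k - fourier_coeff g k"
  by (simp add: fourier_coeff_mode left_diff_distrib Bochner_Integration.integral_diff integrable_mode_mult right_diff_distrib)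

lemma fourier_coeff_scale: "fourier_coeff (\<lambda>x. c * f x) k = c * fourier_coeff f k"
  by (simp add: fourier_coeff_mode mult.assoc)

lemma fourier_coeff_cong_AE:
  assumes "f \<in> borel_measurable circ" "g \<in> borel_measurable circ" "AE x in circ. f x = g x"
  shows "fourier_coeff f k = fourier_coeff g k"
  unfolding fourier_coeff_mode
  by (intro arg_cong2[of _ _ _ _ "(*)"] refl integral_cong_AE borel_measurable_times assms mode_measurable)
     (use assms(3) in auto)

lemma integral_mode: "(LINT x|circ. mode k x) = (if k = 0 then 2 * of_real pi else 0)"
proof (cases "k = 0")
  case True
  have "(LINT x|circ. (1::complex)) = of_real (measure circ {-pi..pi})"
    by (simp add: scaleR_conv_of_real)
  then show ?thesis using True by (simp add: measure_circ)
next
  case False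
  have "((\<lambda>x. mode k x) has_integral (mode k pi / (\<i> * of_int k) - mode k (-pi) / (\<i> * of_int k))) {-pi..pi}"
  proof (rule fundamental_theorem_of_calculus)
    fix x :: real
    have "((\<lambda>x. exp (\<i> * of_int k * of_real x)) has_vector_derivative (\<i> * of_int k) * exp (\<i> * of_int k * of_real x)) (at x within {-pi..pi})"
      by (auto intro!: derivative_eq_intros has_vector_derivative_real_field simp: has_real_derivative_iff_has_vector_derivative)
    then have "((\<lambda>x. mode k x / (\<i> * of_int k)) has_vector_derivative ((\<i> * of_int k) * mode k x) / (\<i> * of_int k)) (at x within {-pi..pi})"
      unfolding mode_def by (rule has_vector_derivative_divide)
    then show "((\<lambda>x. mode k x / (\<i> * of_int k)) has_vector_derivative mode k x) (at x within {-pi..pi})"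
      using False by simp
  qed simp
  moreover have "mode k pi = mode k (-pi)"
    using periodic_mode[of k, unfolded periodic_def, rule_format, of "-pi"] by simp
  ultimately have "integral {-pi..pi} (mode k) = 0" by (simp add: integral_unique)
  then show ?thesis using False lebesgue_integral_eq_integral[OF circ_integrable_continuous[OF continuous_mode], of k] by simp
qed

lemma integral_mult_tsum:
  assumes "integrable circ f"
  shows "(LINT x|circ. f x * tsum K c x) = 2 * of_real pi * (\<Sum>k=-K..K. c k * fourier_coeff f (- k))"
proof -
  have "(LINT x|circ. f x * tsum K c x) = (LINT x|circ. (\<Sum>k=-K..K. c k * (f x * mode k x)))"
    unfolding tsum_def by (simp add: sum_distrib_left mult_ac)
  also have "\<dots> = (\<Sum>k=-K..K. c k * (LINT x|circ. f x * mode k x))"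
    using integrable_mode_mult[OF assms] by (subst Bochner_Integration.integral_sum) auto
  also have "\<dots> = 2 * of_real pi * (\<Sum>k=-K..K. c k * fourier_coeff f (- k))"
    by (simp add: fourier_coeff_mode sum_distrib_left mult_ac)
  finally show ?thesis .
qed

lemma fourier_coeff_mode_self: "fourier_coeff (mode j) k = (if j = k then 1 else 0)"
  by (simp add: fourier_coeff_mode mode_add integral_mode)

lemma fourier_coeff_sum:
  "(\<And>i. i \<in> I \<Longrightarrow> integrable circ (f i)) \<Longrightarrow> fourier_coeff (\<lambda>x. \<Sum>i\<in>I. f i x) k = (\<Sum>i\<in>I. fourier_coeff (f i) k)"
  by (induction I rule: infinite_finite_induct)
     (auto simp: fourier_coeff_add fourier_coeff_mode[of "\<lambda>x. 0"])

lemma fourier_coeff_tsum: "fourier_coeff (tsum K c) k = cutoff K c k"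
proof -
  have "fourier_coeff (tsum K c) k = (\<Sum>j=-K..K. c j * fourier_coeff (mode j) k)"
    unfolding tsum_def[abs_def]
    by (subst fourier_coeff_sum) (auto simp: fourier_coeff_scale intro!: L2_integrable L2_scale L2_mode)
  also have "\<dots> = (\<Sum>j\<in>{-K..K}. if j = k then c j else 0)"
    by (rule sum.cong) (auto simp: fourier_coeff_mode_self)
  also have "\<dots> = cutoff K c k"
    by (auto simp: cutoff_def)
  finally show ?thesis .
qed

lemma cnj_tsum: "cnj (tsum K c x) = tsum K (\<lambda>k. cnj (c (- k))) x"
proof -
  have "cnj (tsum K c x) = (\<Sum>k=-K..K. cnj (c k) * mode (- k) x)"
    by (simp add: tsum_def cnj_mode)
  also have "\<dots> = tsum K (\<lambda>k. cnj (c (- k))) x"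
    unfolding tsum_def by (rule sum.reindex_bij_witness[of _ uminus uminus]) auto
  finally show ?thesis .
qed

lemma l2_inner_tsum:
  assumes "integrable circ f"
  shows "l2_inner f (tsum K c) = 2 * of_real pi * (\<Sum>k=-K..K. fourier_coeff f k * cnj (c k))"
proof -
  have "l2_inner f (tsum K c) = 2 * of_real pi * (\<Sum>k=-K..K. cnj (c (- k)) * fourier_coeff f (- k))"
    unfolding l2_inner_def cnj_tsum by (rule integral_mult_tsum[OF assms])
  also have "(\<Sum>k=-K..K. cnj (c (- k)) * fourier_coeff f (- k)) = (\<Sum>k=-K..K. fourier_coeff f k * cnj (c k))"
    by (rule sum.reindex_bij_witness[of _ uminus uminus]) auto
  finally show ?thesis .
qed

lemma l2_inner_self: "f \<in> L2 \<Longrightarrow> l2_inner f f = of_real (LINT x|circ. (cmod (f x))\<^sup>2)"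
  unfolding l2_inner_def complex_norm_square[symmetric]
  by (subst integral_of_real[symmetric]) (auto intro: L2_square_integrable)

lemma l2_norm_power2: "f \<in> L2 \<Longrightarrow> (l2_norm f)\<^sup>2 = (LINT x|circ. (cmod (f x))\<^sup>2)"
  unfolding l2_norm_def l2_inner_self by (simp add: Bochner_Integration.integral_nonneg)

lemma l2_norm_tsum: "l2_norm (tsum N c) = sqrt (2 * pi) * l2 N c"
proof -
  have "l2_inner (tsum N c) (tsum N c) = 2 * of_real pi * (\<Sum>k=-N..N. cutoff N c k * cnj (c k))"
    by (simp add: l2_inner_tsum L2_integrable L2_tsum fourier_coeff_tsum)
  also have "(\<Sum>k=-N..N. cutoff N c k * cnj (c k)) = of_real ((l2 N c)\<^sup>2)"
    unfolding l2_power2 of_real_sum by (rule sum.cong) (auto simp: cutoff_def complex_norm_square simp del: of_real_power)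
  finally have "Re (l2_inner (tsum N c) (tsum N c)) = 2 * pi * (l2 N c)\<^sup>2" by simp
  then show ?thesis unfolding l2_norm_def by (simp add: real_sqrt_mult l2_nonneg)
qed

section \<open>Absolutely convergent Fourier series\<close>

lemma fourier_coeff_bound:
  assumes "f \<in> borel_measurable circ" "AE x in circ. cmod (f x) \<le> B"
  shows "cmod (fourier_coeff f k) \<le> B"
proof -
  have i: "integrable circ (\<lambda>x. f x * mode (- k) x)"
    by (rule Bochner_Integration.integrable_bound[OF integrable_circ_const[of B]])
       (use assms in \<open>auto simp: norm_mult intro!: borel_measurable_times elim!: eventually_mono\<close>)
  have "cmod (LINT x|circ. f x * mode (- k) x) \<le> (LINT x|circ. cmod (f x * mode (- k) x))"
    by (rule integral_norm_bound)
  also have "\<dots> \<le> (LINT x|circ. B)"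
  proof (rule integral_mono_AE[OF integrable_norm[OF i] integrable_circ_const])
    show "AE x in circ. cmod (f x * mode (- k) x) \<le> B" using assms(2) by (simp add: norm_mult)
  qed
  finally show ?thesis
    unfolding fourier_coeff_mode integral_circ_const
    by (simp add: norm_mult norm_divide divide_le_eq mult.commute)
qed

text \<open>Pairing k with -k turns symmetric partial sums into an ordinary series, as the M-test
  requires. Being a set, \<open>shell 0\<close> counts the mode 0 only once.\<close>

definition shell :: "nat \<Rightarrow> int set" where "shell i = {int i, - int i}"

lemma sum_shells:
  "(\<Sum>k=-int n..int n. f k) = (\<Sum>i<Suc n. \<Sum>k\<in>shell i. f k)" for f :: "int \<Rightarrow> 'a::comm_monoid_add"
proof (induction n)
  case (Suc n)
  have "{-int (Suc n)..int (Suc n)} = {-int n..int n} \<union> shell (Suc n)" by (auto simp: shell_def)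
  moreover have "{-int n..int n} \<inter> shell (Suc n) = {}" by (auto simp: shell_def)
  ultimately have "(\<Sum>k=-int (Suc n)..int (Suc n). f k) = (\<Sum>k=-int n..int n. f k) + (\<Sum>k\<in>shell (Suc n). f k)"
    by (simp add: sum.union_disjoint shell_def ac_simps)
  then show ?case using Suc by simp
qed (simp add: shell_def)

text \<open>The series converges uniformly to a continuous function with the same coefficients,
  which uniqueness identifies with \<open>f\<close>.\<close>

theorem fourier_series_AE:
  assumes f: "integrable circ f" and A: "\<And>n. (\<Sum>k=-int n..int n. cmod (fourier_coeff f k)) \<le> A"
  shows "AE x in circ. (\<lambda>n. tsum (int n) (fourier_coeff f) x) \<longlonglongrightarrow> f x"
proof -
  let ?c = "fourier_coeff f"
  define G where "G x = suminf (\<lambda>i. \<Sum>k\<in>shell i. ?c k * mode k x)" for x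
  have "summable (\<lambda>i. \<Sum>k\<in>shell i. cmod (?c k))"
  proof (rule summableI_nonneg_bounded)
    show "0 \<le> (\<Sum>k\<in>shell i. cmod (?c k))" for i by (simp add: sum_nonneg)
    show "(\<Sum>i<n. \<Sum>k\<in>shell i. cmod (?c k)) \<le> A" for n
    proof -
      have "(\<Sum>i<n. \<Sum>k\<in>shell i. cmod (?c k)) \<le> (\<Sum>i<Suc n. \<Sum>k\<in>shell i. cmod (?c k))"
        by (intro sum_mono2) (auto simp: sum_nonneg)
      then show ?thesis using A[of n] by (simp only: sum_shells)
    qed
  qed
  then have "uniform_limit UNIV (\<lambda>n x. \<Sum>i<n. \<Sum>k\<in>shell i. ?c k * mode k x) G sequentially"
    unfolding G_def[abs_def]
    by (rule Weierstrass_m_test[rotated]) (auto intro!: order_trans[OF norm_sum] sum_mono simp: norm_mult)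
  then have "uniform_limit UNIV (\<lambda>n x. \<Sum>i<Suc n. \<Sum>k\<in>shell i. ?c k * mode k x) G sequentially"
    unfolding uniform_limit_iff by (simp only: eventually_sequentially_Suc[of "\<lambda>n. \<forall>x\<in>UNIV. dist (\<Sum>i<n. \<Sum>k\<in>shell i. ?c k * mode k x) (G x) < e" for e])
  then have ul: "uniform_limit UNIV (\<lambda>n. tsum (int n) ?c) G sequentially"
    unfolding tsum_def[abs_def] sum_shells .
  have Gc: "continuous_on UNIV G"
    by (rule uniform_limit_theorem[OF _ ul]) (auto simp: continuous_tsum)
  have Gi: "integrable circ G" by (rule circ_integrable_continuous[OF Gc])
  have "fourier_coeff G k = ?c k" for k
  proof -
    have "cmod (fourier_coeff G k - ?c k) \<le> 0 + e" if e: "e > 0" for e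
    proof -
      from uniform_limitD[OF ul e] obtain n0 where n0: "\<And>n x. n \<ge> n0 \<Longrightarrow> dist (tsum (int n) ?c x) (G x) < e"
        by (auto simp: eventually_sequentially)
      define n where "n = max n0 (nat \<bar>k\<bar>)"
      have "fourier_coeff (tsum (int n) ?c) k = ?c k"
        unfolding fourier_coeff_tsum by (simp add: cutoff_def n_def)
      then have "cmod (fourier_coeff G k - ?c k) = cmod (fourier_coeff (\<lambda>x. G x - tsum (int n) ?c x) k)"
        by (simp add: fourier_coeff_diff[OF Gi L2_integrable[OF L2_tsum]])
      also have "\<dots> \<le> e"
      proof (rule fourier_coeff_bound)
        show "(\<lambda>x. G x - tsum (int n) ?c x) \<in> borel_measurable circ"
          by (intro borel_measurable_diff borel_measurable_integrable Gi L2_measurable L2_tsum)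
        show "AE x in circ. cmod (G x - tsum (int n) ?c x) \<le> e"
          by (rule AE_I2) (use n0[of n] in \<open>auto simp: n_def dist_norm norm_minus_commute intro: less_imp_le\<close>)
      qed
      finally show ?thesis by simp
    qed
    then have "cmod (fourier_coeff G k - ?c k) \<le> 0" by (rule field_le_epsilon)
    then show ?thesis by simp
  qed
  then have "fourier_coeff (\<lambda>x. f x - G x) k = 0" for k
    by (simp add: fourier_coeff_diff[OF f Gi])
  then have "AE x in circ. f x - G x = 0"
    by (intro fourier_uniqueness Bochner_Integration.integrable_diff f Gi)
  then show ?thesis
  proof (rule AE_mp, intro AE_I2 impI)
    fix x assume "f x - G x = 0"
    then have "G x = f x" by simp
    then show "(\<lambda>n. tsum (int n) ?c x) \<longlonglongrightarrow> f x"
      using tendsto_uniform_limitI[OF ul, of x] by simp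
  qed
qed

lemma norm_tsum_le: "cmod (tsum K c x) \<le> l1 K c"
  unfolding tsum_def l1_def by (rule order_trans[OF norm_sum]) (simp add: norm_mult)

lemma fourier_series_tail_AE:
  assumes f: "integrable circ f" and A: "\<And>n. l1 (int n) (fourier_coeff f) \<le> A"
    and K: "0 \<le> K" and tail: "\<And>n. l1 (int n) (\<lambda>k. fourier_coeff f k - cutoff K (fourier_coeff f) k) \<le> \<tau>"
  shows "AE x in circ. cmod (f x - tsum K (fourier_coeff f) x) \<le> \<tau>" "AE x in circ. cmod (f x) \<le> A"
proof -
  let ?c = "fourier_coeff f"
  have conv: "AE x in circ. (\<lambda>n. tsum (int n) ?c x) \<longlonglongrightarrow> f x"
    by (rule fourier_series_AE[OF f]) (use A in \<open>auto simp: l1_def\<close>)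
  then show "AE x in circ. cmod (f x) \<le> A"
  proof (rule AE_mp, intro AE_I2 impI)
    fix x assume l: "(\<lambda>n. tsum (int n) ?c x) \<longlonglongrightarrow> f x"
    show "cmod (f x) \<le> A"
      by (rule LIMSEQ_le_const2[OF tendsto_norm[OF l]]) (use norm_tsum_le A order_trans in blast)
  qed
  from conv show "AE x in circ. cmod (f x - tsum K ?c x) \<le> \<tau>"
  proof (rule AE_mp, intro AE_I2 impI)
    fix x assume l: "(\<lambda>n. tsum (int n) ?c x) \<longlonglongrightarrow> f x"
    have "cmod (tsum (int n) ?c x - tsum K ?c x) \<le> \<tau>" if n: "n \<ge> nat K" for n
    proof -
      have "tsum K ?c x = (\<Sum>k=-int n..int n. cutoff K ?c k * mode k x)"
        unfolding tsum_def by (rule sum.mono_neutral_cong_left) (use n in \<open>auto simp: cutoff_def\<close>)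
      then have "tsum (int n) ?c x - tsum K ?c x = tsum (int n) (\<lambda>k. ?c k - cutoff K ?c k) x"
        by (simp add: tsum_def sum_subtractf left_diff_distrib)
      then show ?thesis using norm_tsum_le tail order_trans by metis
    qed
    then show "cmod (f x - tsum K ?c x) \<le> \<tau>"
      by (intro LIMSEQ_le_const2[OF tendsto_norm[OF tendsto_diff[OF l tendsto_const]]]) blast
  qed
qed

text \<open>Only the upper bound in Parseval's identity is needed, and absolute summability reduces
  it to bounded convergence of the partial sums.\<close>

lemma parseval_le:
  assumes f: "f \<in> L2" and A: "\<And>n. l1 (int n) (fourier_coeff f) \<le> A" and D: "\<And>n. l2 (int n) (fourier_coeff f) \<le> D"
  shows "l2_norm f \<le> sqrt (2 * pi) * D"
proof -
  let ?c = "fourier_coeff f"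
  have conv: "AE x in circ. (\<lambda>n. tsum (int n) ?c x) \<longlonglongrightarrow> f x"
    by (rule fourier_series_AE[OF L2_integrable[OF f]]) (use A in \<open>auto simp: l1_def\<close>)
  have "(\<lambda>n. LINT x|circ. (cmod (tsum (int n) ?c x))\<^sup>2) \<longlonglongrightarrow> (LINT x|circ. (cmod (f x))\<^sup>2)"
  proof (rule integral_dominated_convergence[where w = "\<lambda>x. A\<^sup>2"])
    show "(\<lambda>x. (cmod (f x))\<^sup>2) \<in> borel_measurable circ"
      using L2_measurable[OF f] by measurable
    show "(\<lambda>x. (cmod (tsum (int n) ?c x))\<^sup>2) \<in> borel_measurable circ" for n
      using L2_measurable[OF L2_tsum[of "int n" ?c]] by measurable
    show "integrable circ (\<lambda>x. A\<^sup>2)" by (rule integrable_circ_const)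
    show "AE x in circ. (\<lambda>n. (cmod (tsum (int n) ?c x))\<^sup>2) \<longlonglongrightarrow> (cmod (f x))\<^sup>2"
      using conv by (rule AE_mp) (auto intro!: AE_I2 tendsto_intros)
    show "AE x in circ. norm ((cmod (tsum (int n) ?c x))\<^sup>2) \<le> A\<^sup>2" for n
      by (rule AE_I2) (auto intro!: power_mono order_trans[OF norm_tsum_le A])
  qed
  moreover have "(LINT x|circ. (cmod (tsum (int n) ?c x))\<^sup>2) \<le> (sqrt (2 * pi) * D)\<^sup>2" for n
    unfolding l2_norm_power2[OF L2_tsum, symmetric] l2_norm_tsum
    by (intro power_mono mult_left_mono D) (auto simp: l2_nonneg)
  ultimately have le: "(l2_norm f)\<^sup>2 \<le> (sqrt (2 * pi) * D)\<^sup>2"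
    unfolding l2_norm_power2[OF f] by (intro LIMSEQ_le_const2) auto
  have "0 \<le> D" using D[of 0] l2_nonneg[of 0 ?c] by simp
  then show ?thesis by (intro power2_le_imp_le[OF le]) simp
qed

lemma fourier_coeff_tsum_mult:
  assumes "integrable circ g"
  shows "fourier_coeff (\<lambda>x. tsum K c x * g x) k = conv K c (fourier_coeff g) k"
proof -
  have "fourier_coeff (\<lambda>x. tsum K c x * g x) k = (\<Sum>j=-K..K. fourier_coeff (\<lambda>x. c j * (g x * mode j x)) k)"
    unfolding tsum_def sum_distrib_right
    by (subst fourier_coeff_sum[symmetric]) (auto simp: mult_ac intro!: integrable_mode_mult assms)
  also have "\<dots> = conv K c (fourier_coeff g) k"
    unfolding conv_def fourier_coeff_scale
    by (simp add: fourier_coeff_mode mult.assoc mode_add)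
  finally show ?thesis .
qed

text \<open>With truncated series F and G, the difference fg - FG is (f - F)g + F(g - G), and l1
  norms of tails bound each factor in the sup norm. Infinite convolutions are thereby
  avoided.\<close>

lemma fourier_coeff_mult_approx:
  assumes f: "f \<in> L2" and g: "g \<in> L2" and K: "0 \<le> K"
    and Af: "\<And>n. l1 (int n) (fourier_coeff f) \<le> A" and Ag: "\<And>n. l1 (int n) (fourier_coeff g) \<le> B"
    and tf: "\<And>n. l1 (int n) (\<lambda>k. fourier_coeff f k - cutoff K (fourier_coeff f) k) \<le> \<sigma>"
    and tg: "\<And>n. l1 (int n) (\<lambda>k. fourier_coeff g k - cutoff K (fourier_coeff g) k) \<le> \<tau>"
  shows "cmod (fourier_coeff (\<lambda>x. f x * g x) k
     - conv K (cutoff K (fourier_coeff f)) (cutoff K (fourier_coeff g)) k) \<le> \<sigma> * B + A * \<tau>"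
proof -
  let ?F = "tsum K (fourier_coeff f)" and ?G = "tsum K (fourier_coeff g)"
  have i1: "integrable circ (\<lambda>x. f x * g x)" and i2: "integrable circ (\<lambda>x. ?F x * ?G x)"
    by (intro L2_mult_integrable f g L2_tsum)+
  have "fourier_coeff (\<lambda>x. ?F x * ?G x) k = conv K (fourier_coeff f) (fourier_coeff ?G) k"
    by (rule fourier_coeff_tsum_mult[OF L2_integrable[OF L2_tsum]])
  also have "\<dots> = conv K (cutoff K (fourier_coeff f)) (cutoff K (fourier_coeff g)) k"
    unfolding conv_def fourier_coeff_tsum by (rule sum.cong) (auto simp: cutoff_def)
  finally have 1: "fourier_coeff (\<lambda>x. ?F x * ?G x) k = \<dots>" .
  have "cmod (fourier_coeff (\<lambda>x. f x * g x - ?F x * ?G x) k) \<le> \<sigma> * B + A * \<tau>"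
  proof (rule fourier_coeff_bound)
    show "(\<lambda>x. f x * g x - ?F x * ?G x) \<in> borel_measurable circ"
      using i1 i2 by (intro borel_measurable_diff) auto
    note Fi = fourier_series_tail_AE[OF L2_integrable[OF f] Af K tf] and Gi = fourier_series_tail_AE[OF L2_integrable[OF g] Ag K tg]
    have s0: "0 \<le> \<sigma>" "0 \<le> A" using tf[of 0] Af[of 0] l1_nonneg order_trans by blast+
    from Fi(1) Gi show "AE x in circ. cmod (f x * g x - ?F x * ?G x) \<le> \<sigma> * B + A * \<tau>"
    proof eventually_elim
      case (elim x)
      have "?F x * (g x - ?G x) + (f x - ?F x) * g x = f x * g x - ?F x * ?G x" by (simp add: algebra_simps)
      then have "cmod (f x * g x - ?F x * ?G x) \<le> cmod (f x - ?F x) * cmod (g x) + cmod (?F x) * cmod (g x - ?G x)"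
        by (metis norm_triangle_ineq norm_mult add.commute)
      also have "\<dots> \<le> \<sigma> * B + A * \<tau>"
      proof (intro add_mono mult_mono elim s0)
        show "cmod (?F x) \<le> A" using norm_tsum_le[of K "fourier_coeff f" x] Af[of "nat K"] K by simp
      qed auto
      finally show ?case .
    qed
  qed
  then show ?thesis by (simp add: fourier_coeff_diff[OF i1 i2] 1)
qed

section \<open>Fourier coefficients of the three solutions\<close>

lemma trig_space_iff: "f \<in> trig_space N \<longleftrightarrow> (\<exists>c. f = tsum (int N) c)"
  unfolding trig_space_def tsum_def[abs_def] mode_def by simp

lemma trig_space_L2: "f \<in> trig_space N \<Longrightarrow> f \<in> L2"
  by (auto simp: trig_space_iff L2_tsum)

lemma supp_fourier_trig: "f \<in> trig_space N \<Longrightarrow> supp (int N) (fourier_coeff f)"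
  by (auto simp: trig_space_iff supp_def fourier_coeff_tsum cutoff_def)

lemma trig_space_tsum: "f \<in> trig_space N \<Longrightarrow> f = tsum (int N) (fourier_coeff f)"
proof -
  assume "f \<in> trig_space N"
  then obtain c where c: "f = tsum (int N) c" by (auto simp: trig_space_iff)
  show ?thesis
    unfolding c tsum_def[abs_def] fourier_coeff_tsum[unfolded tsum_def[abs_def]]
    by (intro ext sum.cong) (auto simp: cutoff_def)
qed

lemma tsum_single: "\<bar>k\<bar> \<le> N \<Longrightarrow> tsum N (\<lambda>j. if j = k then c else 0) x = c * mode k x"
  unfolding tsum_def by (subst sum.cong[OF refl, where h = "\<lambda>j. if j = k then c * mode k x else 0"]) auto

lemma mode_trig_space: "\<bar>k\<bar> \<le> int N \<Longrightarrow> mode k \<in> trig_space N"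
  unfolding trig_space_iff using tsum_single[of k "int N" 1]
  by (intro exI[of _ "\<lambda>j. if j = k then 1 else 0"] ext) simp

lemma mode_vector_derivative: "((\<lambda>x. c * mode k x) has_vector_derivative (c * (\<i> * of_int k) * mode k x)) (at x)"
proof -
  have "(mode k has_vector_derivative (\<i> * of_int k) * mode k x) (at x)"
    unfolding mode_def[abs_def]
    by (auto intro!: derivative_eq_intros has_vector_derivative_real_field simp: has_real_derivative_iff_has_vector_derivative)
  from has_vector_derivative_mult_right[OF this, of c] show ?thesis by (simp add: mult.assoc)
qed

lemma dx_tsum: "dx (tsum N c) = tsum N (\<lambda>k. (\<i> * of_int k) * c k)"
proof
  fix x
  have "(tsum N c has_vector_derivative (\<Sum>k=-N..N. c k * (\<i> * of_int k) * mode k x)) (at x)"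
    unfolding tsum_def[abs_def] by (intro has_vector_derivative_sum mode_vector_derivative)
  then show "dx (tsum N c) x = tsum N (\<lambda>k. (\<i> * of_int k) * c k) x"
    unfolding dx_def tsum_def by (simp add: vector_derivative_at mult_ac)
qed

lemma dx_funpow_tsum: "(dx ^^ n) (tsum N c) = tsum N (\<lambda>k. (\<i> * of_int k) ^ n * c k)"
  by (induction n) (simp_all add: dx_tsum mult.assoc)

lemma dx_funpow_mode: "(dx ^^ n) (mode k) = (\<lambda>x. (\<i> * of_int k) ^ n * mode k x)"
proof (induction n)
  case (Suc n)
  have "dx (\<lambda>x. (\<i> * of_int k) ^ n * mode k x) = (\<lambda>x. (\<i> * of_int k) ^ n * (\<i> * of_int k) * mode k x)"
    unfolding dx_def by (rule ext) (rule vector_derivative_at[OF mode_vector_derivative])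
  with Suc show ?case by (simp add: mult_ac)
qed simp

lemma smooth_mode: "smooth (mode k)"
  unfolding smooth_def dx_funpow_mode
proof (intro allI)
  fix n x
  show "(\<lambda>x. (\<i> * of_int k) ^ n * mode k x) differentiable at x"
    using mode_vector_derivative[of "(\<i> * of_int k) ^ n" k x]
    unfolding has_vector_derivative_def differentiable_def by blast
qed

text \<open>The modes are admissible test functions; the sign in the definition cancels against the
  one from differentiating the mode -k.\<close>

lemma fourier_coeff_weak_deriv:
  assumes "weak_deriv n f g"
  shows "fourier_coeff g k = (\<i> * of_int k) ^ n * fourier_coeff f k"
proof -
  have "(LINT x|circ. f x * (dx ^^ n) (mode (- k)) x) = (-1) ^ n * (LINT x|circ. g x * mode (- k) x)"
    using assms smooth_mode periodic_mode unfolding weak_deriv_def by blast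
  moreover have "(LINT x|circ. f x * (dx ^^ n) (mode (- k)) x) = (\<i> * of_int (- k)) ^ n * (LINT x|circ. f x * mode (- k) x)"
    unfolding dx_funpow_mode
    by (simp only: mult.left_commute[of _ "(\<i> * of_int (- k)) ^ n"] integral_mult_right_zero)
  moreover have "(\<i> * of_int (- k)) ^ n = (-1) ^ n * (\<i> * complex_of_int k) ^ n"
    by (simp flip: power_mult_distrib)
  ultimately have "(-1) ^ n * (LINT x|circ. g x * mode (- k) x) = (-1) ^ n * ((\<i> * of_int k) ^ n * (LINT x|circ. f x * mode (- k) x))"
    by (simp add: mult.assoc)
  then have "(LINT x|circ. g x * mode (- k) x) = (\<i> * of_int k) ^ n * (LINT x|circ. f x * mode (- k) x)"
    by simp
  then show ?thesis by (simp add: fourier_coeff_mode mult.left_commute)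
qed

lemma herm_fourier_coeff:
  assumes "real_valued f"
  shows "herm (fourier_coeff f)"
  unfolding herm_def
proof
  fix k
  have "cnj (f x) = f x" for x using assms unfolding real_valued_def by (simp add: Reals_cnj_iff)
  then have "(LINT x|circ. f x * mode k x) = (LINT x|circ. cnj (f x * mode (- k) x))"
    by (simp add: cnj_mode)
  also have "\<dots> = cnj (LINT x|circ. f x * mode (- k) x)"
    by (rule Bochner_Integration.integral_cnj)
  finally show "fourier_coeff f (- k) = cnj (fourier_coeff f k)"
    by (simp add: fourier_coeff_mode)
qed

lemma l2_inner_mode: "l2_inner f (mode k) = 2 * of_real pi * fourier_coeff f k"
  by (simp add: l2_inner_def cnj_mode fourier_coeff_mode)

lemma disp_symbol: "(\<i> * of_int k) ^ 5 - (\<i> * of_int k) ^ 3 = \<i> * of_real (disp k)"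
  by (simp add: disp_def eval_nat_numeral algebra_simps)

text \<open>The free summand \<open>g\<close> is the time derivative for the Galerkin problem and 0
  for the leapfrog scheme.\<close>

lemma fourier_coeff_rhs:
  assumes "f \<in> trig_space N" "g \<in> L2" "\<bar>k\<bar> \<le> int N"
  shows "fourier_coeff (\<lambda>x. g x + f x * dx f x + (dx ^^ 3) f x - (dx ^^ 5) f x) k
    = fourier_coeff g k - flow1 (int N) (fourier_coeff f) k"
proof -
  let ?c = "fourier_coeff f"
  have f: "f = tsum (int N) ?c" by (rule trig_space_tsum[OF assms(1)])
  have s: "supp (int N) ?c" by (rule supp_fourier_trig[OF assms(1)])
  have d: "dx f = tsum (int N) (\<lambda>k. (\<i> * of_int k) * ?c k)" "(dx ^^ n) f = tsum (int N) (\<lambda>k. (\<i> * of_int k) ^ n * ?c k)" for n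
    by (subst (1) f, rule dx_tsum dx_funpow_tsum)+
  have fd: "fourier_coeff (\<lambda>x. f x * dx f x) k = \<i> * of_int k / 2 * conv (int N) ?c ?c k"
  proof -
    have "fourier_coeff (\<lambda>x. f x * dx f x) k = fourier_coeff (\<lambda>x. tsum (int N) ?c x * dx f x) k"
      using f by simp
    also have "\<dots> = conv (int N) ?c (fourier_coeff (dx f)) k"
      by (rule fourier_coeff_tsum_mult) (simp add: d L2_integrable L2_tsum)
    also have "fourier_coeff (dx f) = (\<lambda>j. \<i> * of_int j * ?c j)"
      unfolding d fourier_coeff_tsum[abs_def] using s by (auto simp: cutoff_def supp_def)
    finally show ?thesis using conv_deriv_square[OF s] by simp
  qed
  have i: "integrable circ g" "integrable circ (\<lambda>x. f x * dx f x)" "integrable circ ((dx ^^ n) f)" for n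
    unfolding d by (intro L2_integrable[OF assms(2)] L2_mult_integrable[OF trig_space_L2[OF assms(1)]] L2_tsum L2_integrable[OF L2_tsum])+
  have "fourier_coeff (\<lambda>x. g x + f x * dx f x + (dx ^^ 3) f x - (dx ^^ 5) f x) k
     = fourier_coeff g k + fourier_coeff (\<lambda>x. f x * dx f x) k + fourier_coeff ((dx ^^ 3) f) k - fourier_coeff ((dx ^^ 5) f) k"
    using i by (simp add: fourier_coeff_add fourier_coeff_diff)
  also have "\<dots> = fourier_coeff g k + \<i> * of_int k / 2 * conv (int N) ?c ?c k + (\<i> * of_int k) ^ 3 * ?c k - (\<i> * of_int k) ^ 5 * ?c k"
    unfolding fd unfolding d fourier_coeff_tsum using assms(3) by (simp add: cutoff_def)
  also have "\<dots> = fourier_coeff g k - (((\<i> * of_int k) ^ 5 - (\<i> * of_int k) ^ 3) * ?c k - \<i> * of_int k / 2 * conv (int N) ?c ?c k)"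
    by (simp add: algebra_simps)
  also have "\<dots> = fourier_coeff g k - flow1 (int N) ?c k"
    unfolding disp_symbol flow1_def using assms(3) by (simp add: cutoff_def)
  finally show ?thesis .
qed

lemma trig_proj_eq:
  assumes "f \<in> L2"
  shows "trig_proj N f = tsum (int N) (fourier_coeff f)"
  unfolding trig_proj_def
proof (rule the_equality)
  let ?p = "tsum (int N) (fourier_coeff f)"
  have "l2_inner (\<lambda>x. f x - ?p x) \<phi> = 0" if phi: "\<phi> \<in> trig_space N" for \<phi>
  proof -
    obtain c where c: "\<phi> = tsum (int N) c" using phi unfolding trig_space_iff by blast
    have i: "integrable circ f" "integrable circ ?p" by (intro L2_integrable assms L2_tsum)+
    show ?thesis
      unfolding c l2_inner_tsum[OF Bochner_Integration.integrable_diff[OF i]] fourier_coeff_diff[OF i] fourier_coeff_tsum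
      by (subst sum.neutral) (auto simp: cutoff_def)
  qed
  then show "?p \<in> trig_space N \<and> (\<forall>\<phi>\<in>trig_space N. l2_inner (\<lambda>x. f x - ?p x) \<phi> = 0)"
    by (auto simp: trig_space_iff)
  fix p assume p: "p \<in> trig_space N \<and> (\<forall>\<phi>\<in>trig_space N. l2_inner (\<lambda>x. f x - p x) \<phi> = 0)"
  have pL2: "p \<in> L2" using p trig_space_L2 by blast
  have "fourier_coeff p k = fourier_coeff f k" if k: "\<bar>k\<bar> \<le> int N" for k
  proof -
    have "l2_inner (\<lambda>x. f x - p x) (mode k) = 0" using p mode_trig_space[OF k] by blast
    then have "fourier_coeff (\<lambda>x. f x - p x) k = 0" by (simp add: l2_inner_mode)
    then show ?thesis
      by (simp add: fourier_coeff_diff[OF L2_integrable[OF assms] L2_integrable[OF pL2]])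
  qed
  then have "tsum (int N) (fourier_coeff p) = ?p"
    unfolding tsum_def[abs_def] by (intro ext sum.cong) auto
  moreover have "p = tsum (int N) (fourier_coeff p)" using p by (intro trig_space_tsum) blast
  ultimately show "p = ?p" by simp
qed

lemma norm_fourier_coeff_trig_le:
  assumes "f \<in> trig_space N"
  shows "cmod (fourier_coeff f k) \<le> l2_norm f"
proof -
  let ?c = "fourier_coeff f"
  have s: "supp (int N) ?c" by (rule supp_fourier_trig[OF assms])
  have f: "l2_norm f = sqrt (2 * pi) * l2 (int N) ?c"
    by (subst trig_space_tsum[OF assms]) (rule l2_norm_tsum)
  have "cmod (?c k) \<le> 1 * l2 (int N) ?c"
  proof (cases "\<bar>k\<bar> \<le> int N")
    case True
    then show ?thesis unfolding l2_def mult_1 by (intro member_le_L2_set) auto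
  next
    case False
    then show ?thesis using s l2_nonneg by (simp add: supp_def)
  qed
  also have "\<dots> \<le> sqrt (2 * pi) * l2 (int N) ?c"
    using pi_gt3 by (intro mult_right_mono l2_nonneg) (auto simp: real_le_rsqrt)
  finally show ?thesis using f by simp
qed

lemma trig_space_add: "f \<in> trig_space N \<Longrightarrow> g \<in> trig_space N \<Longrightarrow> (\<lambda>x. f x + g x) \<in> trig_space N"
proof -
  assume "f \<in> trig_space N" "g \<in> trig_space N"
  then obtain c d where "f = tsum (int N) c" "g = tsum (int N) d" by (auto simp: trig_space_iff)
  then have "(\<lambda>x. f x + g x) = tsum (int N) (\<lambda>k. c k + d k)"
    by (simp add: tsum_def[abs_def] sum.distrib distrib_right)
  then show ?thesis by (auto simp: trig_space_iff)
qed

lemma trig_space_scale: "f \<in> trig_space N \<Longrightarrow> (\<lambda>x. a * f x) \<in> trig_space N"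
proof -
  assume "f \<in> trig_space N"
  then obtain c where "f = tsum (int N) c" by (auto simp: trig_space_iff)
  then have "(\<lambda>x. a * f x) = tsum (int N) (\<lambda>k. a * c k)"
    by (simp add: tsum_def[abs_def] sum_distrib_left mult.assoc)
  then show ?thesis by (auto simp: trig_space_iff)
qed

section \<open>Sobolev spaces and curves in them\<close>

lemma sobolevD:
  assumes "f \<in> sobolev s"
  shows "f \<in> L2" "(\<lambda>k::int. (1 + (real_of_int k)\<^sup>2) ^ s * (cmod (fourier_coeff f k))\<^sup>2) summable_on UNIV"
  using assms by (auto simp: sobolev_def)

lemma sobolev_norm_power2:
  "f \<in> sobolev s \<Longrightarrow> (sobolev_norm s f)\<^sup>2 = (\<Sum>\<^sub>\<infinity>k::int. (1 + (real_of_int k)\<^sup>2) ^ s * (cmod (fourier_coeff f k))\<^sup>2)"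
  unfolding sobolev_norm_def by (simp add: infsum_nonneg)

lemma sobolev_sum_le:
  assumes "f \<in> sobolev s" "finite F"
  shows "(\<Sum>k\<in>F. (1 + (real_of_int k)\<^sup>2) ^ s * (cmod (fourier_coeff f k))\<^sup>2) \<le> (sobolev_norm s f)\<^sup>2"
  unfolding sobolev_norm_power2[OF assms(1)]
  by (rule finite_sum_le_infsum[OF sobolevD(2)[OF assms(1)] assms(2)]) auto

lemma sobolev_norm_nonneg: "f \<in> sobolev s \<Longrightarrow> 0 \<le> sobolev_norm s f"
  unfolding sobolev_norm_def by (simp add: infsum_nonneg)

lemma norm_fourier_coeff_sobolev_le:
  assumes "f \<in> sobolev s"
  shows "cmod (fourier_coeff f k) \<le> sobolev_norm s f"
proof -
  have "1 * (cmod (fourier_coeff f k))\<^sup>2 \<le> (1 + (real_of_int k)\<^sup>2) ^ s * (cmod (fourier_coeff f k))\<^sup>2"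
    by (intro mult_right_mono one_le_power) auto
  also have "\<dots> \<le> (sobolev_norm s f)\<^sup>2" using sobolev_sum_le[OF assms, of "{k}"] by simp
  finally have "(cmod (fourier_coeff f k))\<^sup>2 \<le> (sobolev_norm s f)\<^sup>2" by simp
  then show ?thesis by (rule power2_le_imp_le[OF _ sobolev_norm_nonneg[OF assms]])
qed

lemma weighted_coeff_add_le:
  assumes "f \<in> L2" "g \<in> L2"
  shows "(1 + (real_of_int k)\<^sup>2) ^ s * (cmod (fourier_coeff (\<lambda>x. f x + g x) k))\<^sup>2
    \<le> 2 * ((1 + (real_of_int k)\<^sup>2) ^ s * (cmod (fourier_coeff f k))\<^sup>2 + (1 + (real_of_int k)\<^sup>2) ^ s * (cmod (fourier_coeff g k))\<^sup>2)"
proof -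
  let ?w = "(1 + (real_of_int k)\<^sup>2) ^ s"
  have "(cmod (fourier_coeff f k + fourier_coeff g k))\<^sup>2 \<le> (cmod (fourier_coeff f k) + cmod (fourier_coeff g k))\<^sup>2"
    by (intro power_mono norm_triangle_ineq) simp
  also have "\<dots> \<le> 2 * ((cmod (fourier_coeff f k))\<^sup>2 + (cmod (fourier_coeff g k))\<^sup>2)"
    using sum_squares_bound[of "cmod (fourier_coeff f k)" "cmod (fourier_coeff g k)"] by (simp add: power2_sum)
  finally have "?w * (cmod (fourier_coeff f k + fourier_coeff g k))\<^sup>2 \<le> ?w * (2 * ((cmod (fourier_coeff f k))\<^sup>2 + (cmod (fourier_coeff g k))\<^sup>2))"
    by (rule mult_left_mono) simp
  then show ?thesis
    by (simp add: fourier_coeff_add L2_integrable assms algebra_simps)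
qed

lemma sobolev_add:
  assumes "f \<in> sobolev s" "g \<in> sobolev s"
  shows "(\<lambda>x. f x + g x) \<in> sobolev s"
proof -
  let ?w = "\<lambda>k::int. (1 + (real_of_int k)\<^sup>2) ^ s"
  note F = sobolevD[OF assms(1)] and G = sobolevD[OF assms(2)]
  have "(\<lambda>k. 2 * (?w k * (cmod (fourier_coeff f k))\<^sup>2 + ?w k * (cmod (fourier_coeff g k))\<^sup>2)) summable_on UNIV"
    by (intro summable_on_cmult_right summable_on_add F G)
  then have "(\<lambda>k. ?w k * (cmod (fourier_coeff (\<lambda>x. f x + g x) k))\<^sup>2) summable_on UNIV"
  proof (rule summable_on_comparison_test)
    fix k
    show "?w k * (cmod (fourier_coeff (\<lambda>x. f x + g x) k))\<^sup>2 \<le> 2 * (?w k * (cmod (fourier_coeff f k))\<^sup>2 + ?w k * (cmod (fourier_coeff g k))\<^sup>2)"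
      by (rule weighted_coeff_add_le[OF F(1) G(1)])
  qed auto
  then show ?thesis using L2_add[OF F(1) G(1)] by (simp add: sobolev_def)
qed

lemma sobolev_scale:
  assumes "f \<in> sobolev s"
  shows "(\<lambda>x. c * f x) \<in> sobolev s"
proof -
  have "(\<lambda>k::int. (cmod c)\<^sup>2 * ((1 + (real_of_int k)\<^sup>2) ^ s * (cmod (fourier_coeff f k))\<^sup>2)) summable_on UNIV"
    by (intro summable_on_cmult_right sobolevD[OF assms])
  then show ?thesis using L2_scale[OF sobolevD(1)[OF assms]]
    by (simp add: sobolev_def fourier_coeff_scale norm_mult power_mult_distrib mult_ac)
qed

lemma sobolev_diff: "f \<in> sobolev s \<Longrightarrow> g \<in> sobolev s \<Longrightarrow> (\<lambda>x. f x - g x) \<in> sobolev s"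
  using sobolev_add[of f s "\<lambda>x. (-1) * g x"] sobolev_scale[of g s "-1"] by simp

lemma sobolev_mono:
  assumes "f \<in> sobolev s" "s' \<le> s"
  shows "f \<in> sobolev s'"
proof -
  have "(\<lambda>k::int. (1 + (real_of_int k)\<^sup>2) ^ s' * (cmod (fourier_coeff f k))\<^sup>2) summable_on UNIV"
    by (rule summable_on_comparison_test[OF sobolevD(2)[OF assms(1)]])
       (auto intro!: mult_right_mono power_increasing assms(2))
  then show ?thesis using assms(1) by (simp add: sobolev_def)
qed

text \<open>Any norm that dominates a Fourier coefficient carries differentiability of the curve
  over to it; this is applied with \<open>sobolev_norm\<close> and with \<open>l2_norm\<close>. At s
  = t the quotient is a division by zero, hence that point is excluded.\<close>

lemma coeff_has_derivative:
  assumes curve: "has_curve_deriv nrm w v t" and t: "0 \<le> t"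
    and L2: "\<And>s. 0 \<le> s \<Longrightarrow> w s \<in> L2" "v \<in> L2"
    and le: "\<And>s. 0 \<le> s \<Longrightarrow> s \<noteq> t \<Longrightarrow> cmod (fourier_coeff (\<lambda>x. (w s x - w t x) / of_real (s - t) - v x) k)
      \<le> nrm (\<lambda>x. (w s x - w t x) / of_real (s - t) - v x)"
  shows "((\<lambda>s. fourier_coeff (w s) k) has_vector_derivative fourier_coeff v k) (at t within {0..})"
proof -
  let ?q = "\<lambda>s x. (w s x - w t x) / of_real (s - t) - v x"
  have q: "fourier_coeff (?q s) k = (fourier_coeff (w s) k - fourier_coeff (w t) k) / of_real (s - t) - fourier_coeff v k"
    if s: "0 \<le> s" for s
  proof -
    have i: "integrable circ (\<lambda>x. (1 / of_real (s - t)) * (w s x - w t x))"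
      by (intro L2_integrable L2_scale L2_diff L2 s t)
    have "?q s = (\<lambda>x. (1 / of_real (s - t)) * (w s x - w t x) - v x)" by simp
    then have "fourier_coeff (?q s) k = fourier_coeff (\<lambda>x. (1 / of_real (s - t)) * (w s x - w t x)) k - fourier_coeff v k"
      using fourier_coeff_diff[OF i L2_integrable[OF L2(2)]] by simp
    also have "\<dots> = (fourier_coeff (w s) k - fourier_coeff (w t) k) / of_real (s - t) - fourier_coeff v k"
      unfolding fourier_coeff_scale using L2 s t by (simp add: fourier_coeff_diff L2_integrable)
    finally show ?thesis .
  qed
  have "((\<lambda>s. fourier_coeff (?q s) k) \<longlongrightarrow> 0) (at t within {0..})"
  proof (rule Lim_null_comparison)
    show "((\<lambda>s. nrm (?q s)) \<longlongrightarrow> 0) (at t within {0..})" using curve by (simp add: has_curve_deriv_def)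
    show "\<forall>\<^sub>F s in at t within {0..}. cmod (fourier_coeff (?q s) k) \<le> nrm (?q s)"
      unfolding eventually_at_filter by (rule always_eventually) (auto intro!: le simp del: of_real_diff)
  qed
  moreover have "\<forall>\<^sub>F s in at t within {0..}. fourier_coeff (?q s) k
     = (1 / (s - t)) *\<^sub>R (fourier_coeff (w s) k - fourier_coeff (w t) k) - fourier_coeff v k"
    unfolding eventually_at_filter
    by (rule always_eventually) (auto simp: q scaleR_conv_of_real simp del: of_real_diff)
  ultimately have "((\<lambda>s. (1 / (s - t)) *\<^sub>R (fourier_coeff (w s) k - fourier_coeff (w t) k) - fourier_coeff v k) \<longlongrightarrow> 0) (at t within {0..})"
    by (rule Lim_transform_eventually)
  note d = this
  let ?f = "\<lambda>s. fourier_coeff (w s) k" and ?v = "fourier_coeff v k"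
  have "((\<lambda>s. (1 / norm (s - t)) *\<^sub>R (?f s - (?f t + (s - t) *\<^sub>R ?v))) \<longlongrightarrow> 0) (at t within {0..})"
  proof (rule Lim_null_comparison[OF _ tendsto_norm_zero[OF d]])
    have "norm ((1 / norm (s - t)) *\<^sub>R (?f s - (?f t + (s - t) *\<^sub>R ?v))) \<le> norm ((1 / (s - t)) *\<^sub>R (?f s - ?f t) - ?v)"
      if "s \<noteq> t" for s
    proof -
      have "(1 / (s - t)) *\<^sub>R (?f s - ?f t) - ?v = (1 / (s - t)) *\<^sub>R (?f s - (?f t + (s - t) *\<^sub>R ?v))"
        using that by (simp add: scaleR_diff_right scaleR_add_right)
      then show ?thesis by (simp only: norm_scaleR) simp
    qed
    then show "\<forall>\<^sub>F s in at t within {0..}. norm ((1 / norm (s - t)) *\<^sub>R (?f s - (?f t + (s - t) *\<^sub>R ?v))) \<le> norm ((1 / (s - t)) *\<^sub>R (?f s - ?f t) - ?v)"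
      unfolding eventually_at_filter by (intro always_eventually) blast
  qed
  then show ?thesis
    unfolding has_vector_derivative_def has_derivative_within by (simp add: bounded_linear_scaleR_left)
qed

text \<open>The step telescopes through 1/(n + 2)^2 <= 1/(n + 1) - 1/(n + 2), and 3 is chosen so
  that n = 0 gives equality.\<close>

lemma sum_inverse_wt: "(\<Sum>k=-int n..int n. 1 / wt k ^ 2) \<le> 3 - 2 / (real n + 1)"
proof (induction n)
  case 0
  show ?case by (simp add: wt_def)
next
  case (Suc n)
  have "(\<Sum>k=-int (Suc n)..int (Suc n). 1 / wt k ^ 2) = (\<Sum>k=-int n..int n. 1 / wt k ^ 2) + (\<Sum>k\<in>shell (Suc n). 1 / wt k ^ 2)"
    unfolding sum_shells by simp
  also have "(\<Sum>k\<in>shell (Suc n). 1 / wt k ^ 2) = 2 / (real n + 2) ^ 2"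
    by (simp add: shell_def wt_def)
  also have "2 / (real n + 2) ^ 2 \<le> 2 / (real n + 1) - 2 / (real n + 2)"
  proof -
    have "2 / (real n + 1) - 2 / (real n + 2) = 2 / ((real n + 1) * (real n + 2))"
      by (simp add: field_simps)
    moreover have "2 / (real n + 2) ^ 2 \<le> 2 / ((real n + 1) * (real n + 2))"
      unfolding power2_eq_square by (intro divide_left_mono mult_right_mono) auto
    ultimately show ?thesis by simp
  qed
  finally show ?case using Suc by (simp add: algebra_simps)
qed

text \<open>Cauchy-Schwarz against the square-summable sequence 1/wt; the extra derivative is the
  step from 15 to 16.\<close>

lemma wl1_le_wl2: "wl1 s (int n) f \<le> 2 * wl2 (Suc s) (int n) f"
proof -
  have "wl1 s (int n) f = (\<Sum>k=-int n..int n. \<bar>1 / wt k\<bar> * \<bar>cmod (of_real (wt k ^ Suc s) * f k)\<bar>)"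
    unfolding wl1_sum
  proof (rule sum.cong)
    fix k
    have "\<bar>1 / wt k\<bar> = 1 / wt k" using wt_pos[of k] by simp
    then show "wt k ^ s * cmod (f k) = \<bar>1 / wt k\<bar> * \<bar>cmod (of_real (wt k ^ Suc s) * f k)\<bar>"
      unfolding abs_norm_cancel cmod_wt_power_mult using wt_pos[of k] by simp
  qed simp
  also have "\<dots> \<le> L2_set (\<lambda>k. 1 / wt k) {-int n..int n} * wl2 (Suc s) (int n) f"
    unfolding wl2_def l2_def by (rule L2_set_mult_ineq)
  also have "L2_set (\<lambda>k. 1 / wt k) {-int n..int n} \<le> sqrt (2\<^sup>2)"
    unfolding L2_set_def
  proof (rule real_sqrt_le_mono)
    have "x \<le> 3 - y \<Longrightarrow> 0 \<le> y \<Longrightarrow> x \<le> 4" for x y :: real by simp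
    from this[OF sum_inverse_wt[of n]] show "(\<Sum>k=-int n..int n. (1 / wt k)\<^sup>2) \<le> 2\<^sup>2"
      by (simp add: power_divide)
  qed
  finally show ?thesis by (simp add: mult_right_mono wl2_nonneg)
qed

lemma wl2_mono: "s \<le> s' \<Longrightarrow> wl2 s K f \<le> wl2 s' K f"
  unfolding wl2_def l2_def cmod_wt_power_mult
  by (rule L2_set_mono) (auto intro!: mult_right_mono power_increasing simp: wt_ge_1 less_imp_le wt_pos)

lemma wl2_sobolev:
  assumes "f \<in> sobolev r"
  shows "wl2 r K (fourier_coeff f) \<le> sqrt (2 ^ r) * sobolev_norm r f"
proof -
  have w: "wt k ^ 2 \<le> 2 * (1 + (real_of_int k)\<^sup>2)" for k
    using sum_squares_bound[of 1 "\<bar>real_of_int k\<bar>"] by (simp add: wt_def power2_sum)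
  have "(wl2 r K (fourier_coeff f))\<^sup>2 = (\<Sum>k=-K..K. (wt k ^ 2) ^ r * (cmod (fourier_coeff f k))\<^sup>2)"
    unfolding wl2_def l2_power2 cmod_wt_power_mult power_mult_distrib
    by (simp add: power_mult[symmetric] mult.commute)
  also have "\<dots> \<le> (\<Sum>k=-K..K. 2 ^ r * ((1 + (real_of_int k)\<^sup>2) ^ r * (cmod (fourier_coeff f k))\<^sup>2))"
    unfolding mult.assoc[symmetric] power_mult_distrib[symmetric]
    by (intro sum_mono mult_right_mono power_mono w) auto
  also have "\<dots> \<le> 2 ^ r * (sobolev_norm r f)\<^sup>2"
    unfolding sum_distrib_left[symmetric] by (intro mult_left_mono sobolev_sum_le assms) auto
  also have "\<dots> = (sqrt (2 ^ r) * sobolev_norm r f)\<^sup>2" by (simp add: power_mult_distrib)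
  finally show ?thesis
    by (rule power2_le_imp_le) (simp add: sobolev_norm_nonneg[OF assms])
qed

lemma sobolev_norm_add_le:
  assumes "f \<in> sobolev s" "g \<in> sobolev s"
  shows "(sobolev_norm s (\<lambda>x. f x + g x))\<^sup>2 \<le> 2 * ((sobolev_norm s f)\<^sup>2 + (sobolev_norm s g)\<^sup>2)"
  unfolding sobolev_norm_power2[OF sobolev_add[OF assms]]
proof (rule infsum_le_finite_sums[OF sobolevD(2)[OF sobolev_add[OF assms]]])
  fix F :: "int set" assume F: "finite F"
  let ?w = "\<lambda>k::int. (1 + (real_of_int k)\<^sup>2) ^ s"
  have "(\<Sum>k\<in>F. ?w k * (cmod (fourier_coeff (\<lambda>x. f x + g x) k))\<^sup>2)
     \<le> (\<Sum>k\<in>F. 2 * (?w k * (cmod (fourier_coeff f k))\<^sup>2 + ?w k * (cmod (fourier_coeff g k))\<^sup>2))"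
  proof (rule sum_mono)
    fix k
    show "?w k * (cmod (fourier_coeff (\<lambda>x. f x + g x) k))\<^sup>2 \<le> 2 * (?w k * (cmod (fourier_coeff f k))\<^sup>2 + ?w k * (cmod (fourier_coeff g k))\<^sup>2)"
      by (rule weighted_coeff_add_le[OF sobolevD(1)[OF assms(1)] sobolevD(1)[OF assms(2)]])
  qed
  also have "\<dots> = 2 * ((\<Sum>k\<in>F. ?w k * (cmod (fourier_coeff f k))\<^sup>2) + (\<Sum>k\<in>F. ?w k * (cmod (fourier_coeff g k))\<^sup>2))"
    by (simp add: sum_distrib_left sum.distrib)
  also have "\<dots> \<le> 2 * ((sobolev_norm s f)\<^sup>2 + (sobolev_norm s g)\<^sup>2)"
    by (intro mult_left_mono add_mono sobolev_sum_le assms F) auto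
  finally show "(\<Sum>k\<in>F. ?w k * (cmod (fourier_coeff (\<lambda>x. f x + g x) k))\<^sup>2) \<le> 2 * ((sobolev_norm s f)\<^sup>2 + (sobolev_norm s g)\<^sup>2)" .
qed

text \<open>Continuity is expressed through the norm of differences, so compactness of [0, T] enters
  as a finite subcover by intervals on which the curve varies by at most 1.\<close>

lemma curve_bounded:
  assumes u: "\<And>t. 0 \<le> t \<Longrightarrow> u t \<in> sobolev r" and c: "curve_continuous (sobolev_norm r) u"
  shows "\<exists>B\<ge>0. \<forall>t\<in>{0..T}. sobolev_norm r (u t) \<le> B"
proof -
  have "\<exists>d>0. \<forall>s\<ge>0. dist s t < d \<longrightarrow> sobolev_norm r (\<lambda>x. u s x - u t x) \<le> 1" if t: "t \<in> {0..T}" for t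
  proof -
    have "((\<lambda>s. sobolev_norm r (\<lambda>x. u s x - u t x)) \<longlongrightarrow> 0) (at t within {0..})"
      using c t by (simp add: curve_continuous_def)
    from tendstoD[OF this zero_less_one] obtain d where d: "d > 0"
      "\<And>s. s \<ge> 0 \<Longrightarrow> s \<noteq> t \<Longrightarrow> dist s t < d \<Longrightarrow> dist (sobolev_norm r (\<lambda>x. u s x - u t x)) 0 < 1"
      unfolding eventually_at by auto
    have "sobolev_norm r (\<lambda>x. u s x - u t x) \<le> 1" if s: "s \<ge> 0" "dist s t < d" for s
    proof (cases "s = t")
      case True
      then show ?thesis by (simp add: sobolev_norm_def fourier_coeff_mode)
    next
      case False
      then show ?thesis using d(2)[OF s(1) False s(2)] by simp
    qed
    then show ?thesis using d(1) by blast
  qed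
  then obtain d where d: "\<And>t. t \<in> {0..T} \<Longrightarrow> 0 < d t"
    "\<And>t s. t \<in> {0..T} \<Longrightarrow> s \<ge> 0 \<Longrightarrow> dist s t < d t \<Longrightarrow> sobolev_norm r (\<lambda>x. u s x - u t x) \<le> 1"
    by metis
  have "{0..T} \<subseteq> (\<Union>t\<in>{0..T}. ball t (d t))" using d(1) by force
  then obtain C where C: "C \<subseteq> {0..T}" "finite C" "{0..T} \<subseteq> (\<Union>t\<in>C. ball t (d t))"
    by (rule compactE_image[OF compact_Icc, rotated]) auto
  \<comment> \<open>A sum instead of a maximum also covers the case of an empty cover.\<close>
  define B where "B = (\<Sum>t\<in>C. 2 * (1 + (sobolev_norm r (u t))\<^sup>2))"
  have B0: "0 \<le> B" unfolding B_def by (intro sum_nonneg) simp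
  have "sobolev_norm r (u s) \<le> sqrt B" if s: "s \<in> {0..T}" for s
  proof -
    obtain t where t: "t \<in> C" "dist s t < d t" using C(3) s by (auto simp: dist_commute)
    have t0: "t \<in> {0..T}" using t C by auto
    have s0: "0 \<le> s" using s by simp
    have ut: "u t \<in> sobolev r" "u s \<in> sobolev r" using u t0 s by auto
    have "(sobolev_norm r (u s))\<^sup>2 = (sobolev_norm r (\<lambda>x. (u s x - u t x) + u t x))\<^sup>2" by simp
    also have "\<dots> \<le> 2 * ((sobolev_norm r (\<lambda>x. u s x - u t x))\<^sup>2 + (sobolev_norm r (u t))\<^sup>2)"
      by (rule sobolev_norm_add_le[OF sobolev_diff[OF ut(2,1)] ut(1)])
    also have "\<dots> \<le> 2 * (1\<^sup>2 + (sobolev_norm r (u t))\<^sup>2)"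
      using d(2)[OF t0 s0 t(2)] sobolev_norm_nonneg[OF sobolev_diff[OF ut(2,1)]]
      by (intro mult_left_mono add_right_mono power_mono) auto
    also have "\<dots> \<le> B"
      unfolding B_def using member_le_sum[OF t(1), of "\<lambda>t. 2 * (1 + (sobolev_norm r (u t))\<^sup>2)"] C(2) by simp
    finally show ?thesis by (rule real_le_rsqrt)
  qed
  then show ?thesis using B0 by (intro exI[of _ "sqrt B"]) auto
qed

section \<open>The evolution problems as systems for coefficients\<close>

lemma kawahara_fourier:
  assumes sol: "kawahara_solution r u0 u"
  shows "\<exists>n. (\<forall>t\<ge>0. \<forall>k. ((\<lambda>s. fourier_coeff (u s) k) has_vector_derivative
        (\<i> * of_real (disp k) * fourier_coeff (u t) k - n t k)) (at t within {0..})) \<and>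
     (\<forall>t\<ge>0. \<exists>ux. weak_deriv 1 (u t) ux \<and> (\<forall>k. n t k = fourier_coeff (\<lambda>x. u t x * ux x) k))"
proof -
  have us: "u t \<in> sobolev r" if "0 \<le> t" for t using sol that by (simp add: kawahara_solution_def)
  obtain ut where ut: "\<And>t. 0 \<le> t \<Longrightarrow> ut t \<in> sobolev (r - 5)"
    "\<And>t. 0 \<le> t \<Longrightarrow> has_curve_deriv (sobolev_norm (r - 5)) u (ut t) t"
    and eq: "\<And>t. 0 \<le> t \<Longrightarrow> \<exists>ux uxxx uxxxxx.
              weak_deriv 1 (u t) ux \<and> weak_deriv 3 (u t) uxxx \<and> weak_deriv 5 (u t) uxxxxx \<and>
              (AE x in circ. ut t x + u t x * ux x + uxxx x - uxxxxx x = 0)"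
    using sol unfolding kawahara_solution_def by blast
  have d: "((\<lambda>s. fourier_coeff (u s) k) has_vector_derivative fourier_coeff (ut t) k) (at t within {0..})" if t: "0 \<le> t" for t k
  proof (rule coeff_has_derivative[OF ut(2)[OF t] t])
    show "u s \<in> L2" if "0 \<le> s" for s using us[OF that] by (rule sobolevD)
    show "ut t \<in> L2" using ut(1)[OF t] by (rule sobolevD)
    fix s :: real assume s: "0 \<le> s"
    have "(\<lambda>x. (1 / of_real (s - t)) * (u s x - u t x) - ut t x) \<in> sobolev (r - 5)"
      by (intro sobolev_diff sobolev_scale ut t sobolev_mono[OF us diff_le_self] s)
    then have "(\<lambda>x. (u s x - u t x) / of_real (s - t) - ut t x) \<in> sobolev (r - 5)" by simp
    then show "cmod (fourier_coeff (\<lambda>x. (u s x - u t x) / of_real (s - t) - ut t x) k)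
      \<le> sobolev_norm (r - 5) (\<lambda>x. (u s x - u t x) / of_real (s - t) - ut t x)"
      by (rule norm_fourier_coeff_sobolev_le)
  qed
  \<comment> \<open>With \<open>n\<close> read off from \<open>ut\<close>, the differential equation
    for the coefficients is immediate; the partial differential equation then identifies
    \<open>n\<close> with the coefficients of u u_x.\<close>
  define n where "n t k = \<i> * of_real (disp k) * fourier_coeff (u t) k - fourier_coeff (ut t) k" for t k
  have "\<exists>ux. weak_deriv 1 (u t) ux \<and> (\<forall>k. n t k = fourier_coeff (\<lambda>x. u t x * ux x) k)" if t: "0 \<le> t" for t
  proof -
    obtain ux u3 u5 where w: "weak_deriv 1 (u t) ux" "weak_deriv 3 (u t) u3" "weak_deriv 5 (u t) u5"
      and ae: "AE x in circ. ut t x + u t x * ux x + u3 x - u5 x = 0"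
      using eq[OF t] by blast
    have L2: "u t \<in> L2" "ux \<in> L2" "u3 \<in> L2" "u5 \<in> L2" "ut t \<in> L2"
      using w sobolevD(1)[OF ut(1)[OF t]] by (auto simp: weak_deriv_def)
    note i = L2_integrable[OF L2(5)] L2_mult_integrable[OF L2(1,2)] L2_integrable[OF L2(3)] L2_integrable[OF L2(4)]
    have "n t k = fourier_coeff (\<lambda>x. u t x * ux x) k" for k
    proof -
      have "fourier_coeff (\<lambda>x. ut t x + u t x * ux x + u3 x - u5 x) k = fourier_coeff (\<lambda>x. 0) k"
        by (rule fourier_coeff_cong_AE[OF _ _ ae])
           (use i in \<open>auto intro!: borel_measurable_integrable\<close>)
      moreover have "fourier_coeff (\<lambda>x. ut t x + u t x * ux x + u3 x - u5 x) k
         = fourier_coeff (ut t) k + fourier_coeff (\<lambda>x. u t x * ux x) k + fourier_coeff u3 k - fourier_coeff u5 k"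
        using i by (simp add: fourier_coeff_add fourier_coeff_diff)
      ultimately have "fourier_coeff (ut t) k + fourier_coeff (\<lambda>x. u t x * ux x) k + fourier_coeff u3 k - fourier_coeff u5 k = 0"
        by (simp add: fourier_coeff_mode)
      then have "fourier_coeff (\<lambda>x. u t x * ux x) k = ((\<i> * of_int k) ^ 5 - (\<i> * of_int k) ^ 3) * fourier_coeff (u t) k - fourier_coeff (ut t) k"
        unfolding fourier_coeff_weak_deriv[OF w(2)] fourier_coeff_weak_deriv[OF w(3)]
        by (simp add: algebra_simps)
      then show ?thesis by (simp only: n_def disp_symbol)
    qed
    then show ?thesis using w(1) by blast
  qed
  moreover have "((\<lambda>s. fourier_coeff (u s) k) has_vector_derivative
        (\<i> * of_real (disp k) * fourier_coeff (u t) k - n t k)) (at t within {0..})" if "0 \<le> t" for t k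
    using d[OF that] by (simp add: n_def)
  ultimately show ?thesis by blast
qed

text \<open>Of the two weights in \<open>wl1 2\<close>, one is spent on the derivative
  \<open>ux\<close>, the other on the decay 1/K of its tail.\<close>

lemma nonlinearity_approx:
  assumes u: "u \<in> L2" and w: "weak_deriv 1 u ux" and K: "1 \<le> K"
    and M: "\<And>n. wl1 2 (int n) (fourier_coeff u) \<le> M"
  shows "cmod (fourier_coeff (\<lambda>x. u x * ux x) k
     - \<i> * of_int k / 2 * conv K (cutoff K (fourier_coeff u)) (cutoff K (fourier_coeff u)) k) \<le> 2 * M ^ 2 / real_of_int K"
proof -
  let ?a = "fourier_coeff u"
  have ux: "ux \<in> L2" using w by (simp add: weak_deriv_def)
  have b: "fourier_coeff ux = (\<lambda>j. \<i> * of_int j * ?a j)"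
    by (rule ext) (simp add: fourier_coeff_weak_deriv[OF w])
  have M1: "wl1 s (int n) ?a \<le> M" if "s \<le> 2" for s n
    using wl1_mono[OF that] M by (rule order_trans)
  have Mb: "wl1 s (int n) (fourier_coeff ux) \<le> M" if "s \<le> 1" for s n
  proof -
    have "wl1 s (int n) (fourier_coeff ux) \<le> wl1 (Suc s) (int n) ?a"
      unfolding wl1_sum
    proof (rule sum_mono)
      fix j
      have "wt j ^ s * (\<bar>real_of_int j\<bar> * cmod (?a j)) \<le> wt j ^ s * (wt j * cmod (?a j))"
        using wt_pos[of j] by (intro mult_left_mono mult_right_mono abs_le_wt) auto
      then show "wt j ^ s * cmod (fourier_coeff ux j) \<le> wt j ^ Suc s * cmod (?a j)"
        unfolding b by (simp add: norm_mult mult_ac)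
    qed
    then show ?thesis using M1[of "Suc s" n] that by simp
  qed
  have K0: "0 < real_of_int K" using K by simp
  have tail: "l1 (int n) (\<lambda>k. c k - cutoff K c k) \<le> M / real_of_int K" if "wl1 1 (int n) c \<le> M" for c n
  proof -
    have "l1 (int n) (\<lambda>k. c k - cutoff K c k) \<le> wl1 1 (int n) c / real_of_int K ^ 1"
      by (rule l1_tail) (use K in \<open>auto simp: cutoff_def wt_def split: if_splits\<close>)
    also have "\<dots> \<le> M / real_of_int K ^ 1" using K0 that by (intro divide_right_mono) auto
    finally show ?thesis by simp
  qed
  have "cmod (fourier_coeff (\<lambda>x. u x * ux x) k - conv K (cutoff K ?a) (cutoff K (fourier_coeff ux)) k)
      \<le> M / real_of_int K * M + M * (M / real_of_int K)"
    by (rule fourier_coeff_mult_approx[OF u ux])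
       (use K M1[of 0] Mb[of 0] M1[of 1] Mb[of 1] tail in \<open>auto simp: wl1_0\<close>)
  also have "cutoff K (fourier_coeff ux) = (\<lambda>j. \<i> * of_int j * cutoff K ?a j)"
    unfolding b by (auto simp: cutoff_def)
  also have "conv K (cutoff K ?a) (\<lambda>j. \<i> * of_int j * cutoff K ?a j) k = \<i> * of_int k / 2 * conv K (cutoff K ?a) (cutoff K ?a) k"
    by (rule conv_deriv_square[OF supp_cutoff])
  finally show ?thesis by (simp add: power2_eq_square)
qed

lemma semidiscrete_fourier:
  assumes sol: "semidiscrete_solution N u0 U" and u0: "u0 \<in> L2"
  defines "c \<equiv> \<lambda>t. fourier_coeff (U t)"
  shows "\<And>t. 0 \<le> t \<Longrightarrow> supp (int N) (c t)" "\<And>t. 0 \<le> t \<Longrightarrow> herm (c t)"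
    "\<And>t k. 0 \<le> t \<Longrightarrow> ((\<lambda>s. c s k) has_vector_derivative flow1 (int N) (c t) k) (at t within {0..})"
    "\<And>k. \<bar>k\<bar> \<le> int N \<Longrightarrow> c 0 k = fourier_coeff u0 k"
proof -
  have U: "U t \<in> trig_space N" "real_valued (U t)" if "0 \<le> t" for t
    using sol that by (auto simp: semidiscrete_solution_def)
  obtain Ut where Ut: "\<And>t. 0 \<le> t \<Longrightarrow> Ut t \<in> trig_space N"
    "\<And>t. 0 \<le> t \<Longrightarrow> has_curve_deriv l2_norm U (Ut t) t"
    "\<And>t \<phi>. 0 \<le> t \<Longrightarrow> \<phi> \<in> trig_space N \<Longrightarrow>
        l2_inner (\<lambda>x. Ut t x + U t x * dx (U t) x + (dx ^^ 3) (U t) x - (dx ^^ 5) (U t) x) \<phi> = 0"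
    using sol unfolding semidiscrete_solution_def by blast
  show s: "supp (int N) (c t)" if "0 \<le> t" for t
    unfolding c_def by (rule supp_fourier_trig[OF U(1)[OF that]])
  show "herm (c t)" if "0 \<le> t" for t
    unfolding c_def by (rule herm_fourier_coeff[OF U(2)[OF that]])
  show "c 0 k = fourier_coeff u0 k" if "\<bar>k\<bar> \<le> int N" for k
  proof -
    have "U 0 = trig_proj N u0" using sol by (simp add: semidiscrete_solution_def)
    then show ?thesis
      unfolding c_def trig_proj_eq[OF u0] using that by (simp add: fourier_coeff_tsum cutoff_def)
  qed
  fix t :: real and k assume t: "0 \<le> t"
  have "((\<lambda>s. c s k) has_vector_derivative fourier_coeff (Ut t) k) (at t within {0..})"
    unfolding c_def
  proof (rule coeff_has_derivative[OF Ut(2)[OF t] t])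
    show "U s \<in> L2" if "0 \<le> s" for s by (rule trig_space_L2[OF U(1)[OF that]])
    show "Ut t \<in> L2" by (rule trig_space_L2[OF Ut(1)[OF t]])
    fix s :: real assume s: "0 \<le> s"
    have "(\<lambda>x. (1 / of_real (s - t)) * (U s x + (-1) * U t x) + (-1) * Ut t x) \<in> trig_space N"
      by (intro trig_space_add trig_space_scale U Ut t s)
    then have "(\<lambda>x. (U s x - U t x) / of_real (s - t) - Ut t x) \<in> trig_space N" by simp
    then show "cmod (fourier_coeff (\<lambda>x. (U s x - U t x) / of_real (s - t) - Ut t x) k)
      \<le> l2_norm (\<lambda>x. (U s x - U t x) / of_real (s - t) - Ut t x)"
      by (rule norm_fourier_coeff_trig_le)
  qed
  moreover have "fourier_coeff (Ut t) k = flow1 (int N) (c t) k"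
  proof (cases "\<bar>k\<bar> \<le> int N")
    case True
    from Ut(3)[OF t mode_trig_space[OF True]]
    have "fourier_coeff (\<lambda>x. Ut t x + U t x * dx (U t) x + (dx ^^ 3) (U t) x - (dx ^^ 5) (U t) x) k = 0"
      by (simp add: l2_inner_mode)
    then show ?thesis
      unfolding fourier_coeff_rhs[OF U(1)[OF t] trig_space_L2[OF Ut(1)[OF t]] True] c_def by simp
  next
    case False
    then show ?thesis
      using s[OF t] supp_fourier_trig[OF Ut(1)[OF t]] supp_flow(1)[OF s[OF t]] by (auto simp: supp_def)
  qed
  ultimately show "((\<lambda>s. c s k) has_vector_derivative flow1 (int N) (c t) k) (at t within {0..})" by simp
qed

lemma leapfrog_fourier:
  assumes sol: "leapfrog_solution N M h V"
  defines "v \<equiv> \<lambda>m. fourier_coeff (V m)"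
  shows "\<And>m. m \<le> M \<Longrightarrow> V m \<in> trig_space N" "\<And>m. m \<le> M \<Longrightarrow> supp (int N) (v m)" "\<And>m. m \<le> M \<Longrightarrow> herm (v m)"
    "\<And>m k. 1 \<le> m \<Longrightarrow> m + 1 \<le> M \<Longrightarrow> \<bar>k\<bar> \<le> int N \<Longrightarrow> v (m + 1) k - v (m - 1) k = 2 * of_real h * flow1 (int N) (v m) k"
proof -
  show V: "V m \<in> trig_space N" if "m \<le> M" for m
    using sol that by (auto simp: leapfrog_solution_def)
  have real: "real_valued (V m)" if "m \<le> M" for m
    using sol that by (auto simp: leapfrog_solution_def)
  show "supp (int N) (v m)" if "m \<le> M" for m
    unfolding v_def by (rule supp_fourier_trig[OF V[OF that]])
  show "herm (v m)" if "m \<le> M" for m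
    unfolding v_def by (rule herm_fourier_coeff[OF real[OF that]])
  fix m k assume m: "1 \<le> m" "m + 1 \<le> M" and k: "\<bar>k\<bar> \<le> int N"
  have mM: "m \<le> M" "m - 1 \<le> M" using m by auto
  have mi: "m \<in> {1..M - 1}" using m by auto
  have "l2_inner (\<lambda>x. V (m + 1) x - V (m - 1) x) (mode k)
        + 2 * of_real h * l2_inner (\<lambda>x. V m x * dx (V m) x + (dx ^^ 3) (V m) x - (dx ^^ 5) (V m) x) (mode k) = 0"
    using sol mi mode_trig_space[OF k] unfolding leapfrog_solution_def by blast
  moreover have "fourier_coeff (\<lambda>x. V (m + 1) x - V (m - 1) x) k = v (m + 1) k - v (m - 1) k"
    unfolding v_def using trig_space_L2[OF V[OF m(2)]] trig_space_L2[OF V[OF mM(2)]]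
    by (simp add: fourier_coeff_diff L2_integrable)
  moreover have "fourier_coeff (\<lambda>x. V m x * dx (V m) x + (dx ^^ 3) (V m) x - (dx ^^ 5) (V m) x) k = - flow1 (int N) (v m) k"
    using fourier_coeff_rhs[OF V[OF mM(1)] L2_zero k] by (simp add: v_def fourier_coeff_mode)
  ultimately have "2 * of_real pi * (v (m + 1) k - v (m - 1) k - 2 * of_real h * flow1 (int N) (v m) k) = 0"
    unfolding l2_inner_mode by (simp add: algebra_simps)
  then show "v (m + 1) k - v (m - 1) k = 2 * of_real h * flow1 (int N) (v m) k" by simp
qed

section \<open>The error estimate\<close>

lemma spatial_error:
  assumes sol: "kawahara_solution r u0 u" and u0: "u0 \<in> L2" and T: "0 \<le> T" and r: "16 \<le> r"
  shows "\<exists>M\<ge>1. (\<forall>t\<in>{0..T}. \<forall>n. wl1 15 (int n) (fourier_coeff (u t)) \<le> M \<and> wl2 r (int n) (fourier_coeff (u t)) \<le> M) \<and>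
    (\<forall>N U t. 1 \<le> N \<longrightarrow> semidiscrete_solution N u0 U \<longrightarrow> t \<in> {0..T} \<longrightarrow>
      l2 (int N) (\<lambda>k. fourier_coeff (U t) k - fourier_coeff (u t) k) \<le> spatial_const r M T / real N ^ r)"
proof -
  define a where "a t = fourier_coeff (u t)" for t
  have us: "u t \<in> sobolev r" "real_valued (u t)" if "0 \<le> t" for t using sol that by (auto simp: kawahara_solution_def)
  have "curve_continuous (sobolev_norm r) u" using sol by (simp add: kawahara_solution_def)
  from curve_bounded[OF us(1) this, of T] obtain B where B: "0 \<le> B" "\<And>t. t \<in> {0..T} \<Longrightarrow> sobolev_norm r (u t) \<le> B"
    by blast
  obtain n where da: "\<And>t k. 0 \<le> t \<Longrightarrow> ((\<lambda>s. a s k) has_vector_derivative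
        (\<i> * of_real (disp k) * a t k - n t k)) (at t within {0..})"
    and n: "\<And>t. 0 \<le> t \<Longrightarrow> \<exists>ux. weak_deriv 1 (u t) ux \<and> (\<forall>k. n t k = fourier_coeff (\<lambda>x. u t x * ux x) k)"
    using kawahara_fourier[OF sol] unfolding a_def by blast
  \<comment> \<open>The root of 2^r compares (1 + \<bar>k\<bar>)^2 with 2(1 + k^2), the factor 2 is
    that of \<open>wl1_le_wl2\<close>, and 1 is added to ensure M >= 1.\<close>
  define M where "M = 2 * (sqrt (2 ^ r) * B) + 1"
  have sB: "0 \<le> sqrt (2 ^ r) * B" using B(1) by simp
  have M1: "1 \<le> M" unfolding M_def using sB by simp
  have w2: "wl2 r K (a t) \<le> sqrt (2 ^ r) * B" if "t \<in> {0..T}" for t K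
    unfolding a_def using that
    by (intro order_trans[OF wl2_sobolev[OF us(1)]] mult_left_mono B) auto
  have wl2M: "wl2 r K (a t) \<le> M" if "t \<in> {0..T}" for t K
    using w2[OF that, of K] sB unfolding M_def by linarith
  have wl1M: "wl1 15 (int n) (a t) \<le> M" if t: "t \<in> {0..T}" for t n
  proof -
    have "wl1 15 (int n) (a t) \<le> 2 * wl2 16 (int n) (a t)" using wl1_le_wl2[of 15 n "a t"] by simp
    also have "\<dots> \<le> 2 * wl2 r (int n) (a t)" using wl2_mono[OF r] by simp
    also have "\<dots> \<le> M" using w2[OF t, of "int n"] unfolding M_def by linarith
    finally show ?thesis .
  qed
  have spat: "l2 (int N) (\<lambda>k. fourier_coeff (U t) k - a t k) \<le> spatial_const r M T / real N ^ r"
    if N: "1 \<le> N" and semi: "semidiscrete_solution N u0 U" and t: "t \<in> {0..T}" for N U t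
  proof -
    define c where "c t = fourier_coeff (U t)" for t
    note C = semidiscrete_fourier[OF semi u0, folded c_def]
    \<comment> \<open>The ceiling turns the error 2 M^2 / K of \<open>nonlinearity_approx\<close>
      into at most N^(-(r + 1)), as \<open>n_close\<close> demands. \<open>K\<close> depends on N,
      but it does not enter \<open>spatial_const\<close>.\<close>
    define K where "K = 3 * int N + \<lceil>2 * M ^ 2 * real N ^ (r + 1)\<rceil>"
    have Mpos: "0 < 2 * M ^ 2 * real N ^ (r + 1)" using M1 N by simp
    then have cp: "0 < \<lceil>2 * M ^ 2 * real N ^ (r + 1)\<rceil>" by simp
    have K: "3 * int N \<le> K" "1 \<le> K" unfolding K_def using cp N by linarith+
    have KM: "2 * M ^ 2 * real N ^ (r + 1) \<le> real_of_int K"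
    proof (rule order_trans[OF le_of_int_ceiling])
      show "real_of_int \<lceil>2 * M ^ 2 * real N ^ (r + 1)\<rceil> \<le> real_of_int K" by (simp add: K_def)
    qed
    obtain p where p: "K = int p" using K(2) zero_le_imp_eq_int[of K] by auto
    have prof: "profile (int N) K r M (cutoff K (a s)) (n s)" if s: "0 \<le> s" "s \<le> T" for s
    proof
      have s': "s \<in> {0..T}" using s by simp
      show "1 \<le> int N" "3 * int N \<le> K" "1 \<le> M" "supp K (cutoff K (a s))"
        using N K M1 by (auto simp: supp_cutoff)
      have "wl1 1 K (cutoff K (a s)) = wl1 1 K (a s)" unfolding wl1_sum by (rule sum.cong) (auto simp: cutoff_def)
      also have "\<dots> \<le> wl1 15 K (a s)" by (rule wl1_mono) simp
      also have "\<dots> \<le> M" unfolding p by (rule wl1M[OF s'])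
      finally show "wl1 1 K (cutoff K (a s)) \<le> M" .
      have "wl2 r K (cutoff K (a s)) = wl2 r K (a s)" unfolding wl2_def by (rule l2_cong) (auto simp: cutoff_def)
      then show "wl2 r K (cutoff K (a s)) \<le> M" using wl2M[OF s'] by simp
      fix k
      obtain ux where ux: "weak_deriv 1 (u s) ux" "n s k = fourier_coeff (\<lambda>x. u s x * ux x) k"
        using n[OF s(1)] by blast
      have "cmod (n s k - \<i> * of_int k / 2 * conv K (cutoff K (a s)) (cutoff K (a s)) k) \<le> 2 * M ^ 2 / real_of_int K"
        unfolding ux(2) a_def
      proof (rule nonlinearity_approx[OF _ ux(1) K(2)])
        show "u s \<in> L2" using us(1)[OF s(1)] by (rule sobolevD)
        show "wl1 2 (int n) (fourier_coeff (u s)) \<le> M" for n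
          using order_trans[OF wl1_mono[of 2 15] wl1M[OF s', of n]] by (simp add: a_def)
      qed
      also have "\<dots> \<le> 1 / real_of_int (int N) ^ (r + 1)"
        using KM K(2) N by (simp add: divide_le_eq le_divide_eq mult.commute)
      finally show "cmod (n s k - \<i> * of_int k / 2 * conv K (cutoff K (a s)) (cutoff K (a s)) k) \<le> 1 / real_of_int (int N) ^ (r + 1)" .
    qed
    have "l2 (int N) (\<lambda>k. c t k - cutoff K (a t) k) \<le> spatial_const r M T / real_of_int (int N) ^ r"
    proof (rule galerkin_error[where T = T and K = K and n = n and a = "\<lambda>t. cutoff K (a t)"])
      show "1 \<le> int N" "1 \<le> M" "0 \<le> t" "t \<le> T" using N M1 t by auto
      fix s :: real assume s: "0 \<le> s" "s \<le> T"
      show "profile (int N) K r M (cutoff K (a s)) (n s)" by (rule prof[OF s])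
      show "herm (cutoff K (a s))" unfolding a_def by (intro herm_cutoff herm_fourier_coeff us s)
      show "herm (c s)" by (rule C(2)[OF s(1)])
      show "supp (int N) (c s)" by (rule C(1)[OF s(1)])
      fix k :: int
      {
        assume k: "\<bar>k\<bar> \<le> 3 * int N"
        have "((\<lambda>s. a s k) has_vector_derivative (\<i> * of_real (disp k) * a s k - n s k)) (at s within {0..T})"
          by (rule has_vector_derivative_within_subset[OF da[OF s(1)]]) auto
        then show "((\<lambda>s. cutoff K (a s) k) has_vector_derivative (\<i> * of_real (disp k) * cutoff K (a s) k - n s k)) (at s within {0..T})"
          using k K(1) by (simp add: cutoff_def)
      next
        assume k: "\<bar>k\<bar> \<le> int N"
        have "((\<lambda>s. c s k) has_vector_derivative flow1 (int N) (c s) k) (at s within {0..T})"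
          by (rule has_vector_derivative_within_subset[OF C(3)[OF s(1)]]) auto
        then show "((\<lambda>s. c s k) has_vector_derivative
          (\<i> * of_real (disp k) * c s k - \<i> * of_int k / 2 * conv (int N) (c s) (c s) k)) (at s within {0..T})"
          using k by (simp add: flow1_def cutoff_def)
      }
    next
      fix k assume k: "\<bar>k\<bar> \<le> int N"
      have "AE x in circ. u 0 x = u0 x" using sol by (simp add: kawahara_solution_def)
      then have "a 0 k = fourier_coeff u0 k"
        unfolding a_def by (intro fourier_coeff_cong_AE L2_measurable u0 sobolevD(1)[OF us(1)]) simp_all
      then show "c 0 k = cutoff K (a 0) k" using C(4)[OF k] k K by (simp add: cutoff_def)
    qed
    moreover have "l2 (int N) (\<lambda>k. c t k - cutoff K (a t) k) = l2 (int N) (\<lambda>k. c t k - a t k)"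
      by (rule l2_cong) (use K in \<open>auto simp: cutoff_def\<close>)
    ultimately show ?thesis by (simp add: c_def)
  qed
  show ?thesis using M1 wl1M wl2M spat unfolding a_def by blast
qed

text \<open>An inverse inequality: the weight is at most 2N, which gives 15 powers, and the passage
  from l1 to l2 gives the sixteenth.\<close>

lemma wl1_le_l2:
  assumes "1 \<le> N"
  shows "wl1 15 (int N) f \<le> 2 ^ 16 * real N ^ 16 * l2 (int N) f"
proof -
  have "wl1 15 (int N) f \<le> (2 * real N) ^ 15 * l1 (int N) f"
    unfolding wl1_def
  proof (rule l1_mono)
    fix k assume "\<bar>k\<bar> \<le> int N"
    then have "wt k \<le> 2 * real N" using assms unfolding wt_def by linarith
    then have "wt k ^ 15 * cmod (f k) \<le> (2 * real N) ^ 15 * cmod (f k)"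
      using wt_pos[of k] by (intro mult_right_mono power_mono) auto
    then show "cmod (of_real (wt k ^ 15) * f k) \<le> (2 * real N) ^ 15 * cmod (f k)"
      unfolding cmod_wt_power_mult .
  qed
  also have "\<dots> \<le> (2 * real N) ^ 15 * (2 * real N * l2 (int N) f)"
    using l1_le_l2[of "int N" f] assms by (intro mult_left_mono) auto
  also have "\<dots> = 2 ^ 16 * real N ^ 16 * l2 (int N) f" by (simp add: power_mult_distrib eval_nat_numeral)
  finally show ?thesis .
qed

text \<open>Outside [-K, K] the sequence \<open>b\<close> vanishes and only the tail of
  \<open>f\<close> is left.\<close>

lemma l2_split:
  assumes "supp K (\<lambda>k. b k)" 
  shows "l2 n (\<lambda>k. f k - b k) \<le> l2 K (\<lambda>k. f k - b k) + l2 n (\<lambda>k. f k - cutoff K f k)"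
proof -
  have "l2 n (\<lambda>k. f k - b k) = l2 n (\<lambda>k. cutoff K (\<lambda>k. f k - b k) k + (f k - cutoff K f k))"
    by (rule l2_cong) (use assms in \<open>auto simp: cutoff_def supp_def\<close>)
  also have "\<dots> \<le> l2 n (cutoff K (\<lambda>k. f k - b k)) + l2 n (\<lambda>k. f k - cutoff K f k)"
    by (rule l2_triangle)
  also have "l2 n (cutoff K (\<lambda>k. f k - b k)) \<le> l2 K (cutoff K (\<lambda>k. f k - b k))"
    by (rule l2_supp_le[OF supp_cutoff])
  also have "\<dots> = l2 K (\<lambda>k. f k - b k)" by (rule l2_cong) (simp add: cutoff_def)
  finally show ?thesis by simp
qed

theorem mainTheorem3:
  fixes T C0 :: real and r :: nat
    and u0 :: "real \<Rightarrow> complex"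
    and u :: "real \<Rightarrow> real \<Rightarrow> complex"
    and U :: "nat \<Rightarrow> real \<Rightarrow> real \<Rightarrow> complex"
  assumes "0 < T" and "16 \<le> r" and "0 < C0"
    and "u0 \<in> sobolev r" and "real_valued u0"
    and "kawahara_solution r u0 u"
    and "\<And>N. 1 \<le> N \<Longrightarrow> semidiscrete_solution N u0 (U N)"
  shows "\<exists>C1>0. \<exists>C>0. \<forall>(N::nat) (M::nat) (dt::real) (V :: nat \<Rightarrow> real \<Rightarrow> complex).
     1 \<le> N \<and> 1 \<le> M \<and> dt = T / real M \<and> real N ^ 5 * dt \<le> C1 \<and>
     leapfrog_solution N M dt V \<and>
     V 0 = U N 0 \<and> l2_norm (\<lambda>x. V 1 x - U N dt x) \<le> C0 * dt ^ 2
     \<longrightarrow> Max ((\<lambda>m. l2_norm (\<lambda>x. u (real m * dt) x - V m x)) ` {0..M})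
           \<le> C * (1 / real N ^ r + dt ^ 2)"
proof -
  have u0: "u0 \<in> L2" using assms(4) by (rule sobolevD)
  have us: "u t \<in> sobolev r" if "0 \<le> t" for t using assms(6) that by (auto simp: kawahara_solution_def)
  obtain B where B: "1 \<le> B"
    and wl1B: "\<And>t n. t \<in> {0..T} \<Longrightarrow> wl1 15 (int n) (fourier_coeff (u t)) \<le> B"
    and wl2B: "\<And>t n. t \<in> {0..T} \<Longrightarrow> wl2 r (int n) (fourier_coeff (u t)) \<le> B"
    and spat: "\<And>N U t. 1 \<le> N \<Longrightarrow> semidiscrete_solution N u0 U \<Longrightarrow> t \<in> {0..T} \<Longrightarrow>
      l2 (int N) (\<lambda>k. fourier_coeff (U t) k - fourier_coeff (u t) k) \<le> spatial_const r B T / real N ^ r"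
    using spatial_error[OF assms(6) u0 less_imp_le[OF assms(1)] assms(2)] by blast
  define CS where "CS = spatial_const r B T"
  have CS0: "0 \<le> CS" unfolding CS_def spatial_const_def using assms(1) by simp
  \<comment> \<open>Applied to the spatial error, the inverse inequality gives 2^16 CS N^(16 - r); r
    >= 16 makes this bounded in N, and \<open>B\<close> accounts for the exact solution.\<close>
  define K0 where "K0 = B + 2 ^ 16 * CS"
  have K0: "1 \<le> K0" unfolding K0_def using B CS0 by simp
  define CL where "CL = lf_const K0 C0 T"
  have CL0: "0 \<le> CL" unfolding CL_def lf_const_def using K0 assms(1,3) by simp
  have wl1U: "wl1 15 (int N) (fourier_coeff (U N t)) \<le> K0" if N: "1 \<le> N" and t: "t \<in> {0..T}" for N t
  proof -
    let ?e = "\<lambda>k. fourier_coeff (U N t) k - fourier_coeff (u t) k"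
    have Npos: "0 < real N" using N by simp
    have "wl1 15 (int N) ?e \<le> 2 ^ 16 * real N ^ 16 * l2 (int N) ?e" by (rule wl1_le_l2[OF N])
    also have "\<dots> \<le> 2 ^ 16 * real N ^ 16 * (CS / real N ^ r)"
      unfolding CS_def by (intro mult_left_mono spat N t assms(7)) auto
    also have "\<dots> = 2 ^ 16 * CS * (real N ^ 16 / real N ^ r)" by simp
    also have "\<dots> \<le> 2 ^ 16 * CS * 1"
    proof (intro mult_left_mono)
      have "real N ^ 16 \<le> real N ^ r" using N assms(2) by (intro power_increasing) auto
      then show "real N ^ 16 / real N ^ r \<le> 1" using Npos by simp
    qed (use CS0 in auto)
    finally have 1: "wl1 15 (int N) ?e \<le> 2 ^ 16 * CS" by simp
    have "wl1 15 (int N) (fourier_coeff (U N t)) = wl1 15 (int N) (\<lambda>k. ?e k + fourier_coeff (u t) k)" by simp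
    also have "\<dots> \<le> wl1 15 (int N) ?e + wl1 15 (int N) (fourier_coeff (u t))"
      unfolding wl1_def distrib_left by (rule l1_triangle)
    also have "\<dots> \<le> 2 ^ 16 * CS + B" using 1 wl1B[OF t, of N] by linarith
    finally show ?thesis by (simp add: K0_def)
  qed
  \<comment> \<open>The three contributions are the spatial error, the modes of u above N and the
    time error; the root of 2 pi converts coefficients into L2 norms.\<close>
  define C where "C = sqrt (2 * pi) * (CS + B + CL) + 1"
  have C0: "0 < C" unfolding C_def using CS0 CL0 B by (intro add_nonneg_pos mult_nonneg_nonneg) auto
  have main: "l2_norm (\<lambda>x. u (real m * dt) x - V m x) \<le> C * (1 / real N ^ r + dt ^ 2)"
    if N: "1 \<le> N" and M: "1 \<le> M" and dt: "dt = T / real M" and cfl: "real N ^ 5 * dt \<le> lf_step K0 C0 T"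
      and lf: "leapfrog_solution N M dt V" and V0: "V 0 = U N 0"
      and V1: "l2_norm (\<lambda>x. V 1 x - U N dt x) \<le> C0 * dt ^ 2" and m: "m \<le> M" for N M dt V m
  proof -
    define c where "c t = fourier_coeff (U N t)" for t
    define v where "v m = fourier_coeff (V m)" for m
    note S = semidiscrete_fourier[OF assms(7)[OF N] u0, folded c_def]
    note L = leapfrog_fourier[OF lf, folded v_def]
    have dt0: "0 < dt" using dt assms(1) M by simp
    have MT: "real M * dt = T" using dt M by simp
    have dtT: "dt \<le> T"
      using MT mult_right_mono[of 1 "real M" dt] M dt0 by simp
    interpret leapfrog "int N" dt K0 C0 T M c v
    proof
      show "1 \<le> int N" "0 < dt" "0 \<le> T" "real M * dt \<le> T" "1 \<le> K0" "0 \<le> C0"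
        using N dt0 assms(1,3) MT K0 by auto
      show "real_of_int (int N) ^ 5 * dt \<le> lf_step K0 C0 T" using cfl by simp
      show "v 0 k = c 0 k" for k by (simp add: v_def c_def V0)
      show "l2 (int N) (\<lambda>k. c dt k - v 1 k) \<le> C0 * dt ^ 2"
      proof -
        have tr: "V 1 \<in> trig_space N" "U N dt \<in> trig_space N"
          using L(1)[OF M] assms(7)[OF N] dt0 by (auto simp: semidiscrete_solution_def)
        have "(\<lambda>x. V 1 x - U N dt x) = tsum (int N) (\<lambda>k. v 1 k - c dt k)"
          by (subst trig_space_tsum[OF tr(1)], subst trig_space_tsum[OF tr(2)])
             (simp add: tsum_def[abs_def] v_def c_def left_diff_distrib sum_subtractf)
        then have "sqrt (2 * pi) * l2 (int N) (\<lambda>k. v 1 k - c dt k) \<le> C0 * dt ^ 2"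
          using V1 l2_norm_tsum[of "int N" "\<lambda>k. v 1 k - c dt k"] by simp
        \<comment> \<open>Since the root of 2 pi is at least 1, \<open>C0\<close> also bounds the
          starting error in terms of coefficients.\<close>
        moreover have "1 * l2 (int N) (\<lambda>k. v 1 k - c dt k) \<le> sqrt (2 * pi) * l2 (int N) (\<lambda>k. v 1 k - c dt k)"
          using pi_gt3 by (intro mult_right_mono l2_nonneg) (auto simp: real_le_rsqrt)
        moreover have "l2 (int N) (\<lambda>k. c dt k - v 1 k) = l2 (int N) (\<lambda>k. v 1 k - c dt k)"
          by (simp add: l2_def norm_minus_commute)
        ultimately show ?thesis by simp
      qed
      fix t :: real assume t: "0 \<le> t" "t \<le> T"
      show "supp (int N) (c t)" by (rule S(1)[OF t(1)])
      show "herm (c t)" by (rule S(2)[OF t(1)])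
      show "((\<lambda>s. c s k) has_vector_derivative flow1 (int N) (c t) k) (at t within {0..T})" for k
        by (rule has_vector_derivative_within_subset[OF S(3)[OF t(1)]]) auto
      show "wl1 15 (int N) (c t) \<le> K0" unfolding c_def using wl1U[OF N] t by simp
    qed (use L in auto)
    define t where "t = real m * dt"
    have t: "t \<in> {0..T}" "0 \<le> t" using tm[OF m] by (auto simp: tm_def t_def)
    define a where "a = fourier_coeff (u t)"
    have ut: "u t \<in> L2" using us[OF t(2)] by (rule sobolevD)
    have Vm: "V m \<in> L2" by (rule trig_space_L2[OF L(1)[OF m]])
    have d: "fourier_coeff (\<lambda>x. u t x - V m x) = (\<lambda>k. a k - v m k)"
      by (rule ext) (simp add: a_def v_def fourier_coeff_diff L2_integrable ut Vm)
    have e1: "l2 (int N) (\<lambda>k. a k - v m k) \<le> CS / real N ^ r + CL * dt ^ 2"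
    proof -
      have "l2 (int N) (\<lambda>k. a k - v m k) = l2 (int N) (\<lambda>k. (a k - c t k) + (c t k - v m k))" by simp
      also have "\<dots> \<le> l2 (int N) (\<lambda>k. a k - c t k) + l2 (int N) (\<lambda>k. c t k - v m k)" by (rule l2_triangle)
      also have "l2 (int N) (\<lambda>k. a k - c t k) = l2 (int N) (\<lambda>k. c t k - a k)"
        by (simp add: l2_def norm_minus_commute)
      also have "\<dots> \<le> CS / real N ^ r" unfolding CS_def c_def a_def by (rule spat[OF N assms(7)[OF N] t(1)])
      also have "l2 (int N) (\<lambda>k. c t k - v m k) \<le> CL * dt ^ 2"
        using leapfrog_error[OF m] by (simp add: CL_def tm_def t_def)
      finally show ?thesis by simp
    qed
    have e2: "l2 (int n) (\<lambda>k. a k - cutoff (int N) a k) \<le> B / real N ^ r" for n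
    proof -
      have "l2 (int n) (\<lambda>k. a k - cutoff (int N) a k) \<le> wl2 r (int n) a / real N ^ r"
        by (rule l2_tail) (use N in \<open>auto simp: cutoff_def wt_def split: if_splits\<close>)
      also have "\<dots> \<le> B / real N ^ r" unfolding a_def by (intro divide_right_mono wl2B t) auto
      finally show ?thesis .
    qed
    have "l2_norm (\<lambda>x. u t x - V m x) \<le> sqrt (2 * pi) * ((CS / real N ^ r + CL * dt ^ 2) + B / real N ^ r)"
    proof (rule parseval_le[OF L2_diff[OF ut Vm], unfolded d])
      show "l2 (int n) (\<lambda>k. a k - v m k) \<le> (CS / real N ^ r + CL * dt ^ 2) + B / real N ^ r" for n
        by (rule order_trans[OF l2_split[OF L(2)[OF m]] add_mono[OF e1 e2]])
      \<comment> \<open>A qualitative bound: it secures convergence of the series and does not enter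
        the estimate, so it may depend on N and m.\<close>
      show "l1 (int n) (\<lambda>k. a k - v m k) \<le> B + l1 (int N) (v m)" for n
      proof -
        have "l1 (int n) (\<lambda>k. a k - v m k) \<le> l1 (int n) a + l1 (int n) (v m)"
          using wl1_diff[of 0 "int n" a "v m"] by (simp add: wl1_0)
        moreover have "l1 (int n) a \<le> B"
          using wl1_mono[of 0 15 "int n" a] wl1B[OF t(1), of n] by (simp add: wl1_0 a_def)
        moreover have "l1 (int n) (v m) \<le> l1 (int N) (v m)" by (rule l1_supp_le[OF L(2)[OF m]])
        ultimately show ?thesis by linarith
      qed
    qed
    also have "\<dots> = sqrt (2 * pi) * ((CS + B) * (1 / real N ^ r) + CL * dt ^ 2)"
      by (simp add: add_divide_distrib)
    also have "\<dots> \<le> sqrt (2 * pi) * ((CS + B + CL) * (1 / real N ^ r) + (CS + B + CL) * dt ^ 2)"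
    proof -
      have "CS + B \<le> CS + B + CL" "CL \<le> CS + B + CL" using CS0 CL0 B by auto
      note le = add_mono[OF mult_right_mono[OF this(1)] mult_right_mono[OF this(2)]]
      show ?thesis by (intro mult_left_mono le) auto
    qed
    also have "\<dots> = (sqrt (2 * pi) * (CS + B + CL)) * (1 / real N ^ r + dt ^ 2)"
      by (simp only: mult.assoc distrib_left[of "CS + B + CL" "1 / real N ^ r" "dt ^ 2"])
    also have "\<dots> \<le> C * (1 / real N ^ r + dt ^ 2)"
      unfolding C_def by (intro mult_right_mono) auto
    finally show ?thesis by (simp add: t_def)
  qed
  have step: "0 < lf_step K0 C0 T"
    unfolding lf_step_def lf_rate_def using K0 CL0 unfolding CL_def
    by (intro divide_pos_pos add_pos_nonneg) auto
  show ?thesis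
  proof (rule exI[of _ "lf_step K0 C0 T"], rule conjI[OF step], rule exI[of _ C], rule conjI[OF C0], intro allI impI)
    fix N M :: nat and dt :: real and V :: "nat \<Rightarrow> real \<Rightarrow> complex"
    assume H: "1 \<le> N \<and> 1 \<le> M \<and> dt = T / real M \<and> real N ^ 5 * dt \<le> lf_step K0 C0 T \<and>
     leapfrog_solution N M dt V \<and> V 0 = U N 0 \<and> l2_norm (\<lambda>x. V 1 x - U N dt x) \<le> C0 * dt ^ 2"
    show "Max ((\<lambda>m. l2_norm (\<lambda>x. u (real m * dt) x - V m x)) ` {0..M}) \<le> C * (1 / real N ^ r + dt ^ 2)"
    proof (rule Max.boundedI)
      fix y assume "y \<in> (\<lambda>m. l2_norm (\<lambda>x. u (real m * dt) x - V m x)) ` {0..M}"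
      then show "y \<le> C * (1 / real N ^ r + dt ^ 2)" using main H by auto
    qed auto
  qed
qed

end
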